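(* Let $\Omega\subset\mathbb{R}^N$ be a bounded domain, let $2\le p<N$, let $0<\lambda<\mathcal{H}^p$ where $\mathcal{H}=\frac{N-p}{p}$, and let $f,g\in L^1(\Omega)$ with $g\ge 0$. Suppose there is $M>0$ such that $$|f(x)|\le M g(x)\quad\text{for a.e. }x\in\Omega.$$ Then the Dirichlet problem $$\begin{cases}-\operatorname{div}(|Du|^{p-2}Du)+g(x)u=\dfrac{\lambda}{|x|^p}|u|^{p-2}u+f & \text{in }\Omega,\\ u=0 & \text{on }\partial\Omega,\end{cases}$$ has a weak solution $u\in W_0^{1,p}(\Omega)$. Moreover, $u\in L^s(\Omega)$ for any $s\in[p^*,s_\lambda)$, where $s_\lambda$ is the unique solution in $[p^*,\infty)$ of the equation $$\lambda=\frac{\mathcal{H}^p\left[p\left(\frac{s_\lambda}{p^*}-1\right)+1\right]}{\left(\frac{s_\lambda}{p^*}\right)^p}.$$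
   Context: $W_0^{1,p}(\Omega)$ is the closure of $C_0^\infty(\Omega)$ in the usual Sobolev space $W^{1,p}(\Omega)$, and $p^*=\frac{pN}{N-p}$. A weak solution is $u\in W_0^{1,p}(\Omega)$ such that $g(x)u\in L^1(\Omega)$ and, for every $\varphi\in W_0^{1,p}(\Omega)\cap L^\infty(\Omega)$, $$\int_\Omega |Du|^{p-2}Du\cdot D\varphi+\int_\Omega g(x)u\,\varphi=\int_\Omega\frac{\lambda}{|x|^p}|u|^{p-2}u\,\varphi+\int_\Omega f\varphi .$$ *)

theory Defs
  imports "HOL-Analysis.Analysis"
begin

text \<open>
  Elements of the function spaces over \<open>\<Omega>\<close> are represented by total functions of which only the
  values on \<open>\<Omega>\<close>, up to a null set, matter; no quotient is taken. The measure on \<open>\<Omega>\<close> is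
  \<^term>\<open>lebesgue_on \<Omega>\<close>, and \<open>L\<^sup>1(\<Omega>)\<close> is \<^term>\<open>integrable (lebesgue_on \<Omega>)\<close>.
\<close>

subsection \<open>Lebesgue spaces\<close>

definition Lp_space :: "real \<Rightarrow> 'a::euclidean_space set \<Rightarrow> ('a \<Rightarrow> 'b::euclidean_space) set" where
  "Lp_space p \<Omega> = {u. u \<in> borel_measurable (lebesgue_on \<Omega>) \<and>
                      integrable (lebesgue_on \<Omega>) (\<lambda>x. norm (u x) powr p)}"

definition Linf_space :: "'a::euclidean_space set \<Rightarrow> ('a \<Rightarrow> real) set" where
  "Linf_space \<Omega> = {u. u \<in> borel_measurable (lebesgue_on \<Omega>) \<and>
                      (\<exists>C. AE x in lebesgue_on \<Omega>. \<bar>u x\<bar> \<le> C)}"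

definition locally_integrable :: "'a::euclidean_space set \<Rightarrow> ('a \<Rightarrow> 'b::euclidean_space) \<Rightarrow> bool" where
  "locally_integrable \<Omega> u \<longleftrightarrow> (\<forall>K. compact K \<and> K \<subseteq> \<Omega> \<longrightarrow> integrable (lebesgue_on K) u)"

subsection \<open>Test functions\<close>

definition partial_deriv :: "'a::euclidean_space \<Rightarrow> ('a \<Rightarrow> real) \<Rightarrow> 'a \<Rightarrow> real" where
  "partial_deriv i f = (\<lambda>x. frechet_derivative f (at x) i)"

primrec Ck :: "nat \<Rightarrow> ('a::euclidean_space \<Rightarrow> real) \<Rightarrow> bool" where
  "Ck 0 f \<longleftrightarrow> continuous_on UNIV f"
| "Ck (Suc k) f \<longleftrightarrow> (\<forall>x. f differentiable (at x)) \<and> (\<forall>i\<in>Basis. Ck k (partial_deriv i f))"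

text \<open>\<open>C\<^sub>0\<^sup>\<infinity>(\<Omega>)\<close>, each function being extended by zero to the whole space.\<close>

definition test_functions :: "'a::euclidean_space set \<Rightarrow> ('a \<Rightarrow> real) set" where
  "test_functions \<Omega> = {\<phi>. (\<forall>k. Ck k \<phi>) \<and> compact (closure {x. \<phi> x \<noteq> 0}) \<and>
                          closure {x. \<phi> x \<noteq> 0} \<subseteq> \<Omega>}"

subsection \<open>Sobolev spaces\<close>

definition has_weak_gradient ::
    "'a::euclidean_space set \<Rightarrow> ('a \<Rightarrow> real) \<Rightarrow> ('a \<Rightarrow> 'a) \<Rightarrow> bool" where
  "has_weak_gradient \<Omega> u v \<longleftrightarrow> locally_integrable \<Omega> u \<and> locally_integrable \<Omega> v \<and>
     (\<forall>\<phi>\<in>test_functions \<Omega>. \<forall>i\<in>Basis.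
        (\<integral>x. u x * partial_deriv i \<phi> x \<partial>lebesgue_on \<Omega>) = - (\<integral>x. (v x \<bullet> i) * \<phi> x \<partial>lebesgue_on \<Omega>))"

text \<open>
  For open \<open>\<Omega>\<close> a weak gradient is unique up to a null set, so the representative chosen here is
  immaterial. It is meaningful only where a weak gradient exists.
\<close>

definition weak_grad :: "'a::euclidean_space set \<Rightarrow> ('a \<Rightarrow> real) \<Rightarrow> 'a \<Rightarrow> 'a" where
  "weak_grad \<Omega> u = (SOME v. has_weak_gradient \<Omega> u v)"

definition sobolev_W :: "real \<Rightarrow> 'a::euclidean_space set \<Rightarrow> ('a \<Rightarrow> real) set" where
  "sobolev_W p \<Omega> = {u. u \<in> Lp_space p \<Omega> \<and> (\<exists>v. has_weak_gradient \<Omega> u v \<and> v \<in> Lp_space p \<Omega>)}"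

definition sobolev_norm :: "real \<Rightarrow> 'a::euclidean_space set \<Rightarrow> ('a \<Rightarrow> real) \<Rightarrow> real" where
  "sobolev_norm p \<Omega> u =
     ((\<integral>x. \<bar>u x\<bar> powr p \<partial>lebesgue_on \<Omega>) +
      (\<integral>x. norm (weak_grad \<Omega> u x) powr p \<partial>lebesgue_on \<Omega>)) powr (1 / p)"

definition sobolev_W0 :: "real \<Rightarrow> 'a::euclidean_space set \<Rightarrow> ('a \<Rightarrow> real) set" where
  "sobolev_W0 p \<Omega> = {u \<in> sobolev_W p \<Omega>.
     \<forall>\<epsilon>>0. \<exists>\<phi>\<in>test_functions \<Omega>. sobolev_norm p \<Omega> (\<lambda>x. u x - \<phi> x) < \<epsilon>}"

subsection \<open>The Dirichlet problem\<close>

text \<open>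
  The four integrability requirements only say that the integrals in the equation exist; they guard
  against the value 0 that the Bochner integral takes on non-integrable functions. Where the base of
  \<open>powr (p - 2)\<close> vanishes, the factor next to it vanishes too, so \<open>0 powr 0 = 0\<close> does no harm.
\<close>

definition weak_solution ::
    "real \<Rightarrow> real \<Rightarrow> 'a::euclidean_space set \<Rightarrow> ('a \<Rightarrow> real) \<Rightarrow> ('a \<Rightarrow> real) \<Rightarrow> ('a \<Rightarrow> real) \<Rightarrow> bool" where
  "weak_solution p lam \<Omega> g f u \<longleftrightarrow>
     u \<in> sobolev_W0 p \<Omega> \<and>
     integrable (lebesgue_on \<Omega>) (\<lambda>x. g x * u x) \<and>
     (\<forall>\<phi> \<in> sobolev_W0 p \<Omega> \<inter> Linf_space \<Omega>.
        let A = (\<lambda>x. (norm (weak_grad \<Omega> u x) powr (p - 2) *\<^sub>R weak_grad \<Omega> u x) \<bullet> weak_grad \<Omega> \<phi> x);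
            B = (\<lambda>x. g x * u x * \<phi> x);
            C = (\<lambda>x. lam / norm x powr p * (\<bar>u x\<bar> powr (p - 2) * u x) * \<phi> x);
            F = (\<lambda>x. f x * \<phi> x)
        in integrable (lebesgue_on \<Omega>) A \<and> integrable (lebesgue_on \<Omega>) B \<and>
           integrable (lebesgue_on \<Omega>) C \<and> integrable (lebesgue_on \<Omega>) F \<and>
           (\<integral>x. A x \<partial>lebesgue_on \<Omega>) + (\<integral>x. B x \<partial>lebesgue_on \<Omega>) =
           (\<integral>x. C x \<partial>lebesgue_on \<Omega>) + (\<integral>x. F x \<partial>lebesgue_on \<Omega>))"

subsection \<open>Exponents\<close>

definition sobolev_conj :: "real \<Rightarrow> real \<Rightarrow> real" where
  "sobolev_conj N p = p * N / (N - p)"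

definition hardy_H :: "real \<Rightarrow> real \<Rightarrow> real" where
  "hardy_H N p = (N - p) / p"

definition s_lambda_eqn :: "real \<Rightarrow> real \<Rightarrow> real \<Rightarrow> real \<Rightarrow> bool" where
  "s_lambda_eqn N p lam s \<longleftrightarrow>
     lam = hardy_H N p powr p * (p * (s / sobolev_conj N p - 1) + 1) / (s / sobolev_conj N p) powr p"

definition s_lambda :: "real \<Rightarrow> real \<Rightarrow> real \<Rightarrow> real" where
  "s_lambda N p lam = (THE s. s \<ge> sobolev_conj N p \<and> s_lambda_eqn N p lam s)"

end

theory Submission
  imports Defs
begin

text \<open>
  The exponent \<open>\<alpha> = N / s\<^sub>\<lambda>\<close> is the smaller root of \<open>\<alpha>\<^sup>p\<^sup>-\<^sup>1 (N - p - \<alpha> (p - 1)) = \<lambda>\<close>, so that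
  \<open>W = A |x|\<^sup>-\<^sup>\<alpha>\<close> satisfies \<open>- \<Delta>\<^sub>p W = \<lambda> W\<^sup>p\<^sup>-\<^sup>1 / |x|\<^sup>p\<close>, and for \<open>A\<close> large \<open>W \<ge> M\<close> on \<open>\<Omega>\<close>. Because
  \<open>|f| \<le> M g\<close>, the zero-order term \<open>g u - f\<close> is nonnegative wherever \<open>u \<ge> W\<close>, hence \<open>W\<close> and \<open>- W\<close>
  are a super- and a subsolution. For a given right-hand side \<open>h\<close> in place of the Hardy term the problem
  is monotone; it is solved by minimising a strictly convex energy, where Clarkson's inequality
  (\<open>p \<ge> 2\<close>) makes minimising sequences converge strongly. Iterating \<open>u \<mapsto> \<lambda> |u|\<^sup>p\<^sup>-\<^sup>2 u / |x|\<^sup>p\<close> from \<open>- W\<close>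
  gives an increasing sequence between \<open>- W\<close> and \<open>W\<close>, whose limit is a solution, and \<open>|u| \<le> W\<close> yields
  \<open>u \<in> L\<^sup>s\<close> as soon as \<open>\<alpha> s < N\<close>. No compactness and no Hardy or Sobolev inequality is needed.
\<close>

subsection \<open>Smooth functions\<close>

text \<open>The barrier \<open>W\<close> is singular at the origin, while truncation arguments call
  for smooth barriers. So (|x|^2 + \<epsilon>)^(-\<alpha>/2) is used instead of |x|^(-\<alpha>):
  regularising only adds a positive term to the right-hand side, which stays bounded for each
  \<epsilon> and tends to that of \<open>W\<close>. Solutions are compared with these smooth
  barriers, and \<epsilon> goes to 0 only in the solutions. The smaller root matters because it is
  the one with \<alpha> < (N - p)/p, that is \<alpha> p + p < N: this is exactly integrability of
  W^p / |x|^p, and that single integral dominates every Hardy term that occurs. A second obstacle is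
  that g is merely integrable, so g u \<phi> has to be controlled through the integral of g u^2,
  whose finiteness becomes part of the solution space. Bounded test functions satisfy it, and since
  W \<ge> M > 0 they are also dominated by a multiple of \<open>W\<close>, which makes them
  admissible in the limit equation. Strong convergence of the gradients, which the nonlinear flux
  demands, always comes from uniform monotonicity of a \<mapsto> |a|^(p-2) a.\<close>

definition grad :: "('a::euclidean_space \<Rightarrow> real) \<Rightarrow> 'a \<Rightarrow> 'a" where
  "grad f x = (\<Sum>i\<in>Basis. partial_deriv i f x *\<^sub>R i)"

lemma GDERIV_partial_deriv: "GDERIV f x :> D \<Longrightarrow> partial_deriv i f x = D \<bullet> i"
  unfolding gderiv_def partial_deriv_def
  by (metis frechet_derivative_at inner_commute)

lemma GDERIV_imp_grad: "GDERIV f x :> D \<Longrightarrow> grad f x = D"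
  unfolding grad_def by (simp add: GDERIV_partial_deriv euclidean_representation)

lemma GDERIV_grad:
  fixes f :: "'a::euclidean_space \<Rightarrow> real"
  assumes "f differentiable (at x)"
  shows "GDERIV f x :> grad f x"
proof -
  from assms have d: "(f has_derivative frechet_derivative f (at x)) (at x)"
    by (simp add: frechet_derivative_works)
  then interpret linear "frechet_derivative f (at x)" by (rule has_derivative_linear)
  have "frechet_derivative f (at x) h = h \<bullet> grad f x" for h
  proof -
    have "frechet_derivative f (at x) h = frechet_derivative f (at x) (\<Sum>i\<in>Basis. (h \<bullet> i) *\<^sub>R i)"
      by (simp add: euclidean_representation)
    also have "\<dots> = (\<Sum>i\<in>Basis. (h \<bullet> i) * frechet_derivative f (at x) i)"
      by (simp add: sum scale)
    finally show ?thesis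
      by (simp add: grad_def partial_deriv_def inner_sum_right mult.commute)
  qed
  then show ?thesis using d unfolding gderiv_def by (metis (no_types, lifting) has_derivative_eq_rhs ext)
qed

lemma grad_inner_Basis: "i \<in> Basis \<Longrightarrow> grad f x \<bullet> i = partial_deriv i f x"
  unfolding grad_def by (simp add: inner_sum_left_Basis)

lemma GDERIV_imp_differentiable: "GDERIV f x :> D \<Longrightarrow> f differentiable (at x)"
  unfolding gderiv_def differentiable_def by blast

lemma GDERIV_imp_continuous_on: "(\<And>x. GDERIV f x :> D x) \<Longrightarrow> continuous_on S f"
  using GDERIV_imp_differentiable by (metis differentiable_imp_continuous_within continuous_at_imp_continuous_on)

text \<open>Lets the inductions on k run on an explicit gradient field, so that the product and
  chain rules for \<open>GDERIV\<close> apply and \<open>frechet_derivative\<close> never has to be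
  computed.\<close>

lemma Ck_SucI:
  assumes "\<And>x. GDERIV f x :> D x" "\<And>i. i \<in> Basis \<Longrightarrow> Ck k (\<lambda>x. D x \<bullet> i)"
  shows "Ck (Suc k) f"
proof -
  have "partial_deriv i f = (\<lambda>x. D x \<bullet> i)" for i
    using GDERIV_partial_deriv[OF assms(1)] by auto
  moreover have "f differentiable (at x)" for x
    using assms(1) by (rule GDERIV_imp_differentiable)
  ultimately show ?thesis using assms(2) by auto
qed

lemma Ck_SucD: "Ck (Suc k) f \<Longrightarrow> Ck k f"
proof (induction k arbitrary: f)
  case 0
  then show ?case
    by (auto intro!: continuous_at_imp_continuous_on differentiable_imp_continuous_within)
next
  case (Suc k)
  then show ?case by (metis Ck.simps(2))
qed

lemma Ck_GDERIV: "Ck (Suc k) f \<Longrightarrow> GDERIV f x :> grad f x"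
  by (simp add: GDERIV_grad)

lemma Ck_grad: "Ck (Suc k) f \<Longrightarrow> i \<in> Basis \<Longrightarrow> Ck k (\<lambda>x. grad f x \<bullet> i)"
  by (simp add: grad_inner_Basis)

lemma Ck_const: "Ck k (\<lambda>x. c)"
  by (induction k arbitrary: c) (auto intro!: Ck_SucI[where D="\<lambda>x. 0"] GDERIV_const simp del: Ck.simps(2))

lemma Ck_inner_const: "Ck k (\<lambda>x. x \<bullet> c)"
proof (cases k)
  case (Suc n)
  have "GDERIV (\<lambda>x. x \<bullet> c) x :> c" for x
    unfolding gderiv_def by (auto intro!: derivative_eq_intros)
  then show ?thesis unfolding Suc by (rule Ck_SucI) (rule Ck_const)
qed (auto intro!: continuous_intros)

lemma Ck_add: "Ck k f \<Longrightarrow> Ck k g \<Longrightarrow> Ck k (\<lambda>x. f x + g x)"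
proof (induction k arbitrary: f g)
  case (Suc k)
  have "GDERIV (\<lambda>x. f x + g x) x :> grad f x + grad g x" for x
    using Suc.prems by (intro GDERIV_add Ck_GDERIV)
  then show ?case
    by (rule Ck_SucI) (use Suc in \<open>auto simp: inner_add_left simp del: Ck.simps(2) intro!: Suc.IH Ck_grad\<close>)
qed (auto intro!: continuous_intros)

lemma Ck_mult: "Ck k f \<Longrightarrow> Ck k g \<Longrightarrow> Ck k (\<lambda>x. f x * g x)"
proof (induction k arbitrary: f g)
  case (Suc k)
  have "GDERIV (\<lambda>x. f x * g x) x :> f x *\<^sub>R grad g x + g x *\<^sub>R grad f x" for x
    using Suc.prems by (intro GDERIV_mult Ck_GDERIV)
  then show ?case
    by (rule Ck_SucI) (use Suc in \<open>auto simp: inner_add_left simp del: Ck.simps(2) intro!: Ck_add Suc.IH Ck_grad intro: Ck_SucD\<close>)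
qed (auto intro!: continuous_intros)

lemma Ck_cmult: "Ck k f \<Longrightarrow> Ck k (\<lambda>x. c * f x)"
  by (intro Ck_mult Ck_const)

lemma Ck_diff: "Ck k f \<Longrightarrow> Ck k g \<Longrightarrow> Ck k (\<lambda>x. f x - g x)"
  using Ck_add[of k f "\<lambda>x. -1 * g x"] Ck_cmult[of k g "-1"] by simp

lemma Ck_sum: "(\<And>i. i \<in> I \<Longrightarrow> Ck k (f i)) \<Longrightarrow> Ck k (\<lambda>x. \<Sum>i\<in>I. f i x)"
  by (induction I rule: infinite_finite_induct) (auto intro!: Ck_const Ck_add)

lemma Ck_prod: "(\<And>i. i \<in> I \<Longrightarrow> Ck k (f i)) \<Longrightarrow> Ck k (\<lambda>x. \<Prod>i\<in>I. f i x)"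
  by (induction I rule: infinite_finite_induct) (auto intro!: Ck_const Ck_mult)

lemma Ck_inner_self: "Ck k (\<lambda>x::'a::euclidean_space. x \<bullet> x)"
proof -
  have "Ck k (\<lambda>x::'a. \<Sum>i\<in>Basis. (x \<bullet> i) * (x \<bullet> i))"
    by (intro Ck_sum Ck_mult Ck_inner_const)
  then show ?thesis by (subst euclidean_inner)
qed

text \<open>A whole sequence \<open>d\<close> of successive derivatives is taken, with n arbitrary
  in the induction, because the gradient of \<open>d n\<close> after f is \<open>d (Suc n)\<close>
  after f times the gradient of f. Restricting to values in \<open>S\<close> admits real powers,
  which are smooth only on the positive axis.\<close>

lemma Ck_compose:
  assumes "\<And>n s. s \<in> S \<Longrightarrow> (d n has_real_derivative d (Suc n) s) (at s)" "\<And>x. f x \<in> S" "Ck k f"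
  shows "Ck k (\<lambda>x. d n (f x))"
  using assms(3)
proof (induction k arbitrary: n)
  case 0
  have "isCont (d n) s" if "s \<in> S" for s
    using assms(1)[OF that] by (rule DERIV_isCont)
  with 0 assms(2) show ?case
    by (auto intro!: continuous_on_compose2[of S "d n" UNIV f] intro: continuous_at_imp_continuous_on)
next
  case (Suc k)
  have "GDERIV (\<lambda>x. d n (f x)) x :> d (Suc n) (f x) *\<^sub>R grad f x" for x
    by (rule GDERIV_DERIV_compose[OF Ck_GDERIV[OF Suc.prems] assms(1)[OF assms(2)]])
  then show ?case
    by (rule Ck_SucI)
       (use Suc Ck_SucD[OF Suc.prems] in \<open>auto simp del: Ck.simps(2) intro!: Ck_mult Suc.IH Ck_grad\<close>)
qed

section \<open>Smooth approximations of the unit step and of the positive part\<close>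

definition smooth_step :: "real \<Rightarrow> real \<Rightarrow> real" where
  "smooth_step \<delta> s = (if s > 0 then exp (- \<delta> / s) else 0)"

text \<open>All derivatives of \<^const>\<open>smooth_step\<close> on the positive axis have the form \<open>P(1/s) exp(-\<delta>/s)\<close>.\<close>

primrec smooth_step_poly :: "real \<Rightarrow> nat \<Rightarrow> real poly" where
  "smooth_step_poly \<delta> 0 = 1"
| "smooth_step_poly \<delta> (Suc n) =
    [:0, 0, 1:] * (smult \<delta> (smooth_step_poly \<delta> n) - pderiv (smooth_step_poly \<delta> n))"

definition smooth_step_deriv :: "real \<Rightarrow> nat \<Rightarrow> real \<Rightarrow> real" where
  "smooth_step_deriv \<delta> n s =
    (if s > 0 then poly (smooth_step_poly \<delta> n) (1 / s) * exp (- \<delta> / s) else 0)"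

text \<open>With y = 1/s this says that every P(1/s) exp(-\<delta>/s) tends to 0 as s decreases to
  0, which is why all derivatives of the step fit together at the origin.\<close>

lemma poly_times_exp_neg_tendsto_0:
  assumes "\<delta> > 0"
  shows "((\<lambda>y. poly q y * exp (- \<delta> * y)) \<longlongrightarrow> (0::real)) at_top"
proof -
  have "((\<lambda>y. y ^ k * exp (- \<delta> * y)) \<longlongrightarrow> (0::real)) at_top" for k
  proof -
    have "filterlim (\<lambda>y. \<delta> * y) at_top at_top"
      using assms by (simp add: filterlim_tendsto_pos_mult_at_top[OF tendsto_const] filterlim_ident)
    then have "((\<lambda>y. (\<delta> * y) ^ k / exp (\<delta> * y)) \<longlongrightarrow> (0::real)) at_top"
      by (rule filterlim_compose[OF tendsto_power_div_exp_0])
    then have "((\<lambda>y. (1 / \<delta> ^ k) * ((\<delta> * y) ^ k / exp (\<delta> * y))) \<longlongrightarrow> (1 / \<delta> ^ k) * 0) at_top"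
      by (intro tendsto_intros)
    moreover have "(1 / \<delta> ^ k) * ((\<delta> * y) ^ k / exp (\<delta> * y)) = y ^ k * exp (- \<delta> * y)" for y
      using assms by (simp add: exp_minus field_simps)
    ultimately show ?thesis by simp
  qed
  then have "((\<lambda>y. \<Sum>k\<le>degree q. coeff q k * (y ^ k * exp (- \<delta> * y))) \<longlongrightarrow> (\<Sum>k\<le>degree q. coeff q k * 0)) at_top"
    by (intro tendsto_intros)
  then show ?thesis by (simp add: poly_altdef sum_distrib_right mult.assoc)
qed

lemma smooth_step_deriv_has_derivative:
  assumes "\<delta> > 0"
  shows "(smooth_step_deriv \<delta> n has_real_derivative smooth_step_deriv \<delta> (Suc n) s) (at s)"
proof -
  consider "s > 0" | "s < 0" | "s = 0" by linarith
  then show ?thesis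
  proof cases
    case 1
    have "((\<lambda>s. poly (smooth_step_poly \<delta> n) (1 / s) * exp (- \<delta> / s)) has_real_derivative
        smooth_step_deriv \<delta> (Suc n) s) (at s)"
      using 1 by (auto intro!: derivative_eq_intros poly_DERIV[THEN DERIV_chain2] simp: smooth_step_deriv_def field_simps power2_eq_square)
    then show ?thesis
      by (rule has_field_derivative_transform_within_open[of _ _ _ "{0<..}"])
         (use 1 in \<open>auto simp: smooth_step_deriv_def\<close>)
  next
    case 2
    have "((\<lambda>s. 0) has_real_derivative smooth_step_deriv \<delta> (Suc n) s) (at s)"
      using 2 by (auto simp: smooth_step_deriv_def)
    then show ?thesis
      by (rule has_field_derivative_transform_within_open[of _ _ _ "{..<0}"])
         (use 2 in \<open>auto simp: smooth_step_deriv_def\<close>)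
  next
    case 3
    \<comment> \<open>The extra polynomial factor y stands for the denominator h of the difference
      quotient at 0, with y = 1/h.\<close>
    have "((\<lambda>y. poly ([:0,1:] * smooth_step_poly \<delta> n) y * exp (- \<delta> * y)) \<longlongrightarrow> (0::real)) at_top"
      by (rule poly_times_exp_neg_tendsto_0[OF assms])
    from filterlim_compose[OF this filterlim_inverse_at_top_right]
    have "((\<lambda>h. smooth_step_deriv \<delta> n h / h) \<longlongrightarrow> 0) (at_right 0)"
      by (rule Lim_transform_eventually)
         (auto simp: eventually_at_filter smooth_step_deriv_def field_simps)
    moreover have "((\<lambda>h. smooth_step_deriv \<delta> n h / h) \<longlongrightarrow> 0) (at_left 0)"
      by (rule Lim_transform_eventually[OF tendsto_const])
         (auto simp: eventually_at_filter smooth_step_deriv_def)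
    ultimately have "((\<lambda>h. smooth_step_deriv \<delta> n h / h) \<longlongrightarrow> 0) (at 0)"
      by (simp add: filterlim_split_at)
    then show ?thesis unfolding 3 DERIV_def by (simp add: smooth_step_deriv_def)
  qed
qed

lemma smooth_step_has_derivative:
  assumes "\<delta> > 0"
  shows "(smooth_step \<delta> has_real_derivative (if s > 0 then \<delta> / s\<^sup>2 * exp (- \<delta> / s) else 0)) (at s)"
proof -
  have "smooth_step_deriv \<delta> 0 = smooth_step \<delta>"
    by (auto simp: smooth_step_deriv_def smooth_step_def)
  moreover have "smooth_step_deriv \<delta> (Suc 0) s = (if s > 0 then \<delta> / s\<^sup>2 * exp (- \<delta> / s) else 0)"
    by (auto simp: smooth_step_deriv_def power2_eq_square)
  ultimately show ?thesis using smooth_step_deriv_has_derivative[OF assms, of 0 s] by simp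
qed

lemma Ck_smooth_step:
  assumes "\<delta> > 0" "Ck k f"
  shows "Ck k (\<lambda>x. smooth_step \<delta> (f x))"
proof -
  have "smooth_step_deriv \<delta> 0 = smooth_step \<delta>"
    by (auto simp: smooth_step_deriv_def smooth_step_def)
  with Ck_compose[of UNIV "smooth_step_deriv \<delta>" f k 0] smooth_step_deriv_has_derivative[OF assms(1)] assms(2)
  show ?thesis by simp
qed

lemma smooth_step_bounds: "0 \<le> smooth_step \<delta> s" "\<delta> \<ge> 0 \<Longrightarrow> smooth_step \<delta> s \<le> 1"
  by (auto simp: smooth_step_def)

text \<open>A smooth stand-in for the positive part that is exactly 0 on the nonpositive axis, lies
  below the positive part and has slope between 0 and 1. The first property preserves compact
  supports, the other two provide majorants that do not depend on \<delta>.\<close>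

definition smooth_pos :: "real \<Rightarrow> real \<Rightarrow> real" where
  "smooth_pos \<delta> s = s * smooth_step \<delta> s"

definition smooth_pos' :: "real \<Rightarrow> real \<Rightarrow> real" where
  "smooth_pos' \<delta> s = (if s > 0 then (1 + \<delta> / s) * exp (- \<delta> / s) else 0)"

lemma smooth_pos_has_derivative:
  assumes "\<delta> > 0"
  shows "(smooth_pos \<delta> has_real_derivative smooth_pos' \<delta> s) (at s)"
  unfolding smooth_pos_def[abs_def]
  by (rule derivative_eq_intros smooth_step_has_derivative[OF assms] refl)+
     (auto simp: smooth_pos'_def smooth_step_def field_simps power2_eq_square)

lemma Ck_smooth_pos: "\<delta> > 0 \<Longrightarrow> Ck k f \<Longrightarrow> Ck k (\<lambda>x. smooth_pos \<delta> (f x))"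
  unfolding smooth_pos_def by (intro Ck_mult Ck_smooth_step)

lemma smooth_pos_bounds: "\<delta> \<ge> 0 \<Longrightarrow> 0 \<le> smooth_pos \<delta> s" "\<delta> \<ge> 0 \<Longrightarrow> smooth_pos \<delta> s \<le> max 0 s"
  by (auto simp: smooth_pos_def smooth_step_def mult_le_cancel_left2)

lemma smooth_pos'_bounds: 
  assumes "\<delta> \<ge> 0" shows "0 \<le> smooth_pos' \<delta> s" "smooth_pos' \<delta> s \<le> 1"
proof -
  have "(1 + y) * exp (- y) \<le> 1" for y :: real
    using exp_ge_add_one_self[of y] by (simp add: exp_minus field_simps)
  from this[of "\<delta> / s"] show "smooth_pos' \<delta> s \<le> 1" by (auto simp: smooth_pos'_def)
qed (use assms in \<open>auto simp: smooth_pos'_def\<close>)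

lemma smooth_pos'_isCont:
  assumes "\<delta> > 0" shows "isCont (smooth_pos' \<delta>) s"
proof -
  have "smooth_pos' \<delta> = (\<lambda>s. smooth_step \<delta> s + s * smooth_step_deriv \<delta> (Suc 0) s)"
    by (auto simp: smooth_pos'_def smooth_step_deriv_def smooth_step_def field_simps power2_eq_square)
  moreover have "isCont (smooth_step \<delta>) s" "isCont (smooth_step_deriv \<delta> (Suc 0)) s"
    using DERIV_isCont smooth_step_has_derivative smooth_step_deriv_has_derivative assms by blast+
  ultimately show ?thesis by (auto intro!: continuous_intros)
qed

lemma smooth_step_tendsto: "(\<lambda>n. smooth_step (1 / real (Suc n)) s) \<longlonglongrightarrow> (if s > 0 then 1 else 0)"
proof (cases "s > 0")
  case True
  have "(\<lambda>n. exp (- (1 / real (Suc n)) / s)) \<longlonglongrightarrow> exp (- 0 / s)"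
    using True by (intro tendsto_intros LIMSEQ_Suc[OF lim_1_over_n]) auto
  with True show ?thesis by (simp add: smooth_step_def)
qed (simp add: smooth_step_def)

lemma smooth_pos_tendsto: "(\<lambda>n. smooth_pos (1 / real (Suc n)) s) \<longlonglongrightarrow> max 0 s"
proof -
  have "(\<lambda>n. s * smooth_step (1 / real (Suc n)) s) \<longlonglongrightarrow> s * (if s > 0 then 1 else 0)"
    by (intro tendsto_intros smooth_step_tendsto)
  then show ?thesis by (cases "s > 0") (auto simp: smooth_pos_def max_def simp del: of_nat_Suc)
qed

text \<open>The limit is 0 at s = 0. This fixes the convention that the gradient of a positive part
  vanishes on the contact set.\<close>

lemma smooth_pos'_tendsto: "(\<lambda>n. smooth_pos' (1 / real (Suc n)) s) \<longlonglongrightarrow> (if s > 0 then 1 else 0)"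
proof (cases "s > 0")
  case True
  have "(\<lambda>n. (1 + (1 / real (Suc n)) / s) * exp (- (1 / real (Suc n)) / s)) \<longlonglongrightarrow> (1 + 0 / s) * exp (- 0 / s)"
    using True by (intro tendsto_intros LIMSEQ_Suc[OF lim_1_over_n]) auto
  with True show ?thesis by (simp add: smooth_pos'_def)
qed (simp add: smooth_pos'_def)

subsection \<open>Integration by parts\<close>

lemma bounded_subset_cball0:
  fixes K :: "'a::real_normed_vector set"
  assumes "bounded K"
  obtains R where "R > 0" "K \<subseteq> cball 0 R"
proof -
  from bounded_subset_ballD[OF assms, of 0] obtain R where "0 < R" "K \<subseteq> ball 0 R" by blast
  then show ?thesis using that[of R] ball_subset_cball[of 0 R] by blast
qed

lemma continuous_on_compact_abs_le:
  fixes f :: "'a::euclidean_space \<Rightarrow> 'b::real_normed_vector"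
  assumes "compact K" "continuous_on K f"
  obtains B where "B > 0" "\<And>x. x \<in> K \<Longrightarrow> norm (f x) \<le> B"
proof -
  have "bounded (f ` K)" using assms compact_continuous_image compact_imp_bounded by blast
  then obtain R where "R > 0" "f ` K \<subseteq> cball 0 R" by (rule bounded_subset_cball0)
  then show ?thesis by (intro that) auto
qed

lemma GDERIV_bounded_imp_lipschitz:
  fixes \<psi> :: "'a::euclidean_space \<Rightarrow> real"
  assumes "\<And>x. GDERIV \<psi> x :> G x" "\<And>x. norm (G x) \<le> B"
  shows "\<bar>\<psi> x - \<psi> y\<bar> \<le> B * norm (x - y)"
proof -
  have "norm (\<psi> x - \<psi> y) \<le> B * norm (x - y)"
  proof (rule differentiable_bound[where S=UNIV and f' = "\<lambda>x h. h \<bullet> G x"])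
    show "(\<psi> has_derivative (\<lambda>h. h \<bullet> G x)) (at x within UNIV)" for x
      using assms(1)[of x] by (simp add: gderiv_def)
    show "onorm (\<lambda>h. h \<bullet> G x) \<le> B" for x
    proof (rule onorm_bound)
      have "0 \<le> norm (G x)" by simp
      also have "\<dots> \<le> B" by (rule assms(2))
      finally show "0 \<le> B" .
      show "norm (h \<bullet> G x) \<le> B * norm h" for h
        using Cauchy_Schwarz_ineq2[of h "G x"] mult_left_mono[OF assms(2)[of x], of "norm h"]
        by (simp add: mult.commute)
    qed
  qed auto
  then show ?thesis by simp
qed

lemma GDERIV_directional:
  fixes \<psi> :: "'a::euclidean_space \<Rightarrow> real"
  assumes "GDERIV \<psi> x :> G"
  shows "((\<lambda>t. \<psi> (x + t *\<^sub>R i)) has_real_derivative (G \<bullet> i)) (at 0)"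
proof -
  have "((\<lambda>t. x + t *\<^sub>R i) has_derivative (\<lambda>t. t *\<^sub>R i)) (at 0)"
    by (auto intro!: derivative_eq_intros)
  moreover have "(\<psi> has_derivative (\<lambda>h. h \<bullet> G)) (at (x + 0 *\<^sub>R i))"
    using assms by (simp add: gderiv_def)
  ultimately have "((\<lambda>t. \<psi> (x + t *\<^sub>R i)) has_derivative (\<lambda>t. (t *\<^sub>R i) \<bullet> G)) (at 0)"
    by (rule has_derivative_compose)
  then show ?thesis
    unfolding has_field_derivative_def
    by (rule has_derivative_eq_rhs) (auto simp: inner_commute)
qed

lemma lborel_integral_translate:
  fixes \<psi> :: "'a::euclidean_space \<Rightarrow> real"
  assumes [measurable]: "\<psi> \<in> borel_measurable borel"
  shows "(\<integral>x. \<psi> (x + c) \<partial>lborel) = (\<integral>x. \<psi> x \<partial>lborel)"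
    "integrable lborel (\<lambda>x. \<psi> (x + c)) \<longleftrightarrow> integrable lborel \<psi>"
proof -
  show "(\<integral>x. \<psi> (x + c) \<partial>lborel) = (\<integral>x. \<psi> x \<partial>lborel)"
    by (subst (2) lborel_distr_plus[of c, symmetric])
       (auto simp: integral_distr add.commute)
  show "integrable lborel (\<lambda>x. \<psi> (x + c)) \<longleftrightarrow> integrable lborel \<psi>"
    by (subst (2) lborel_distr_plus[of c, symmetric])
       (auto simp: integrable_distr_eq add.commute)
qed

lemma integrable_lborel_bounded_support:
  fixes f :: "'a::euclidean_space \<Rightarrow> real"
  assumes [measurable]: "f \<in> borel_measurable borel" and "bounded K" "\<And>x. x \<notin> K \<Longrightarrow> f x = 0" "\<And>x. \<bar>f x\<bar> \<le> B"
  shows "integrable lborel f"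
proof -
  from \<open>bounded K\<close> obtain R where R: "K \<subseteq> cball 0 R" by (rule bounded_subset_cball0)
  have "integrable lborel (indicator (cball 0 R) :: 'a \<Rightarrow> real)"
    using emeasure_bounded_finite[OF bounded_cball] by (simp add: integrable_indicator_iff)
  then have "integrable lborel (\<lambda>x::'a. B * indicator (cball 0 R) x)" by simp
  then show ?thesis
  proof (rule Bochner_Integration.integrable_bound)
    show "AE x in lborel. norm (f x) \<le> norm (B * indicator (cball 0 R) x)"
      using assms(3,4) R
      by (intro AE_I2) (metis (mono_tags, opaque_lifting) abs_ge_self indicator_simps(1) mult.right_neutral
           norm_ge_zero norm_zero order_trans real_norm_def subsetD)
  qed auto
qed

text \<open>Difference quotients in direction i integrate to 0 by translation invariance. The
  Lipschitz bound dominates them by a constant on a fixed ball, so dominated convergence carries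
  this over to the derivative, for which boundedness is enough.\<close>

lemma integral_GDERIV_eq_0:
  fixes \<psi> :: "'a::euclidean_space \<Rightarrow> real"
  assumes gd: "\<And>x. GDERIV \<psi> x :> G x" and B: "\<And>x. norm (G x) \<le> B"
    and K: "compact K" "\<And>x. x \<notin> K \<Longrightarrow> \<psi> x = 0" and i: "i \<in> Basis"
  shows "integrable lborel (\<lambda>x. G x \<bullet> i)" "(\<integral>x. G x \<bullet> i \<partial>lborel) = 0"
proof -
  have cont: "continuous_on UNIV \<psi>"
    using GDERIV_imp_continuous_on[OF gd] .
  then have [measurable]: "\<psi> \<in> borel_measurable borel"
    by (rule borel_measurable_continuous_onI)
  obtain C where C0: "C > 0" "\<And>x. x \<in> K \<Longrightarrow> norm (\<psi> x) \<le> C"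
    using continuous_on_compact_abs_le[OF K(1) continuous_on_subset[OF cont]] by auto
  then have C: "\<bar>\<psi> x\<bar> \<le> C" for x by (cases "x \<in> K") (auto simp: K(2))
  have int: "integrable lborel \<psi>"
    by (rule integrable_lborel_bounded_support[where K=K and B=C])
       (use K C compact_imp_bounded in auto)
  define q where "q n x = (\<psi> (x + (1 / real (Suc n)) *\<^sub>R i) - \<psi> x) * real (Suc n)" for n x
  have qm[measurable]: "q n \<in> borel_measurable borel" for n unfolding q_def by measurable
  from compact_imp_bounded[OF K(1)] obtain R where R: "K \<subseteq> cball 0 R" by (rule bounded_subset_cball0)
  have Bpos: "0 \<le> B" using B[of 0] norm_ge_zero order_trans by blast
  have i1: "norm i = 1" using i by simp
  \<comment> \<open>The radius is R + 1 because the shifts have length 1 / (n + 1), at most 1: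
    further out, neither x nor the shifted point lies in \<open>K\<close>.\<close>
  have qb: "\<bar>q n x\<bar> \<le> B * indicator (cball 0 (R + 1)) x" for n x
  proof (cases "x \<in> cball 0 (R + 1)")
    case True
    have "\<bar>\<psi> (x + (1 / real (Suc n)) *\<^sub>R i) - \<psi> x\<bar> \<le> B * (1 / real (Suc n))"
      using GDERIV_bounded_imp_lipschitz[OF gd B, of "x + (1 / real (Suc n)) *\<^sub>R i" x] i1 by simp
    then have "\<bar>q n x\<bar> \<le> B * (1 / real (Suc n)) * real (Suc n)"
      unfolding q_def abs_mult by (intro mult_mono) auto
    with True show ?thesis by simp
  next
    case False
    then have n: "norm x > R + 1" by simp
    have "norm ((1 / real (Suc n)) *\<^sub>R i) \<le> 1" using i1 by simp
    then have "norm (x + (1 / real (Suc n)) *\<^sub>R i) > R"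
      using n norm_diff_ineq[of x "(1 / real (Suc n)) *\<^sub>R i"] by linarith
    then have "x + (1 / real (Suc n)) *\<^sub>R i \<notin> K" "x \<notin> K" using R n by auto
    then show ?thesis using False K(2) by (simp add: q_def)
  qed
  have qlim: "(\<lambda>n. q n x) \<longlonglongrightarrow> G x \<bullet> i" for x
  proof -
    have "((\<lambda>h. (\<psi> (x + h *\<^sub>R i) - \<psi> x) / h) \<longlongrightarrow> G x \<bullet> i) (at 0)"
      using GDERIV_directional[OF gd[of x], of i] unfolding DERIV_def by simp
    moreover have "filterlim (\<lambda>n. 1 / real (Suc n)) (at 0) sequentially"
      using LIMSEQ_Suc[OF lim_1_over_n] unfolding filterlim_at by auto
    ultimately have "(\<lambda>n. (\<psi> (x + (1 / real (Suc n)) *\<^sub>R i) - \<psi> x) / (1 / real (Suc n))) \<longlonglongrightarrow> G x \<bullet> i"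
      by (rule filterlim_compose)
    then show ?thesis by (simp add: q_def)
  qed
  have Gm[measurable]: "(\<lambda>x. G x \<bullet> i) \<in> borel_measurable borel"
    by (rule borel_measurable_LIMSEQ_real[OF qlim qm])
  have w: "integrable lborel (\<lambda>x::'a. B * indicator (cball 0 (R + 1)) x)"
    using emeasure_bounded_finite[OF bounded_cball] by (intro integrable_mult_right) (simp add: integrable_indicator_iff)
  show "integrable lborel (\<lambda>x. G x \<bullet> i)"
    by (rule integrable_dominated_convergence[where s=q, OF _ _ w]) (use qb qlim in auto)
  have "(\<lambda>n. integral\<^sup>L lborel (q n)) \<longlonglongrightarrow> (\<integral>x. G x \<bullet> i \<partial>lborel)"
    by (rule integral_dominated_convergence[OF _ _ w]) (use qb qlim in auto)
  moreover have "integral\<^sup>L lborel (q n) = 0" for n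
    unfolding q_def using lborel_integral_translate[of \<psi> "(1 / real (Suc n)) *\<^sub>R i"] int by simp
  ultimately show "(\<integral>x. G x \<bullet> i \<partial>lborel) = 0"
    by (simp add: LIMSEQ_const_iff)
qed

lemma lebesgue_on_eq_lborel:
  fixes F :: "'a::euclidean_space \<Rightarrow> real"
  assumes [measurable]: "F \<in> borel_measurable borel" and "\<And>x. x \<notin> \<Omega> \<Longrightarrow> F x = 0" "\<Omega> \<in> sets lebesgue"
  shows "integrable (lebesgue_on \<Omega>) F \<longleftrightarrow> integrable lborel F"
    "(\<integral>x. F x \<partial>lebesgue_on \<Omega>) = (\<integral>x. F x \<partial>lborel)"
proof -
  have e: "(\<lambda>x. if x \<in> \<Omega> then F x else 0) = F" using assms(2) by auto
  show "integrable (lebesgue_on \<Omega>) F \<longleftrightarrow> integrable lborel F"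
    using Lebesgue_Measure.integrable_restrict_UNIV[OF assms(3), of F] by (simp add: e integrable_completion)
  show "(\<integral>x. F x \<partial>lebesgue_on \<Omega>) = (\<integral>x. F x \<partial>lborel)"
    using Lebesgue_Measure.integral_restrict_UNIV[OF assms(3), of F] by (simp add: e integral_completion)
qed

lemma test_functionsI:
  assumes "\<And>k. Ck k \<phi>" "compact K" "K \<subseteq> \<Omega>" "\<And>x. x \<notin> K \<Longrightarrow> \<phi> x = 0"
  shows "\<phi> \<in> test_functions \<Omega>"
proof -
  have "closure {x. \<phi> x \<noteq> 0} \<subseteq> K"
    using assms(2,4) by (intro closure_minimal) (auto simp: compact_imp_closed)
  then show ?thesis
    unfolding test_functions_def using assms(1,2,3)
    by (auto simp: compact_closure intro: bounded_subset[OF compact_imp_bounded, OF assms(2)] closure_subset[THEN subsetD])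
qed

lemma test_functionsE:
  assumes "\<phi> \<in> test_functions \<Omega>"
  obtains K where "compact K" "K \<subseteq> \<Omega>" "\<And>x. x \<notin> K \<Longrightarrow> \<phi> x = 0" "\<And>x. x \<notin> K \<Longrightarrow> grad \<phi> x = 0"
proof
  let ?K = "closure {x. \<phi> x \<noteq> 0}"
  show "compact ?K" "?K \<subseteq> \<Omega>" using assms by (auto simp: test_functions_def)
  show z: "\<phi> x = 0" if "x \<notin> ?K" for x using that closure_subset[of "{x. \<phi> x \<noteq> 0}"] by blast
  show "grad \<phi> x = 0" if "x \<notin> ?K" for x
  proof (rule GDERIV_imp_grad)
    have "((\<lambda>x. 0) has_derivative (\<lambda>h. 0)) (at x)" by simp
    then have "(\<phi> has_derivative (\<lambda>h. 0)) (at x)"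
    proof (rule has_derivative_transform_within_open)
      show "open (- ?K)" by (simp add: open_Compl)
      show "x \<in> - ?K" using that by (rule Compl_iff[THEN iffD2])
      show "0 = \<phi> y" if "y \<in> - ?K" for y using z[OF ComplD[OF that]] by (rule sym)
    qed
    then show "GDERIV \<phi> x :> 0" by (simp add: gderiv_def)
  qed
qed

lemma test_functions_Ck: "\<phi> \<in> test_functions \<Omega> \<Longrightarrow> Ck k \<phi>"
  by (simp add: test_functions_def)

lemma test_functions_GDERIV: "\<phi> \<in> test_functions \<Omega> \<Longrightarrow> GDERIV \<phi> x :> grad \<phi> x"
  by (rule Ck_GDERIV[of 0]) (rule test_functions_Ck)

lemma test_functions_continuous: "\<phi> \<in> test_functions \<Omega> \<Longrightarrow> continuous_on S \<phi>"
  by (rule GDERIV_imp_continuous_on) (rule test_functions_GDERIV)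

lemma Ck_grad_continuous:
  assumes "Ck (Suc 0) f" shows "continuous_on S (grad f)"
proof -
  have "continuous_on UNIV (\<lambda>x. \<Sum>i\<in>Basis. (grad f x \<bullet> i) *\<^sub>R i)"
    using Ck_grad[OF assms] by (intro continuous_on_sum continuous_on_scaleR continuous_on_const) simp
  then have "continuous_on UNIV (grad f)" by (simp add: euclidean_representation)
  then show ?thesis by (rule continuous_on_subset) simp
qed

lemma test_functions_grad_continuous: "\<phi> \<in> test_functions \<Omega> \<Longrightarrow> continuous_on S (grad \<phi>)"
  by (rule Ck_grad_continuous) (rule test_functions_Ck)

lemma test_functions_bounded:
  assumes "\<phi> \<in> test_functions \<Omega>"
  obtains B where "\<And>x. \<bar>\<phi> x\<bar> \<le> B" "\<And>x. norm (grad \<phi> x) \<le> B" "B > 0"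
proof -
  from test_functionsE[OF assms] obtain K where
    K: "compact K" "\<And>x. x \<notin> K \<Longrightarrow> \<phi> x = 0" "\<And>x. x \<notin> K \<Longrightarrow> grad \<phi> x = 0" by metis
  obtain B1 where B1: "B1 > 0" "\<And>x. x \<in> K \<Longrightarrow> norm (\<phi> x) \<le> B1"
    using continuous_on_compact_abs_le[OF K(1) test_functions_continuous[OF assms]] by metis
  obtain B2 where B2: "B2 > 0" "\<And>x. x \<in> K \<Longrightarrow> norm (grad \<phi> x) \<le> B2"
    using continuous_on_compact_abs_le[OF K(1) test_functions_grad_continuous[OF assms]] by metis
  have "\<bar>\<phi> x\<bar> \<le> B1 + B2 \<and> norm (grad \<phi> x) \<le> B1 + B2" for x
  proof (cases "x \<in> K")
    case True
    show ?thesis using B1(1) B2(1) B1(2)[OF True] B2(2)[OF True] by simp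
  next
    case False
    show ?thesis using B1(1) B2(1) K(2,3)[OF False] by simp
  qed
  then show ?thesis using that[of "B1 + B2"] B1(1) B2(1) by simp
qed

text \<open>The previous result is applied to the product F \<phi>, which inherits the compact
  support of \<phi>. F is asked only for a locally bounded gradient, since it will also be a
  component of the flux of a radial barrier, which need not be smooth at the origin.\<close>

lemma test_functions_ibp:
  fixes F :: "'a::euclidean_space \<Rightarrow> real"
  assumes \<phi>: "\<phi> \<in> test_functions \<Omega>" and F: "\<And>x. GDERIV F x :> DF x"
    and bd: "\<And>R. \<exists>B. \<forall>x\<in>cball 0 R. norm (DF x) \<le> B" and \<Omega>: "\<Omega> \<in> sets lebesgue" and i: "i \<in> Basis"
  shows "integrable (lebesgue_on \<Omega>) (\<lambda>x. F x * partial_deriv i \<phi> x)"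
    "integrable (lebesgue_on \<Omega>) (\<lambda>x. (DF x \<bullet> i) * \<phi> x)"
    "(\<integral>x. F x * partial_deriv i \<phi> x \<partial>lebesgue_on \<Omega>) = - (\<integral>x. (DF x \<bullet> i) * \<phi> x \<partial>lebesgue_on \<Omega>)"
proof -
  from test_functionsE[OF \<phi>] obtain K where
    K: "compact K" "K \<subseteq> \<Omega>" "\<And>x. x \<notin> K \<Longrightarrow> \<phi> x = 0" "\<And>x. x \<notin> K \<Longrightarrow> grad \<phi> x = 0" by metis
  from compact_imp_bounded[OF K(1)] obtain R where R: "K \<subseteq> cball 0 R" by (rule bounded_subset_cball0)
  from test_functions_bounded[OF \<phi>] obtain B1 where B1: "\<And>x. \<bar>\<phi> x\<bar> \<le> B1" "\<And>x. norm (grad \<phi> x) \<le> B1" "B1 > 0" by metis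
  from bd[of R] obtain B2 where B2: "\<And>x. x \<in> K \<Longrightarrow> norm (DF x) \<le> B2" using R by blast
  have cF: "continuous_on S F" for S by (rule GDERIV_imp_continuous_on[OF F])
  obtain B3 where "\<And>x. x \<in> K \<Longrightarrow> norm (F x) \<le> B3"
    using continuous_on_compact_abs_le[OF K(1) cF] by metis
  then have B3: "\<And>x. x \<in> K \<Longrightarrow> \<bar>F x\<bar> \<le> B3" by simp
  let ?G = "\<lambda>x. F x *\<^sub>R grad \<phi> x + \<phi> x *\<^sub>R DF x"
  have gd: "GDERIV (\<lambda>x. F x * \<phi> x) x :> ?G x" for x
    by (rule GDERIV_mult[OF F test_functions_GDERIV[OF \<phi>]])
  have Gb: "norm (?G x) \<le> max 0 (B3 * B1 + B1 * B2)" for x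
  proof (cases "x \<in> K")
    case True
    have "norm (?G x) \<le> \<bar>F x\<bar> * norm (grad \<phi> x) + \<bar>\<phi> x\<bar> * norm (DF x)"
      by (rule norm_triangle_le) simp
    also have "\<dots> \<le> B3 * B1 + B1 * B2"
      using B1 B2[OF True] B3[OF True] by (intro add_mono mult_mono) (auto intro: order_trans[OF abs_ge_zero] less_imp_le)
    finally show ?thesis by simp
  qed (use K in auto)
  note z = integral_GDERIV_eq_0[OF gd Gb K(1) _ i]
  have [measurable]: "F \<in> borel_measurable borel" "\<phi> \<in> borel_measurable borel" "grad \<phi> \<in> borel_measurable borel"
    using cF test_functions_continuous[OF \<phi>] test_functions_grad_continuous[OF \<phi>]
    by (auto intro: borel_measurable_continuous_onI)
  have i1: "integrable lborel (\<lambda>x. F x * (grad \<phi> x \<bullet> i))"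
  proof (rule integrable_lborel_bounded_support)
    show "(\<lambda>x. F x * (grad \<phi> x \<bullet> i)) \<in> borel_measurable borel" by measurable
    show "bounded K" using K(1) by (rule compact_imp_bounded)
    show "F x * (grad \<phi> x \<bullet> i) = 0" if "x \<notin> K" for x using K(4)[OF that] by simp
    show "\<bar>F x * (grad \<phi> x \<bullet> i)\<bar> \<le> max 0 (B3 * B1)" for x
    proof (cases "x \<in> K")
      case True
      have "\<bar>grad \<phi> x \<bullet> i\<bar> \<le> B1" using B1(2)[of x] Basis_le_norm[OF i, of "grad \<phi> x"] by linarith
      then have "\<bar>F x * (grad \<phi> x \<bullet> i)\<bar> \<le> B3 * B1"
        unfolding abs_mult using B3[OF True] by (intro mult_mono) auto
      then show ?thesis by simp
    qed (use K(4) in auto)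
  qed
  have i2: "integrable lborel (\<lambda>x. ?G x \<bullet> i - F x * (grad \<phi> x \<bullet> i))"
    using z(1) i1 K(3) by (intro Bochner_Integration.integrable_diff) auto
  have e: "?G x \<bullet> i - F x * (grad \<phi> x \<bullet> i) = (DF x \<bullet> i) * \<phi> x" for x
    by (simp add: inner_add_left)
  note i2 = i2[unfolded e]
  from borel_measurable_integrable[OF i2] have [measurable]: "(\<lambda>x. (DF x \<bullet> i) * \<phi> x) \<in> borel_measurable borel" by simp
  have "(\<integral>x. ?G x \<bullet> i \<partial>lborel) = (\<integral>x. F x * (grad \<phi> x \<bullet> i) + (DF x \<bullet> i) * \<phi> x \<partial>lborel)"
    by (simp add: inner_add_left mult.commute)
  also have "\<dots> = (\<integral>x. F x * (grad \<phi> x \<bullet> i) \<partial>lborel) + (\<integral>x. (DF x \<bullet> i) * \<phi> x \<partial>lborel)"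
    using i1 i2 by simp
  finally have s: "(\<integral>x. F x * (grad \<phi> x \<bullet> i) \<partial>lborel) = - (\<integral>x. (DF x \<bullet> i) * \<phi> x \<partial>lborel)"
    using z(2) K(3) by simp
  have v: "F x * (grad \<phi> x \<bullet> i) = 0" "(DF x \<bullet> i) * \<phi> x = 0" if "x \<notin> \<Omega>" for x
  proof -
    from that K(2) have "x \<notin> K" by blast
    from K(3,4)[OF this] show "F x * (grad \<phi> x \<bullet> i) = 0" "(DF x \<bullet> i) * \<phi> x = 0" by simp_all
  qed
  have pd: "partial_deriv i \<phi> x = grad \<phi> x \<bullet> i" for x by (simp add: grad_inner_Basis i)
  note l1 = lebesgue_on_eq_lborel[of "\<lambda>x. F x * (grad \<phi> x \<bullet> i)", OF _ v(1) \<Omega>]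
  note l2 = lebesgue_on_eq_lborel[of "\<lambda>x. (DF x \<bullet> i) * \<phi> x", OF _ v(2) \<Omega>]
  show "integrable (lebesgue_on \<Omega>) (\<lambda>x. F x * partial_deriv i \<phi> x)"
    unfolding pd by (rule l1(1)[THEN iffD2, OF _ _ i1]) measurable
  show "integrable (lebesgue_on \<Omega>) (\<lambda>x. (DF x \<bullet> i) * \<phi> x)"
    by (rule l2(1)[THEN iffD2, OF _ _ i2]) measurable
  have "(\<integral>x. F x * (grad \<phi> x \<bullet> i) \<partial>lebesgue_on \<Omega>) = (\<integral>x. F x * (grad \<phi> x \<bullet> i) \<partial>lborel)"
    by (rule l1(2)) measurable
  moreover have "(\<integral>x. (DF x \<bullet> i) * \<phi> x \<partial>lebesgue_on \<Omega>) = (\<integral>x. (DF x \<bullet> i) * \<phi> x \<partial>lborel)"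
    by (rule l2(2)) measurable
  ultimately show "(\<integral>x. F x * partial_deriv i \<phi> x \<partial>lebesgue_on \<Omega>) = - (\<integral>x. (DF x \<bullet> i) * \<phi> x \<partial>lebesgue_on \<Omega>)"
    unfolding pd using s by simp
qed

subsection \<open>Uniqueness of weak gradients\<close>

text \<open>One pair of steps per coordinate, each facing one side of the box. The product vanishes
  off the open box and tends pointwise to its indicator, so integrals against test functions
  determine integrals over boxes.\<close>

definition smooth_box :: "nat \<Rightarrow> 'a \<Rightarrow> 'a \<Rightarrow> 'a::euclidean_space \<Rightarrow> real" where
  "smooth_box n a b x = (\<Prod>i\<in>Basis. smooth_step (1 / real (Suc n)) (x \<bullet> i - a \<bullet> i) *
     smooth_step (1 / real (Suc n)) (b \<bullet> i - x \<bullet> i))"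

lemma Ck_smooth_box: "Ck k (smooth_box n a b)"
  unfolding smooth_box_def[abs_def]
  by (intro Ck_prod Ck_mult Ck_smooth_step Ck_diff Ck_inner_const Ck_const) auto

lemma smooth_box_bounds: "0 \<le> smooth_box n a b x" "smooth_box n a b x \<le> 1"
  unfolding smooth_box_def
  by (auto intro!: prod_nonneg prod_le_1 mult_nonneg_nonneg mult_le_one smooth_step_bounds simp del: of_nat_Suc)

lemma smooth_box_eq_0: "x \<notin> box a b \<Longrightarrow> smooth_box n a b x = 0"
  unfolding smooth_box_def by (force simp: box_def smooth_step_def)

lemma smooth_box_tendsto: "(\<lambda>n. smooth_box n a b x) \<longlonglongrightarrow> indicator (box a b) x"
proof -
  have "(\<lambda>n. smooth_box n a b x) \<longlonglongrightarrow>
    (\<Prod>i\<in>Basis. (if x \<bullet> i - a \<bullet> i > 0 then 1 else 0) * (if b \<bullet> i - x \<bullet> i > 0 then 1 else 0))"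
    unfolding smooth_box_def by (intro tendsto_intros smooth_step_tendsto)
  moreover have "(\<Prod>i\<in>Basis. (if x \<bullet> i - a \<bullet> i > 0 then 1 else 0) * (if b \<bullet> i - x \<bullet> i > 0 then 1 else 0)) = (indicator (box a b) x :: real)"
    by (force simp: indicator_def box_def)
  ultimately show ?thesis by simp
qed

lemma smooth_box_test_function:
  assumes "cbox c d \<subseteq> \<Omega>" "box a b \<subseteq> cbox c d"
  shows "smooth_box n a b \<in> test_functions \<Omega>"
  using assms smooth_box_eq_0[of _ a b n]
  by (intro test_functionsI[of _ "cbox c d"] Ck_smooth_box) auto

lemma enn2real_cancel:
  assumes "enn2real a = enn2real b" "a \<noteq> top" "b \<noteq> top"
  shows "a = b"
proof -
  have "a = ennreal (enn2real a)" "b = ennreal (enn2real b)" using assms(2,3) by (simp_all add: less_top)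
  with assms(1) show ?thesis by simp
qed

text \<open>The positive and the negative part of f are densities of two measures that agree on
  boxes, an intersection-stable generator of the Borel sets. Hence the measures are equal, so are
  the densities almost everywhere, and f and -f have the same positive part only where f =
  0.\<close>

lemma AE_eq_0_if_integral_box_eq_0:
  fixes f :: "'a::euclidean_space \<Rightarrow> real"
  assumes f: "integrable lborel f" and 0: "\<And>a b. (\<integral>x. f x * indicator (box a b) x \<partial>lborel) = 0"
  shows "AE x in lborel. f x = 0"
proof -
  from f have [measurable]: "f \<in> borel_measurable borel" by auto
  let ?M = "density lborel (\<lambda>x. ennreal (f x))" and ?N = "density lborel (\<lambda>x. ennreal (- f x))"
  have fin: "(\<integral>\<^sup>+x. ennreal (f x) \<partial>lborel) < \<infinity>" "(\<integral>\<^sup>+x. ennreal (- f x) \<partial>lborel) < \<infinity>"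
    using f by (auto simp: real_integrable_def less_top)
  have "?M = ?N"
  proof (rule measure_eqI_generator_eq[where A="\<lambda>n. box (- (real n *\<^sub>R One)) (real n *\<^sub>R One)" and \<Omega>=UNIV])
    let ?E = "range (\<lambda>(a, b). box a b::'a set)"
    show "Int_stable ?E"
      by (auto simp: Int_stable_def box_Int_box)
    show "?E \<subseteq> Pow UNIV" "sets ?M = sigma_sets UNIV ?E" "sets ?N = sigma_sets UNIV ?E"
      by (simp_all add: borel_eq_box)
    show "range (\<lambda>n. box (- (real n *\<^sub>R One)) (real n *\<^sub>R One)) \<subseteq> ?E" by auto
    show "(\<Union>n. box (- (real n *\<^sub>R One)) (real n *\<^sub>R One)) = (UNIV::'a set)"
      by (rule UN_box_eq_UNIV)
    show "emeasure ?M (box (- (real n *\<^sub>R One)) (real n *\<^sub>R One)) \<noteq> \<infinity>" for n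
    proof -
      have "emeasure ?M (box (- (real n *\<^sub>R One)) (real n *\<^sub>R One)) \<le> (\<integral>\<^sup>+x. ennreal (f x) \<partial>lborel)"
        by (subst emeasure_density) (auto intro!: nn_integral_mono simp: indicator_def)
      with fin(1) show ?thesis by (auto simp: top_unique)
    qed
    fix X assume "X \<in> ?E"
    then obtain a b where X: "X = box a b" by auto
    have e: "ennreal (f x * indicator X x) = ennreal (f x) * indicator X x"
      "ennreal (- (f x * indicator X x)) = ennreal (- f x) * indicator X x" for x
      by (auto simp: indicator_def)
    have le: "(\<integral>\<^sup>+x. ennreal (f x) * indicator X x \<partial>lborel) \<le> (\<integral>\<^sup>+x. ennreal (f x) \<partial>lborel)"
      "(\<integral>\<^sup>+x. ennreal (- f x) * indicator X x \<partial>lborel) \<le> (\<integral>\<^sup>+x. ennreal (- f x) \<partial>lborel)"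
      by (auto intro!: nn_integral_mono simp: indicator_def)
    have "integrable lborel (\<lambda>x. f x * indicator X x)"
      unfolding X by (rule integrable_real_mult_indicator) (use f in auto)
    from real_lebesgue_integral_def[OF this]
    have "enn2real (\<integral>\<^sup>+x. ennreal (f x) * indicator X x \<partial>lborel) = enn2real (\<integral>\<^sup>+x. ennreal (- f x) * indicator X x \<partial>lborel)"
      using 0[of a b] unfolding e X[symmetric] by simp
    moreover have "(\<integral>\<^sup>+x. ennreal (f x) * indicator X x \<partial>lborel) \<noteq> top" "(\<integral>\<^sup>+x. ennreal (- f x) * indicator X x \<partial>lborel) \<noteq> top"
      using le fin by (auto simp: top_unique)
    ultimately have "(\<integral>\<^sup>+x. ennreal (f x) * indicator X x \<partial>lborel) = (\<integral>\<^sup>+x. ennreal (- f x) * indicator X x \<partial>lborel)"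
      by (rule enn2real_cancel)
    moreover have "emeasure ?M X = (\<integral>\<^sup>+x. ennreal (f x) * indicator X x \<partial>lborel)"
      by (rule emeasure_density) (auto simp: X)
    moreover have "emeasure ?N X = (\<integral>\<^sup>+x. ennreal (- f x) * indicator X x \<partial>lborel)"
      by (rule emeasure_density) (auto simp: X)
    ultimately show "emeasure ?M X = emeasure ?N X" by simp
  qed
  then have "AE x in lborel. ennreal (f x) = ennreal (- f x)"
    by (subst (asm) sigma_finite_measure.density_unique_iff[OF sigma_finite_lborel]) auto
  then show ?thesis
  proof (rule AE_mp, intro AE_I2 impI)
    fix x assume "ennreal (f x) = ennreal (- f x)"
    then show "f x = 0" by (cases "f x \<ge> 0") (auto simp: ennreal_neg ennreal_eq_0_iff)
  qed
qed

text \<open>On the compact set \<open>K\<close> the continuous factor is bounded and w is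
  integrable; outside \<open>K\<close> the product is 0.\<close>

lemma locally_integrable_mult_continuous:
  fixes w :: "'a::euclidean_space \<Rightarrow> real"
  assumes w: "locally_integrable \<Omega> w" and K: "compact K" "K \<subseteq> \<Omega>" "\<And>x. x \<notin> K \<Longrightarrow> \<psi> x = 0"
    and c: "continuous_on UNIV \<psi>" and \<Omega>: "\<Omega> \<in> sets lebesgue"
  shows "integrable (lebesgue_on \<Omega>) (\<lambda>x. w x * \<psi> x)"
proof -
  have wK: "integrable (lebesgue_on K) w" using w K by (simp add: locally_integrable_def)
  have [measurable]: "\<psi> \<in> borel_measurable (lebesgue_on K)"
    by (intro measurable_restrict_space1 measurable_completion) (simp add: borel_measurable_continuous_onI[OF c])
  obtain B where B: "\<And>x. x \<in> K \<Longrightarrow> norm (\<psi> x) \<le> B"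
    using continuous_on_compact_abs_le[OF K(1) continuous_on_subset[OF c]] by auto
  have "integrable (lebesgue_on K) (\<lambda>x. w x * \<psi> x)"
  proof (rule Bochner_Integration.integrable_bound)
    show "integrable (lebesgue_on K) (\<lambda>x. B * w x)" using wK by simp
    show "(\<lambda>x. w x * \<psi> x) \<in> borel_measurable (lebesgue_on K)" using wK by measurable
    show "AE x in lebesgue_on K. norm (w x * \<psi> x) \<le> norm (B * w x)"
    proof (intro AE_I2)
      fix x assume "x \<in> space (lebesgue_on K)"
      then have "norm (\<psi> x) \<le> \<bar>B\<bar>" using B by fastforce
      then show "norm (w x * \<psi> x) \<le> norm (B * w x)"
        by (simp add: abs_mult mult.commute mult_right_mono)
    qed
  qed
  then have "integrable lebesgue (\<lambda>x. if x \<in> K then w x * \<psi> x else 0)"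
    using Lebesgue_Measure.integrable_restrict_UNIV[of K "\<lambda>x. w x * \<psi> x"] K(1) by (simp add: borel_compact)
  also have "(\<lambda>x. if x \<in> K then w x * \<psi> x else 0) = (\<lambda>x. if x \<in> \<Omega> then w x * \<psi> x else 0)"
    using K by fastforce
  finally show ?thesis by (rule Lebesgue_Measure.integrable_restrict_UNIV[OF \<Omega>, THEN iffD1])
qed

text \<open>Inside a closed box contained in \<Omega> the functions \<open>smooth_box\<close> are
  admissible test functions, and their limit shows that w has integral 0 over every smaller box.
  Countably many such closed boxes cover \<Omega>, so the exceptional null sets can be
  united.\<close>

lemma fundamental_lemma:
  fixes w :: "'a::euclidean_space \<Rightarrow> real"
  assumes \<Omega>: "open \<Omega>" and w: "locally_integrable \<Omega> w"
    and 0: "\<And>\<phi>. \<phi> \<in> test_functions \<Omega> \<Longrightarrow> (\<integral>x. w x * \<phi> x \<partial>lebesgue_on \<Omega>) = 0"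
  shows "AE x in lebesgue_on \<Omega>. w x = 0"
proof -
  have \<Omega>s: "\<Omega> \<in> sets lebesgue" using \<Omega> by auto
  have cb: "AE x in lebesgue. x \<in> cbox c d \<longrightarrow> w x = 0" if cd: "cbox c d \<subseteq> \<Omega>" for c d
  proof -
    define f where "f x = (if x \<in> cbox c d then w x else 0)" for x
    have "integrable (lebesgue_on (cbox c d)) w" using w cd by (simp add: locally_integrable_def)
    then have f: "integrable lebesgue f"
      unfolding f_def by (subst Lebesgue_Measure.integrable_restrict_UNIV) auto
    \<comment> \<open>The criterion on boxes is about Borel functions and \<open>lborel\<close>, so
      a Borel representative \<open>f'\<close> of the Lebesgue measurable f is used.\<close>
    from completion_ex_borel_measurable_real[OF borel_measurable_integrable[OF f]]
    obtain f' where [measurable]: "f' \<in> borel_measurable lborel" and ae: "AE x in lborel. f x = f' x" by blast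
    have ae': "AE x in lebesgue. f x = f' x" by (rule AE_completion[OF ae])
    have fm[measurable]: "f \<in> borel_measurable lebesgue" using f by auto
    have f'm[measurable]: "f' \<in> borel_measurable lebesgue" by (rule measurable_completion) measurable
    have f': "integrable lborel f'"
      using f integrable_cong_AE[OF fm f'm ae'] by (simp add: integrable_completion)
    have "AE x in lborel. f' x = 0"
    proof (rule AE_eq_0_if_integral_box_eq_0[OF f'])
      fix a b :: 'a
      obtain a' b' where ab: "box a b \<inter> box c d = box a' b'" by (rule that[OF box_Int_box])
      have [measurable]: "box a' b' \<in> sets lebesgue" "box a b \<in> sets lebesgue" by auto
      have sub: "box a' b' \<subseteq> cbox c d" using ab box_subset_cbox by blast
      have "(\<lambda>n. \<integral>x. f x * smooth_box n a' b' x \<partial>lebesgue) \<longlonglongrightarrow> (\<integral>x. f x * indicator (box a' b') x \<partial>lebesgue)"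
      proof (rule integral_dominated_convergence[where w="\<lambda>x. norm (f x)"])
        have "smooth_box n a' b' \<in> borel_measurable borel" for n
          using Ck_smooth_box[of 0 n a' b'] by (auto intro: borel_measurable_continuous_onI)
        then have [measurable]: "smooth_box n a' b' \<in> borel_measurable lebesgue" for n
          by (intro measurable_completion) simp
        show "(\<lambda>x. f x * smooth_box n a' b' x) \<in> borel_measurable lebesgue" for n by measurable
        show "(\<lambda>x. f x * indicator (box a' b') x) \<in> borel_measurable lebesgue" by measurable
        show "AE x in lebesgue. (\<lambda>n. f x * smooth_box n a' b' x) \<longlonglongrightarrow> f x * indicator (box a' b') x"
          by (intro AE_I2 tendsto_intros smooth_box_tendsto)
        show "AE x in lebesgue. norm (f x * smooth_box n a' b' x) \<le> norm (f x)" for n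
          using smooth_box_bounds[of n a' b'] by (intro AE_I2) (simp add: abs_mult mult_left_le)
      qed (use f in auto)
      moreover have "(\<integral>x. f x * smooth_box n a' b' x \<partial>lebesgue) = 0" for n
      proof -
        have "(\<integral>x. f x * smooth_box n a' b' x \<partial>lebesgue) = (\<integral>x. (if x \<in> \<Omega> then w x * smooth_box n a' b' x else 0) \<partial>lebesgue)"
          using smooth_box_eq_0[of _ a' b' n] sub cd
          by (intro Bochner_Integration.integral_cong refl) (auto simp: f_def)
        also have "\<dots> = (\<integral>x. w x * smooth_box n a' b' x \<partial>lebesgue_on \<Omega>)"
          by (rule Lebesgue_Measure.integral_restrict_UNIV[OF \<Omega>s])
        also have "\<dots> = 0" by (rule 0[OF smooth_box_test_function[OF cd sub]])
        finally show ?thesis .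
      qed
      ultimately have z: "(\<integral>x. f x * indicator (box a' b') x \<partial>lebesgue) = 0"
        by (simp add: LIMSEQ_const_iff)
      \<comment> \<open>f lives on the closed box, whereas the approximating test functions only see
        the open one. The faces between them are a null set.\<close>
      have "AE x in lebesgue. x \<notin> cbox c d - box c d"
      proof -
        have "cbox c d - box c d \<in> null_sets lborel"
          by (subst null_sets_def) (auto simp: emeasure_Diff emeasure_lborel_cbox_eq emeasure_lborel_box_eq box_subset_cbox)
        then show ?thesis by (intro AE_not_in null_sets_completionI)
      qed
      with ae' have "AE x in lebesgue. f' x * indicator (box a b) x = f x * indicator (box a' b') x"
        by eventually_elim (auto simp: ab[symmetric] f_def indicator_def)
      then have "(\<integral>x. f' x * indicator (box a b) x \<partial>lebesgue) = 0"
        unfolding z[symmetric] by (intro integral_cong_AE) measurable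
      then show "(\<integral>x. f' x * indicator (box a b) x \<partial>lborel) = 0"
        by (subst (asm) integral_completion) measurable
    qed
    from AE_completion[OF this] ae' show ?thesis
      by eventually_elim (auto simp: f_def split: if_splits)
  qed
  obtain D where D: "countable D" "D \<subseteq> Pow \<Omega>" "\<And>X. X \<in> D \<Longrightarrow> \<exists>a b. X = cbox a b" "\<Union>D = \<Omega>"
    using open_countable_Union_open_cbox[OF \<Omega>] by metis
  have "AE x in lebesgue. \<forall>X\<in>D. x \<in> X \<longrightarrow> w x = 0"
  proof (subst AE_ball_countable[OF D(1)], intro ballI)
    fix X assume "X \<in> D"
    with D(2,3) obtain a b where "X = cbox a b" "cbox a b \<subseteq> \<Omega>" by blast
    then show "AE x in lebesgue. x \<in> X \<longrightarrow> w x = 0" using cb by simp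
  qed
  then have "AE x in lebesgue. x \<in> \<Omega> \<longrightarrow> w x = 0"
    by eventually_elim (use D(4) in blast)
  then show ?thesis using \<Omega>s by (simp add: AE_restrict_space_iff)
qed

lemma has_weak_gradient_unique:
  assumes \<Omega>: "open \<Omega>" and 1: "has_weak_gradient \<Omega> u v1" and 2: "has_weak_gradient \<Omega> u v2"
  shows "AE x in lebesgue_on \<Omega>. v1 x = v2 x"
proof -
  have \<Omega>s: "\<Omega> \<in> sets lebesgue" using \<Omega> by auto
  have "AE x in lebesgue_on \<Omega>. v1 x \<bullet> i - v2 x \<bullet> i = 0" if i: "i \<in> Basis" for i
  proof (rule fundamental_lemma[OF \<Omega>])
    have l: "locally_integrable \<Omega> (\<lambda>x. v1 x \<bullet> i)" "locally_integrable \<Omega> (\<lambda>x. v2 x \<bullet> i)"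
      using 1 2 by (auto simp: has_weak_gradient_def locally_integrable_def)
    then show "locally_integrable \<Omega> (\<lambda>x. v1 x \<bullet> i - v2 x \<bullet> i)"
      by (auto simp: locally_integrable_def)
    fix \<phi> assume \<phi>: "\<phi> \<in> test_functions \<Omega>"
    obtain K where K: "compact K" "K \<subseteq> \<Omega>" "\<And>x. x \<notin> K \<Longrightarrow> \<phi> x = 0" "\<And>x. x \<notin> K \<Longrightarrow> grad \<phi> x = 0"
      by (rule test_functionsE[OF \<phi>]) (rule that)
    note int = locally_integrable_mult_continuous[OF _ K(1-3) test_functions_continuous[OF \<phi>] \<Omega>s]
    have "(\<integral>x. u x * partial_deriv i \<phi> x \<partial>lebesgue_on \<Omega>) = - (\<integral>x. (v1 x \<bullet> i) * \<phi> x \<partial>lebesgue_on \<Omega>)"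
      "(\<integral>x. u x * partial_deriv i \<phi> x \<partial>lebesgue_on \<Omega>) = - (\<integral>x. (v2 x \<bullet> i) * \<phi> x \<partial>lebesgue_on \<Omega>)"
      using 1 2 \<phi> i unfolding has_weak_gradient_def by blast+
    then show "(\<integral>x. (v1 x \<bullet> i - v2 x \<bullet> i) * \<phi> x \<partial>lebesgue_on \<Omega>) = 0"
      using int[OF l(1)] int[OF l(2)] by (simp add: left_diff_distrib)
  qed
  then have "AE x in lebesgue_on \<Omega>. \<forall>i\<in>Basis. v1 x \<bullet> i - v2 x \<bullet> i = 0"
    by (subst AE_ball_countable) (auto intro: countable_finite)
  then show ?thesis by eventually_elim (rule euclidean_eqI, simp)
qed

subsection \<open>Inequalities for powers of norms\<close>

text \<open>Young's inequality with exponents p/(p-1) and p for x^(p-1) and y, multiplied by p.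
  Equality holds at x = y, so it also expresses that the graph of y^p lies above its tangent at
  x.\<close>

lemma powr_Young:
  fixes x y p :: real
  assumes "p > 1" "x \<ge> 0" "y \<ge> 0"
  shows "p * (x powr (p - 1) * y) \<le> (p - 1) * x powr p + y powr p"
proof -
  have "(x powr (p - 1)) * y \<le> (x powr (p - 1)) powr (p / (p - 1)) / (p / (p - 1)) + y powr p / p"
    using assms by (intro Youngs_inequality) (auto simp: field_simps)
  also have "(x powr (p - 1)) powr (p / (p - 1)) = x powr p"
    using assms by (simp add: powr_powr)
  finally have "p * (x powr (p - 1) * y) \<le> p * (x powr p / (p / (p - 1)) + y powr p / p)"
    using assms by (intro mult_left_mono) auto
  also have "\<dots> = (p - 1) * x powr p + y powr p"
    using assms by (simp add: field_simps)
  finally show ?thesis .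
qed

lemma powr_mult_le:
  fixes x y p :: real
  assumes "p > 1" "x \<ge> 0" "y \<ge> 0"
  shows "x powr (p - 1) * y \<le> x powr p + y powr p"
proof -
  have "p * (x powr (p - 1) * y) \<le> (p - 1) * x powr p + y powr p" by (rule powr_Young[OF assms])
  also have "\<dots> \<le> p * x powr p + p * y powr p" using assms
    by (intro add_mono mult_right_mono) (auto simp: mult_le_cancel_right1)
  finally have "p * (x powr (p - 1) * y) \<le> p * (x powr p + y powr p)" by (simp add: distrib_left)
  then show ?thesis using assms by simp
qed

lemma powr_le_add_1:
  fixes x p q :: real
  assumes "0 \<le> q" "q \<le> p" "x \<ge> 0"
  shows "x powr q \<le> 1 + x powr p"
proof (cases "x \<le> 1")
  case True
  then have "x powr q \<le> 1 powr q" using assms by (intro powr_mono2) auto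
  then show ?thesis by (simp add: add_increasing2)
next
  case False
  then have "x powr q \<le> x powr p" using assms by (intro powr_mono) auto
  then show ?thesis by simp
qed

lemma le_add_1_powr: "x \<ge> 0 \<Longrightarrow> p \<ge> 1 \<Longrightarrow> x \<le> 1 + x powr p" for x p :: real
  using powr_le_add_1[of 1 p x] by simp

lemma add_powr_le:
  fixes x y p :: real
  assumes "p \<ge> 0" "x \<ge> 0" "y \<ge> 0"
  shows "(x + y) powr p \<le> 2 powr p * (x powr p + y powr p)"
proof -
  have "(x + y) powr p \<le> (2 * max x y) powr p" using assms by (intro powr_mono2) auto
  also have "\<dots> = 2 powr p * max x y powr p" by (simp add: powr_mult)
  also have "\<dots> \<le> 2 powr p * (x powr p + y powr p)" by (auto simp: max_def)
  finally show ?thesis .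
qed

lemma norm_add_powr_le:
  fixes a b :: "'a::real_normed_vector"
  assumes "p \<ge> 0"
  shows "norm (a + b) powr p \<le> 2 powr p * (norm a powr p + norm b powr p)"
proof -
  have "norm (a + b) powr p \<le> (norm a + norm b) powr p" using assms by (intro powr_mono2 norm_triangle_ineq) auto
  also have "\<dots> \<le> 2 powr p * (norm a powr p + norm b powr p)" using assms by (intro add_powr_le) auto
  finally show ?thesis .
qed

lemma norm_diff_powr_le:
  fixes a b :: "'a::real_normed_vector"
  assumes "p \<ge> 0"
  shows "norm (a - b) powr p \<le> 2 powr p * (norm a powr p + norm b powr p)"
  using norm_add_powr_le[OF assms, of a "- b"] by simp

text \<open>The gradient of |a|^p / p. For vectors it is the flux of the p-Laplacian, for reals it
  is the nonlinearity of the Hardy term, so one set of estimates serves both.\<close>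

definition pflux :: "real \<Rightarrow> 'a::real_inner \<Rightarrow> 'a" where
  "pflux p a = norm a powr (p - 2) *\<^sub>R a"

lemma powr_minus_2_times: "x powr (p - 2) * x = x powr (p - 1)" if "x \<ge> 0" for x p :: real
proof (cases "x = 0")
  case False
  have "x powr ((p - 2) + 1) = x powr (p - 2) * x powr 1" by (rule powr_add)
  moreover have "(p - 2) + 1 = p - 1" by simp
  ultimately show ?thesis using False that by simp
qed simp

lemma powr_minus_1_times: "x powr (p - 1) * x = x powr p" if "x \<ge> 0" for x p :: real
  using powr_minus_2_times[OF that, of "p + 1"] by simp

lemma norm_pflux: "norm (pflux p a) = norm a powr (p - 1)"
  by (simp add: pflux_def powr_minus_2_times)

lemma pflux_0 [simp]: "pflux p 0 = 0"
  by (simp add: pflux_def)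

lemma pflux_minus: "pflux p (- a) = - pflux p a"
  by (simp add: pflux_def)

lemma pflux_inner_self: "pflux p a \<bullet> a = norm a powr p"
proof -
  have "pflux p a \<bullet> a = norm a powr (p - 2) * norm a * norm a"
    by (simp add: pflux_def power2_norm_eq_inner[symmetric] power2_eq_square)
  then show ?thesis by (simp add: powr_minus_2_times powr_minus_1_times)
qed

lemma abs_pflux_inner_le: "p > 1 \<Longrightarrow> \<bar>pflux p a \<bullet> b\<bar> \<le> norm a powr p + norm b powr p"
  using Cauchy_Schwarz_ineq2[of "pflux p a" b] powr_mult_le[of p "norm a" "norm b"]
  by (simp add: norm_pflux)

text \<open>First-order convexity of the p-th power of the norm, by Cauchy-Schwarz and the tangent
  form of Young's inequality. No differentiation is involved, so the origin needs no separate
  treatment.\<close>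

lemma pflux_subgradient:
  assumes "p > 1"
  shows "norm b powr p \<ge> norm a powr p + p * (pflux p a \<bullet> (b - a))"
proof -
  have "pflux p a \<bullet> b \<le> norm a powr (p - 1) * norm b"
    using Cauchy_Schwarz_ineq2[of "pflux p a" b] by (simp add: norm_pflux)
  then have "p * (pflux p a \<bullet> b) \<le> p * (norm a powr (p - 1) * norm b)" using assms by simp
  also have "\<dots> \<le> (p - 1) * norm a powr p + norm b powr p" using assms by (intro powr_Young) auto
  finally show ?thesis by (simp add: inner_diff_right pflux_inner_self algebra_simps)
qed

lemma powr_add_superadd:
  fixes x y q :: real
  assumes "q \<ge> 1" "x \<ge> 0" "y \<ge> 0"
  shows "x powr q + y powr q \<le> (x + y) powr q"
proof -
  have "x powr (q - 1) * x \<le> (x + y) powr (q - 1) * x" "y powr (q - 1) * y \<le> (x + y) powr (q - 1) * y"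
    using assms by (auto intro!: mult_right_mono powr_mono2)
  then have "x powr (q - 1) * x + y powr (q - 1) * y \<le> (x + y) powr (q - 1) * (x + y)"
    by (simp add: distrib_left)
  then show ?thesis using assms by (simp add: powr_minus_1_times)
qed

text \<open>The subgradient inequalities at the midpoint towards x and towards y are added; their
  linear terms cancel.\<close>

lemma powr_midpoint:
  fixes x y q :: real
  assumes "q \<ge> 1" "x \<ge> 0" "y \<ge> 0"
  shows "((x + y) / 2) powr q \<le> (x powr q + y powr q) / 2"
proof (cases "q = 1")
  case False
  let ?m = "(x + y) / 2"
  have q: "q > 1" using assms False by simp
  have "x powr q \<ge> ?m powr q + q * (pflux q ?m \<bullet> (x - ?m))" "y powr q \<ge> ?m powr q + q * (pflux q ?m \<bullet> (y - ?m))"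
    using pflux_subgradient[OF q, of ?m x] pflux_subgradient[OF q, of ?m y] assms by simp_all
  moreover have "q * (pflux q ?m \<bullet> (x - ?m)) + q * (pflux q ?m \<bullet> (y - ?m)) = 0"
    by (simp add: field_simps)
  ultimately show ?thesis by simp
qed (use assms in auto)

text \<open>Pointwise form: with t = |.|^2, superadditivity of t^(p/2) joins the two terms on the
  left, the parallelogram law evaluates their sum, and convexity of t^(p/2) splits it again. Both
  properties rest on p/2 \<ge> 1.\<close>

lemma Clarkson:
  fixes a b :: "'a::real_inner"
  assumes "p \<ge> 2"
  shows "norm ((1/2) *\<^sub>R (a + b)) powr p + norm ((1/2) *\<^sub>R (a - b)) powr p \<le> (norm a powr p + norm b powr p) / 2"
proof -
  have pw: "norm z powr p = ((norm z)\<^sup>2) powr (p / 2)" for z :: 'a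
  proof -
    have "norm z powr p = (norm z powr 2) powr (p / 2)" by (subst powr_powr) simp
    then show ?thesis by simp
  qed
  have "norm ((1/2) *\<^sub>R (a + b)) powr p + norm ((1/2) *\<^sub>R (a - b)) powr p
      \<le> ((norm ((1/2) *\<^sub>R (a + b)))\<^sup>2 + (norm ((1/2) *\<^sub>R (a - b)))\<^sup>2) powr (p / 2)"
    unfolding pw using assms by (intro powr_add_superadd) auto
  also have "(norm ((1/2) *\<^sub>R (a + b)))\<^sup>2 + (norm ((1/2) *\<^sub>R (a - b)))\<^sup>2 = ((norm a)\<^sup>2 + (norm b)\<^sup>2) / 2"
    by (simp add: power2_norm_eq_inner inner_add_left inner_add_right inner_diff_left inner_diff_right inner_commute field_simps)
  also have "\<dots> powr (p / 2) \<le> (norm a powr p + norm b powr p) / 2"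
    unfolding pw using assms by (intro powr_midpoint) auto
  finally show ?thesis .
qed

text \<open>The subgradient inequalities at a and at b, both evaluated at the midpoint m, bound 2
  |m|^p from below by |a|^p + |b|^p minus p/2 times the right-hand side. Clarkson bounds 2 |m|^p
  from above by |a|^p + |b|^p - 2 |(a-b)/2|^p. Comparing the two gives the factor 4/p.\<close>

lemma pflux_monotone:
  fixes a b :: "'a::real_inner"
  assumes "p \<ge> 2"
  shows "(4 / p) * norm ((1/2) *\<^sub>R (a - b)) powr p \<le> (pflux p a - pflux p b) \<bullet> (a - b)"
proof -
  let ?m = "(1/2) *\<^sub>R (a + b)"
  have e: "?m - a = (-1/2) *\<^sub>R (a - b)" "?m - b = (1/2) *\<^sub>R (a - b)"
  proof -
    have "?m - a = ?m - (1/2) *\<^sub>R (a + a)" "?m - b = ?m - (1/2) *\<^sub>R (b + b)" by simp_all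
    then have "?m - a = (1/2) *\<^sub>R ((a + b) - (a + a))" "?m - b = (1/2) *\<^sub>R ((a + b) - (b + b))"
      by (simp_all only: scaleR_diff_right)
    moreover have "(a + b) - (a + a) = - (a - b)" "(a + b) - (b + b) = a - b" by simp_all
    ultimately show "?m - a = (-1/2) *\<^sub>R (a - b)" "?m - b = (1/2) *\<^sub>R (a - b)"
      by (simp_all only: scaleR_minus_right) simp
  qed
  have "norm ?m powr p \<ge> norm a powr p + p * (pflux p a \<bullet> (?m - a))"
    "norm ?m powr p \<ge> norm b powr p + p * (pflux p b \<bullet> (?m - b))"
    using assms by (intro pflux_subgradient; simp)+
  then have "norm ?m powr p \<ge> norm a powr p - (p / 2) * (pflux p a \<bullet> (a - b))"
    "norm ?m powr p \<ge> norm b powr p + (p / 2) * (pflux p b \<bullet> (a - b))"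
    unfolding e inner_scaleR_right by linarith+
  then have "2 * norm ?m powr p \<ge> norm a powr p + norm b powr p - (p / 2) * ((pflux p a - pflux p b) \<bullet> (a - b))"
    unfolding inner_diff_left right_diff_distrib by linarith
  with Clarkson[OF assms, of a b] have "4 * norm ((1/2) *\<^sub>R (a - b)) powr p \<le> p * ((pflux p a - pflux p b) \<bullet> (a - b))"
    by argo
  then show ?thesis using assms by (simp add: field_simps)
qed

lemma pflux_monotone_nonneg: "p \<ge> 2 \<Longrightarrow> 0 \<le> (pflux p a - pflux p b) \<bullet> (a - b)"
  by (rule order_trans[OF _ pflux_monotone]) auto

lemma pflux_monotone_eq_0:
  assumes "p \<ge> 2" "(pflux p a - pflux p b) \<bullet> (a - b) = 0" shows "a = b"
proof (rule ccontr)
  assume "a \<noteq> b"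
  then have "norm ((1/2) *\<^sub>R (a - b)) powr p > 0" by simp
  then have "(4 / p) * norm ((1/2) *\<^sub>R (a - b)) powr p > 0" using assms(1) by simp
  with pflux_monotone[OF assms(1), of a b] assms(2) show False by linarith
qed

lemma tendsto_norm_powr:
  fixes f :: "'b \<Rightarrow> 'a::real_normed_vector"
  assumes "p > 0" "(f \<longlongrightarrow> a) F"
  shows "((\<lambda>x. norm (f x) powr p) \<longlongrightarrow> norm a powr p) F"
  using assms by (intro tendsto_powr2 tendsto_norm tendsto_const) auto

text \<open>The limit a = 0 is treated through the norm |a|^(p-1), because the factor
  \<open>norm a powr (p - 2)\<close> alone is discontinuous at 0 when p = 2, where
  \<open>0 powr 0 = 0\<close>.\<close>

lemma tendsto_pflux:
  assumes "p > 1" "(f \<longlongrightarrow> a) F"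
  shows "((\<lambda>x. pflux p (f x)) \<longlongrightarrow> pflux p a) F"
proof (cases "a = 0")
  case True
  have "((\<lambda>x. norm (f x) powr (p - 1)) \<longlongrightarrow> norm a powr (p - 1)) F"
    using assms by (intro tendsto_norm_powr) auto
  then have "((\<lambda>x. norm (pflux p (f x))) \<longlongrightarrow> 0) F" using True by (simp add: norm_pflux)
  then show ?thesis using True by (simp add: tendsto_norm_zero_iff)
next
  case False
  then show ?thesis unfolding pflux_def using assms
    by (intro tendsto_scaleR tendsto_powr tendsto_norm tendsto_const) auto
qed

lemma isCont_pflux: "p > 1 \<Longrightarrow> isCont (pflux p) a"
  unfolding isCont_def by (rule tendsto_pflux[OF _ tendsto_ident_at])

lemma pflux_measurable:
  assumes "p > 1" "f \<in> borel_measurable M"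
  shows "(\<lambda>x. pflux p (f x :: 'b::euclidean_space)) \<in> borel_measurable M"
  unfolding pflux_def using assms(2) by measurable

subsection \<open>Lebesgue spaces over a measure\<close>

definition in_Lp :: "real \<Rightarrow> 'a measure \<Rightarrow> ('a \<Rightarrow> 'b::euclidean_space) \<Rightarrow> bool" where
  "in_Lp p M F \<longleftrightarrow> F \<in> borel_measurable M \<and> integrable M (\<lambda>x. norm (F x) powr p)"

lemma Lp_space_iff: "u \<in> Lp_space p \<Omega> \<longleftrightarrow> in_Lp p (lebesgue_on \<Omega>) u"
  by (simp add: Lp_space_def in_Lp_def)

lemma in_Lp_measurable [measurable_dest]: "in_Lp p M F \<Longrightarrow> F \<in> borel_measurable M"
  by (simp add: in_Lp_def)

lemma in_Lp_integrable: "in_Lp p M F \<Longrightarrow> integrable M (\<lambda>x. norm (F x) powr p)"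
  by (simp add: in_Lp_def)

lemma in_Lp_bound:
  fixes V :: "'a \<Rightarrow> 'c::euclidean_space"
  assumes "p \<ge> 0" "in_Lp p M V" and [measurable]: "F \<in> borel_measurable M" and "AE x in M. norm (F x) \<le> norm (V x)"
  shows "in_Lp p M F"
  unfolding in_Lp_def
proof
  show "integrable M (\<lambda>x. norm (F x) powr p)"
    by (rule Bochner_Integration.integrable_bound[OF in_Lp_integrable[OF assms(2)]])
       (use assms(1,4) in \<open>auto elim!: eventually_mono intro!: powr_mono2\<close>)
qed fact

lemma in_Lp_add:
  assumes "p \<ge> 0" "in_Lp p M F" "in_Lp p M G"
  shows "in_Lp p M (\<lambda>x. F x + G x)"
  unfolding in_Lp_def
proof
  show [measurable]: "(\<lambda>x. F x + G x) \<in> borel_measurable M" using assms(2,3) by measurable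
  have "integrable M (\<lambda>x. 2 powr p * (norm (F x) powr p + norm (G x) powr p))"
    using assms(2,3) by (auto simp: in_Lp_def)
  then show "integrable M (\<lambda>x. norm (F x + G x) powr p)"
    by (rule Bochner_Integration.integrable_bound)
       (auto intro!: AE_I2 norm_add_powr_le[OF assms(1), THEN order_trans])
qed

lemma in_Lp_scaleR: "in_Lp p M F \<Longrightarrow> in_Lp p M (\<lambda>x. c *\<^sub>R F x)"
  by (auto simp: in_Lp_def powr_mult)

lemma in_Lp_diff:
  assumes "p \<ge> 0" "in_Lp p M F" "in_Lp p M G"
  shows "in_Lp p M (\<lambda>x. F x - G x)"
  using in_Lp_add[OF assms(1,2) in_Lp_scaleR[OF assms(3), of "-1"]] by simp

lemma in_Lp_norm: "in_Lp p M F \<Longrightarrow> in_Lp p M (\<lambda>x. norm (F x))"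
  by (auto simp: in_Lp_def)

lemma integral_norm_powr_add_le:
  assumes "p \<ge> 0" "in_Lp p M F" "in_Lp p M G"
  shows "(\<integral>x. norm (F x + G x) powr p \<partial>M) \<le> 2 powr p * ((\<integral>x. norm (F x) powr p \<partial>M) + (\<integral>x. norm (G x) powr p \<partial>M))"
proof -
  have "(\<integral>x. norm (F x + G x) powr p \<partial>M) \<le> (\<integral>x. 2 powr p * (norm (F x) powr p + norm (G x) powr p) \<partial>M)"
    using assms in_Lp_add[OF assms] by (intro integral_mono norm_add_powr_le) (auto simp: in_Lp_def)
  also have "\<dots> = 2 powr p * ((\<integral>x. norm (F x) powr p \<partial>M) + (\<integral>x. norm (G x) powr p \<partial>M))"
    using assms by (simp add: in_Lp_def)
  finally show ?thesis .
qed

lemma in_Lp_pflux_inner: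
  assumes "p > 1" "in_Lp p M F" "in_Lp p M G"
  shows "integrable M (\<lambda>x. pflux p (F x) \<bullet> G x)"
proof (rule Bochner_Integration.integrable_bound)
  show "integrable M (\<lambda>x. norm (F x) powr p + norm (G x) powr p)"
    using assms by (auto simp: in_Lp_def)
  have [measurable]: "(\<lambda>x. pflux p (F x)) \<in> borel_measurable M" using assms by (intro pflux_measurable) (auto simp: in_Lp_def)
  show "(\<lambda>x. pflux p (F x) \<bullet> G x) \<in> borel_measurable M" using assms(3) by measurable
  show "AE x in M. norm (pflux p (F x) \<bullet> G x) \<le> norm (norm (F x) powr p + norm (G x) powr p)"
    using abs_pflux_inner_le[OF assms(1)] by (intro AE_I2) simp
qed

lemma Lp_dominated_convergence:
  assumes p: "p > 0" and V: "in_Lp p M V" and m: "\<And>n. F n \<in> borel_measurable M" "G \<in> borel_measurable M"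
    and b: "\<And>n. AE x in M. norm (F n x) \<le> norm (V x)" and l: "AE x in M. (\<lambda>n. F n x) \<longlonglongrightarrow> G x"
  shows "in_Lp p M G" "\<And>n. in_Lp p M (F n)" "(\<lambda>n. \<integral>x. norm (F n x - G x) powr p \<partial>M) \<longlonglongrightarrow> 0"
proof -
  have "AE x in M. \<forall>n. norm (F n x) \<le> norm (V x)" using b by (simp add: AE_all_countable)
  with l have Gb: "AE x in M. norm (G x) \<le> norm (V x)"
    by eventually_elim (rule Lim_bounded[OF tendsto_norm], auto)
  show G: "in_Lp p M G" using p V m Gb by (intro in_Lp_bound[OF _ V]) auto
  show F: "in_Lp p M (F n)" for n using p V m b by (intro in_Lp_bound[OF _ V]) auto
  have "(\<lambda>n. \<integral>x. norm (F n x - G x) powr p \<partial>M) \<longlonglongrightarrow> (\<integral>x. 0 \<partial>M)"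
  proof (rule integral_dominated_convergence)
    show "integrable M (\<lambda>x. 2 powr p * (norm (V x) powr p + norm (V x) powr p))"
      using V by (simp add: in_Lp_def)
    show "(\<lambda>x. norm (F n x - G x) powr p) \<in> borel_measurable M" for n using m by measurable
    show "AE x in M. (\<lambda>n. norm (F n x - G x) powr p) \<longlonglongrightarrow> 0"
      using l
    proof eventually_elim
      case (elim x)
      then have "(\<lambda>n. F n x - G x) \<longlonglongrightarrow> 0" by (simp add: LIM_zero_iff)
      from tendsto_norm_powr[OF p this] show ?case by simp
    qed
    show "AE x in M. norm (norm (F n x - G x) powr p) \<le> 2 powr p * (norm (V x) powr p + norm (V x) powr p)" for n
      using b[of n] Gb
    proof eventually_elim
      case (elim x)
      have "norm (F n x - G x) powr p \<le> 2 powr p * (norm (F n x) powr p + norm (G x) powr p)"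
        using p by (intro norm_diff_powr_le) auto
      also have "\<dots> \<le> 2 powr p * (norm (V x) powr p + norm (V x) powr p)"
        using elim p by (intro mult_left_mono add_mono powr_mono2) auto
      finally show ?case by simp
    qed
  qed auto
  then show "(\<lambda>n. \<integral>x. norm (F n x - G x) powr p \<partial>M) \<longlonglongrightarrow> 0" by simp
qed

section \<open>Almost everywhere convergent subsequences with majorants\<close>

lemma fast_subsequence:
  fixes P :: "nat \<Rightarrow> nat \<Rightarrow> nat \<Rightarrow> bool"
  assumes "\<And>k. \<exists>N. \<forall>m\<ge>N. \<forall>n\<ge>N. P k m n"
  obtains r where "strict_mono r" "\<And>k m n. m \<ge> r k \<Longrightarrow> n \<ge> r k \<Longrightarrow> P k m n"
proof -
  obtain N where N: "\<And>k m n. m \<ge> N k \<Longrightarrow> n \<ge> N k \<Longrightarrow> P k m n" using assms by metis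
  \<comment> \<open>Partial sums of \<open>Suc (N j)\<close> increase strictly and still exceed each
    single \<open>N k\<close>.\<close>
  define r where "r k = (\<Sum>j\<le>k. Suc (N j))" for k
  have "strict_mono r" unfolding strict_mono_Suc_iff r_def by simp
  moreover have "N k \<le> r k" for k
  proof -
    have "N k \<le> Suc (N k)" by simp
    also have "\<dots> \<le> r k" unfolding r_def by (rule member_le_sum) auto
    finally show ?thesis .
  qed
  ultimately show ?thesis using N by (intro that[of r]) (blast intro: order_trans)+
qed

text \<open>
  Riesz--Fischer, with a dominating function for the subsequence: if
  \<open>\<integral> |F\<^sub>k\<^sub>+\<^sub>1 - F\<^sub>k|\<^sup>p \<le> 2\<^sup>-\<^sup>k\<^sup>(\<^sup>p\<^sup>+\<^sup>1\<^sup>)\<close>, then \<open>S = \<Sum>\<^sub>k 2\<^sup>k\<^sup>p |F\<^sub>k\<^sub>+\<^sub>1 - F\<^sub>k|\<^sup>p\<close> is integrable and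
  \<open>|F\<^sub>k\<^sub>+\<^sub>1 - F\<^sub>k| \<le> 2\<^sup>-\<^sup>k S\<^sup>1\<^sup>/\<^sup>p\<close>.
\<close>

lemma Riesz_Fischer:
  fixes F :: "nat \<Rightarrow> 'a \<Rightarrow> 'b::euclidean_space"
  assumes p: "p > 0" and F: "\<And>n. in_Lp p M (F n)"
    and C: "\<And>\<epsilon>. \<epsilon> > 0 \<Longrightarrow> \<exists>N. \<forall>m\<ge>N. \<forall>n\<ge>N. (\<integral>x. norm (F m x - F n x) powr p \<partial>M) \<le> \<epsilon>"
  obtains r G and V :: "'a \<Rightarrow> real" where "strict_mono r" "in_Lp p M V" "G \<in> borel_measurable M"
    "AE x in M. (\<lambda>n. F (r n) x) \<longlonglongrightarrow> G x" "\<And>n. AE x in M. norm (F (r n) x) \<le> norm (V x)"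
proof -
  define e where "e k = 2 powr (- (real k * (p + 1)))" for k :: nat
  have "e k > 0" for k unfolding e_def by simp
  from C[OF this] obtain r where r: "strict_mono r"
    and re: "\<And>k m n. m \<ge> r k \<Longrightarrow> n \<ge> r k \<Longrightarrow> (\<integral>x. norm (F m x - F n x) powr p \<partial>M) \<le> e k"
    by (rule fast_subsequence[of "\<lambda>k m n. (\<integral>x. norm (F m x - F n x) powr p \<partial>M) \<le> e k"]) blast
  have [measurable]: "F n \<in> borel_measurable M" for n using F by measurable
  define D where "D k x = F (r (Suc k)) x - F (r k) x" for k x
  have D: "in_Lp p M (D k)" for k unfolding D_def[abs_def] using p by (intro in_Lp_diff F) auto
  define t where "t k x = 2 powr (real k * p) * norm (D k x) powr p" for k x
  have ti: "integrable M (t k)" for k unfolding t_def using in_Lp_integrable[OF D] by auto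
  then have [measurable]: "t k \<in> borel_measurable M" for k by auto
  have t0: "t k x \<ge> 0" for k x unfolding t_def by simp
  have tI: "(\<integral>x. t k x \<partial>M) \<le> (1/2) ^ k" for k
  proof -
    have "r k \<le> r (Suc k)" using r by (simp add: strict_mono_less_eq)
    then have "(\<integral>x. norm (D k x) powr p \<partial>M) \<le> e k" unfolding D_def using re[of k "r (Suc k)" "r k"] by simp
    then have "(\<integral>x. t k x \<partial>M) \<le> 2 powr (real k * p) * e k" unfolding t_def by simp
    also have "\<dots> = 2 powr (real k * p) * 2 powr (- (real k * (p + 1)))"
      unfolding e_def ..
    also have "\<dots> = 2 powr (real k * p + - (real k * (p + 1)))" by (rule powr_add[symmetric])
    also have "real k * p + - (real k * (p + 1)) = - real k" by (simp add: algebra_simps)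
    also have "2 powr (- real k) = (1/2) ^ k" by (simp add: powr_minus powr_realpow field_simps)
    finally show ?thesis .
  qed
  have sI: "summable (\<lambda>k. \<integral>x. norm (t k x) \<partial>M)"
    by (rule summable_comparison_test'[where g="\<lambda>k. (1/2) ^ k" and N=0]) (use tI t0 in \<open>auto intro!: integral_nonneg\<close>)
  have "(\<integral>\<^sup>+x. (\<Sum>k. ennreal (t k x)) \<partial>M) = (\<Sum>k. \<integral>\<^sup>+x. ennreal (t k x) \<partial>M)"
    by (rule nn_integral_suminf) auto
  also have "\<dots> = (\<Sum>k. ennreal (\<integral>x. t k x \<partial>M))"
    using ti t0 by (intro suminf_cong nn_integral_eq_integral) auto
  also have "\<dots> \<le> (\<Sum>k. ennreal ((1/2) ^ k))"
    using tI by (intro suminf_le ennreal_leI) auto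
  also have "\<dots> = ennreal (\<Sum>k. (1/2) ^ k)"
    by (rule suminf_ennreal2) (auto intro: summable_geometric)
  also have "\<dots> < \<infinity>" by simp
  finally have "AE x in M. (\<Sum>k. ennreal (t k x)) \<noteq> \<infinity>"
    by (intro nn_integral_PInf_AE) auto
  then have ts: "AE x in M. summable (\<lambda>k. t k x)"
    by eventually_elim (rule summable_suminf_not_top, use t0 in auto)
  define S where "S x = (\<Sum>k. t k x)" for x
  have Si: "integrable M S" unfolding S_def
    by (rule integrable_suminf[OF ti _ sI]) (use ts t0 in \<open>auto elim!: eventually_mono\<close>)
  then have [measurable]: "S \<in> borel_measurable M" by auto
  \<comment> \<open>The factor 2 is the sum of the geometric series of the weights 2^(-k) of the
    increments.\<close>
  define V where "V x = norm (F (r 0) x) + 2 * \<bar>S x\<bar> powr (1 / p)" for x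
  have VL: "in_Lp p M V" unfolding V_def[abs_def]
  proof (rule in_Lp_add)
    have "in_Lp p M (\<lambda>x. \<bar>S x\<bar> powr (1 / p))" using Si p by (simp add: in_Lp_def powr_powr)
    from in_Lp_scaleR[OF this, of 2] show "in_Lp p M (\<lambda>x. 2 * \<bar>S x\<bar> powr (1 / p))" by simp
  qed (use p F in_Lp_norm in auto)
  define G where "G x = lim (\<lambda>n. F (r n) x)" for x
  have key: "convergent (\<lambda>n. F (r n) x) \<and> (\<forall>n. norm (F (r n) x) \<le> norm (V x))" if s: "summable (\<lambda>k. t k x)" for x
  proof -
    have S0: "S x \<ge> 0" unfolding S_def using t0 by (rule suminf_nonneg[OF s])
    have Dk: "norm (D k x) \<le> (1/2) ^ k * S x powr (1 / p)" for k
    proof -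
      have "t k x \<le> S x" unfolding S_def
        using sum_le_suminf[OF s, of "{k}"] t0 by simp
      then have "t k x powr (1 / p) \<le> S x powr (1 / p)" using p t0 by (intro powr_mono2) auto
      moreover have "t k x powr (1 / p) = 2 ^ k * norm (D k x)"
        unfolding t_def using p by (simp add: powr_mult powr_powr powr_realpow)
      ultimately show ?thesis by (simp add: field_simps power_one_over)
    qed
    have g: "summable (\<lambda>k. (1/2) ^ k * S x powr (1 / p))" by (intro summable_mult2 summable_geometric) auto
    have sD: "summable (\<lambda>k. norm (D k x))"
      by (rule summable_comparison_test'[OF g, of 0]) (use Dk in simp)
    have tel: "F (r n) x = F (r 0) x + (\<Sum>k<n. D k x)" for n
      unfolding D_def using sum_lessThan_telescope[of "\<lambda>k. F (r k) x" n] by simp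
    have "(\<lambda>n. F (r 0) x + (\<Sum>k<n. D k x)) \<longlonglongrightarrow> F (r 0) x + (\<Sum>k. D k x)"
      by (intro tendsto_intros summable_LIMSEQ summable_norm_cancel[OF sD])
    then have c: "convergent (\<lambda>n. F (r n) x)" unfolding tel[symmetric] by (auto simp: convergent_def)
    have "norm (F (r n) x) \<le> V x" for n
    proof -
      have "norm (\<Sum>k<n. D k x) \<le> (\<Sum>k<n. norm (D k x))" by (rule norm_sum)
      also have "\<dots> \<le> (\<Sum>k<n. (1/2) ^ k * S x powr (1 / p))" by (intro sum_mono Dk)
      also have "\<dots> \<le> (\<Sum>k. (1/2) ^ k * S x powr (1 / p))" by (rule sum_le_suminf[OF g]) auto
      also have "\<dots> = 2 * S x powr (1 / p)"
        by (subst suminf_mult2[symmetric]) (auto simp: suminf_geometric)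
      finally show ?thesis unfolding V_def tel[of n] using S0 norm_triangle_ineq[of "F (r 0) x" "\<Sum>k<n. D k x"] by simp
    qed
    then have "norm (F (r n) x) \<le> norm (V x)" for n
      using abs_ge_self[of "V x"] by (metis order_trans real_norm_def)
    with c show ?thesis by blast
  qed
  show ?thesis
  proof (rule that[OF r VL])
    show "G \<in> borel_measurable M" unfolding G_def[abs_def] by measurable
    show "AE x in M. (\<lambda>n. F (r n) x) \<longlonglongrightarrow> G x"
      using ts by eventually_elim (auto dest!: key simp: G_def convergent_LIMSEQ_iff)
    show "AE x in M. norm (F (r n) x) \<le> norm (V x)" for n
      using ts by eventually_elim (auto dest!: key)
  qed
qed

text \<open>Fatou's lemma with bounds C n that merely converge. This suits minimising sequences,
  whose energies approach the infimum without being below it.\<close>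

lemma Fatou_integral:
  fixes q :: "nat \<Rightarrow> 'a \<Rightarrow> real"
  assumes q: "\<And>n. integrable M (q n)" "\<And>n. AE x in M. 0 \<le> q n x" and l: "AE x in M. (\<lambda>n. q n x) \<longlonglongrightarrow> Q x"
    and [measurable]: "Q \<in> borel_measurable M" and C: "(\<lambda>n. C n) \<longlonglongrightarrow> C0" "\<And>n. (\<integral>x. q n x \<partial>M) \<le> C n"
  shows "integrable M Q" "(\<integral>x. Q x \<partial>M) \<le> C0"
proof -
  have [measurable]: "q n \<in> borel_measurable M" for n using q by auto
  have C0: "C n \<ge> 0" for n using C(2)[of n] integral_nonneg_AE[OF q(2)[of n]] by linarith
  have "AE x in M. \<forall>n. 0 \<le> q n x" using q(2) by (simp add: AE_all_countable)
  with l have Q0: "AE x in M. 0 \<le> Q x"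
    by eventually_elim (rule LIMSEQ_le_const, auto)
  have "(\<integral>\<^sup>+x. ennreal (Q x) \<partial>M) = (\<integral>\<^sup>+x. liminf (\<lambda>n. ennreal (q n x)) \<partial>M)"
    by (rule nn_integral_cong_AE) (use l in \<open>eventually_elim, auto intro!: lim_imp_Liminf[symmetric] tendsto_ennrealI\<close>)
  also have "\<dots> \<le> liminf (\<lambda>n. \<integral>\<^sup>+x. ennreal (q n x) \<partial>M)"
    by (rule nn_integral_liminf) auto
  also have "\<dots> = liminf (\<lambda>n. ennreal (\<integral>x. q n x \<partial>M))"
    using q by (simp add: nn_integral_eq_integral)
  also have "\<dots> \<le> liminf (\<lambda>n. ennreal (C n))"
    using C(2) by (intro Liminf_mono always_eventually) (auto intro: ennreal_leI)
  also have "\<dots> = ennreal C0"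
    using C(1) by (intro lim_imp_Liminf tendsto_ennrealI) auto
  finally have le: "(\<integral>\<^sup>+x. ennreal (Q x) \<partial>M) \<le> ennreal C0" .
  have "C0 \<ge> 0" using C(1) C0 by (intro LIMSEQ_le_const[OF C(1)]) auto
  show i: "integrable M Q"
    by (rule integrableI_nonneg) (use Q0 le in \<open>auto simp: le_less_trans less_top[symmetric] top_unique\<close>)
  have "ennreal (\<integral>x. Q x \<partial>M) \<le> ennreal C0" using le nn_integral_eq_integral[OF i Q0] by simp
  then show "(\<integral>x. Q x \<partial>M) \<le> C0" using \<open>C0 \<ge> 0\<close> by (simp add: ennreal_le_iff)
qed

text \<open>Riesz-Fischer produces some limit H with a majorant; H agrees with the given G because
  the integral of |H - G|^p is bounded by two errors that both vanish along the subsequence.\<close>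

lemma Lp_convergent_subsequence:
  fixes F :: "nat \<Rightarrow> 'a \<Rightarrow> 'b::euclidean_space"
  assumes p: "p > 0" and F: "\<And>n. in_Lp p M (F n)" and G: "in_Lp p M G"
    and l: "(\<lambda>n. \<integral>x. norm (F n x - G x) powr p \<partial>M) \<longlonglongrightarrow> 0"
  obtains r and V :: "'a \<Rightarrow> real" where "strict_mono r" "in_Lp p M V"
    "AE x in M. (\<lambda>n. F (r n) x) \<longlonglongrightarrow> G x" "\<And>n. AE x in M. norm (F (r n) x) \<le> norm (V x)"
proof -
  have tri: "(\<integral>x. norm (A x - B x) powr p \<partial>M) \<le> 2 powr p * ((\<integral>x. norm (A x - G x) powr p \<partial>M) + (\<integral>x. norm (B x - G x) powr p \<partial>M))"
    if "in_Lp p M A" "in_Lp p M B" for A B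
    using integral_norm_powr_add_le[of p M "\<lambda>x. A x - G x" "\<lambda>x. G x - B x"] that p G
    by (simp add: in_Lp_diff norm_minus_commute)
  have cau: "\<exists>N. \<forall>m\<ge>N. \<forall>n\<ge>N. (\<integral>x. norm (F m x - F n x) powr p \<partial>M) \<le> \<epsilon>" if "\<epsilon> > 0" for \<epsilon>
  proof -
    define e where "e = \<epsilon> / (2 * 2 powr p)"
    have "e > 0" unfolding e_def using that by simp
    then obtain N where N: "\<And>n. n \<ge> N \<Longrightarrow> (\<integral>x. norm (F n x - G x) powr p \<partial>M) < e"
      using order_tendstoD(2)[OF l] by (auto simp: eventually_sequentially)
    have "(\<integral>x. norm (F m x - F n x) powr p \<partial>M) \<le> \<epsilon>" if "m \<ge> N" "n \<ge> N" for m n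
    proof -
      have "(\<integral>x. norm (F m x - F n x) powr p \<partial>M) \<le> 2 powr p * (e + e)"
        using N[OF that(1)] N[OF that(2)] by (intro order_trans[OF tri[OF F F]] mult_left_mono add_mono) auto
      also have "\<dots> = \<epsilon>" by (simp add: e_def)
      finally show ?thesis .
    qed
    then show ?thesis by blast
  qed
  obtain r H and V :: "'a \<Rightarrow> real" where
    r: "strict_mono r" and V: "in_Lp p M V" and Hm: "H \<in> borel_measurable M"
    and ae: "AE x in M. (\<lambda>n. F (r n) x) \<longlonglongrightarrow> H x" and b: "\<And>n. AE x in M. norm (F (r n) x) \<le> norm (V x)"
    by (rule Riesz_Fischer[OF p F cau], assumption) (rule that)
  have dc: "in_Lp p M H" "(\<lambda>n. \<integral>x. norm (F (r n) x - H x) powr p \<partial>M) \<longlonglongrightarrow> 0"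
    by (rule Lp_dominated_convergence[OF p V in_Lp_measurable[OF F] Hm b ae])+
  have "(\<integral>x. norm (H x - G x) powr p \<partial>M) \<le> 0"
  proof (rule LIMSEQ_le_const)
    have "(\<lambda>n. \<integral>x. norm (F (r n) x - G x) powr p \<partial>M) \<longlonglongrightarrow> 0"
      using LIMSEQ_subseq_LIMSEQ[OF l r] by (simp add: o_def)
    with dc(2) have "(\<lambda>n. 2 powr p * ((\<integral>x. norm (F (r n) x - H x) powr p \<partial>M) + (\<integral>x. norm (F (r n) x - G x) powr p \<partial>M)))
      \<longlonglongrightarrow> 2 powr p * (0 + 0)" by (intro tendsto_intros)
    then show "(\<lambda>n. 2 powr p * ((\<integral>x. norm (F (r n) x - H x) powr p \<partial>M) + (\<integral>x. norm (F (r n) x - G x) powr p \<partial>M))) \<longlonglongrightarrow> 0"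
      by simp
    have "(\<integral>x. norm (H x - G x) powr p \<partial>M) \<le> 2 powr p * ((\<integral>x. norm (F (r n) x - H x) powr p \<partial>M) + (\<integral>x. norm (F (r n) x - G x) powr p \<partial>M))" for n
      using integral_norm_powr_add_le[of p M "\<lambda>x. H x - F (r n) x" "\<lambda>x. F (r n) x - G x"] p G dc(1) F
      by (simp add: in_Lp_diff norm_minus_commute)
    then show "\<exists>N. \<forall>n\<ge>N. (\<integral>x. norm (H x - G x) powr p \<partial>M) \<le> 2 powr p * ((\<integral>x. norm (F (r n) x - H x) powr p \<partial>M) + (\<integral>x. norm (F (r n) x - G x) powr p \<partial>M))"
      by blast
  qed
  moreover have "(\<integral>x. norm (H x - G x) powr p \<partial>M) \<ge> 0" by simp
  ultimately have "(\<integral>x. norm (H x - G x) powr p \<partial>M) = 0" by linarith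
  then have "AE x in M. norm (H x - G x) powr p = 0"
    using in_Lp_integrable[OF in_Lp_diff[OF less_imp_le[OF p] dc(1) G]]
    by (subst (asm) integral_nonneg_eq_0_iff_AE) auto
  with ae have "AE x in M. (\<lambda>n. F (r n) x) \<longlonglongrightarrow> G x"
    by eventually_elim simp
  with r V b show ?thesis by (intro that)
qed

lemma powr_Young_scaled:
  fixes p \<eta> :: real
  assumes "p > 1" "\<eta> > 0"
  obtains C where "C > 0" "\<And>x y. x \<ge> 0 \<Longrightarrow> y \<ge> 0 \<Longrightarrow> p * (x powr (p - 1) * y) \<le> \<eta> * x powr p + C * y powr p"
proof -
  \<comment> \<open>Young's inequality is applied to \<theta> x and y / \<theta>^(p-1), whose
    product of powers is unchanged; \<theta> solves (p - 1) \<theta>^p = \<eta>.\<close>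
  define \<theta> where "\<theta> = (\<eta> / (p - 1)) powr (1 / p)"
  have \<theta>: "\<theta> > 0" "\<theta> powr p = \<eta> / (p - 1)" unfolding \<theta>_def using assms by (auto simp: powr_powr)
  define C where "C = (1 / \<theta> powr (p - 1)) powr p"
  show ?thesis
  proof (rule that[of C])
    show "C > 0" unfolding C_def using \<theta> by simp
    fix x y :: real assume xy: "x \<ge> 0" "y \<ge> 0"
    have "p * (x powr (p - 1) * y) = p * ((\<theta> * x) powr (p - 1) * (1 / \<theta> powr (p - 1) * y))"
      using \<theta>(1) by (simp add: powr_mult)
    also have "\<dots> \<le> (p - 1) * (\<theta> * x) powr p + (1 / \<theta> powr (p - 1) * y) powr p"
      using assms xy \<theta>(1) by (intro powr_Young) auto
    also have "\<dots> = \<eta> * x powr p + C * y powr p"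
      unfolding C_def powr_mult \<theta>(2) using assms(1) by simp
    finally show "p * (x powr (p - 1) * y) \<le> \<eta> * x powr p + C * y powr p" .
  qed
qed

text \<open>The subgradient inequalities at t and at t + h confine the difference quotient between p
  times the flux at t and at t + h. Continuity of the flux finishes the argument, uniformly in t
  including t = 0.\<close>

lemma DERIV_abs_powr:
  fixes t p :: real
  assumes p: "p > 1"
  shows "((\<lambda>t. \<bar>t\<bar> powr p) has_real_derivative p * pflux p t) (at t)"
  unfolding DERIV_def
proof -
  have b: "\<bar>(\<bar>t + h\<bar> powr p - \<bar>t\<bar> powr p) / h - p * pflux p t\<bar> \<le> p * \<bar>pflux p (t + h) - pflux p t\<bar>" if "h \<noteq> 0" for h
  proof -
    have "\<bar>t + h\<bar> powr p \<ge> \<bar>t\<bar> powr p + p * (pflux p t * h)"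
      using pflux_subgradient[OF p, of t "t + h"] by simp
    moreover have "\<bar>t\<bar> powr p \<ge> \<bar>t + h\<bar> powr p - p * (pflux p (t + h) * h)"
      using pflux_subgradient[OF p, of "t + h" t] by simp
    ultimately have "\<bar>(\<bar>t + h\<bar> powr p - \<bar>t\<bar> powr p) - p * pflux p t * h\<bar> \<le> p * (pflux p (t + h) - pflux p t) * h"
      by (simp add: algebra_simps)
    also have "\<dots> \<le> \<bar>p * (pflux p (t + h) - pflux p t) * h\<bar>" by (rule abs_ge_self)
    also have "\<dots> = p * \<bar>pflux p (t + h) - pflux p t\<bar> * \<bar>h\<bar>" using p by (simp add: abs_mult)
    finally have "\<bar>(\<bar>t + h\<bar> powr p - \<bar>t\<bar> powr p) - p * pflux p t * h\<bar> / \<bar>h\<bar> \<le> p * \<bar>pflux p (t + h) - pflux p t\<bar>"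
      using that by (simp add: divide_le_eq)
    moreover have "\<bar>(\<bar>t + h\<bar> powr p - \<bar>t\<bar> powr p) - p * pflux p t * h\<bar> / \<bar>h\<bar> = \<bar>(\<bar>t + h\<bar> powr p - \<bar>t\<bar> powr p) / h - p * pflux p t\<bar>"
      using that by (subst abs_divide[symmetric]) (simp add: diff_divide_distrib)
    ultimately show ?thesis by simp
  qed
  have "((\<lambda>h. t + h) \<longlongrightarrow> t + 0) (at 0)" by (intro tendsto_intros)
  then have "((\<lambda>h. t + h) \<longlongrightarrow> t) (at 0)" by simp
  from tendsto_pflux[OF p this]
  have "((\<lambda>h. p * \<bar>pflux p (t + h) - pflux p t\<bar>) \<longlongrightarrow> p * \<bar>pflux p t - pflux p t\<bar>) (at 0)"
    by (intro tendsto_intros)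
  then have "((\<lambda>h. p * \<bar>pflux p (t + h) - pflux p t\<bar>) \<longlongrightarrow> 0) (at 0)" by simp
  then have "((\<lambda>h. (\<bar>t + h\<bar> powr p - \<bar>t\<bar> powr p) / h - p * pflux p t) \<longlongrightarrow> 0) (at 0)"
    by (rule Lim_null_comparison[rotated]) (use b in \<open>auto simp: eventually_at_filter\<close>)
  then show "(\<lambda>h. (\<bar>t + h\<bar> powr p - \<bar>t\<bar> powr p) / h) \<midarrow>0\<rightarrow> p * pflux p t"
    by (simp add: LIM_zero_iff)
qed

locale bounded_open =
  fixes \<Omega> :: "'a::euclidean_space set" and p :: real
  assumes \<Omega>_open: "open \<Omega>" and \<Omega>_bounded: "bounded \<Omega>" and p2: "2 \<le> p"
begin

abbreviation "L \<equiv> lebesgue_on \<Omega>"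

lemma p_gt: "p > 0" "p > 1" "p \<ge> 0" "p \<ge> 1" using p2 by auto

lemma \<Omega>_sets: "\<Omega> \<in> sets lebesgue" using \<Omega>_open by auto

sublocale finite_measure L
proof (rule finite_measure_lebesgue_on)
  show "\<Omega> \<in> lmeasurable" using \<Omega>_open \<Omega>_bounded by (simp add: lmeasurable_open)
qed

lemma continuous_measurable: "continuous_on UNIV f \<Longrightarrow> f \<in> borel_measurable L"
  for f :: "'a \<Rightarrow> 'b::euclidean_space"
  by (intro measurable_restrict_space1 measurable_completion) (simp add: borel_measurable_continuous_onI)

lemma in_Lp_bounded:
  fixes f :: "'a \<Rightarrow> 'b::euclidean_space"
  assumes "f \<in> borel_measurable L" "\<And>x. x \<in> \<Omega> \<Longrightarrow> norm (f x) \<le> B"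
  shows "in_Lp p L f"
  by (rule in_Lp_bound[of p L "\<lambda>_. B"]) (use assms p_gt in \<open>auto simp: in_Lp_def intro!: AE_I2 order_trans[OF _ abs_ge_self]\<close>)

lemma in_Lp_continuous:
  fixes f :: "'a \<Rightarrow> 'b::euclidean_space"
  assumes "continuous_on UNIV f"
  shows "in_Lp p L f"
proof -
  have "compact (closure \<Omega>)" using \<Omega>_bounded by (simp add: compact_closure)
  then obtain B where "\<And>x. x \<in> closure \<Omega> \<Longrightarrow> norm (f x) \<le> B"
    using continuous_on_compact_abs_le[OF _ continuous_on_subset[OF assms subset_UNIV]] by metis
  then show ?thesis
    using closure_subset[of \<Omega>] by (intro in_Lp_bounded[of f B] continuous_measurable assms) auto
qed

lemma in_Lp_imp_integrable: "in_Lp p L u \<Longrightarrow> integrable L u"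
  by (rule Bochner_Integration.integrable_bound[where f="\<lambda>x. 1 + norm (u x) powr p"])
     (use p_gt le_add_1_powr in \<open>auto simp: in_Lp_def intro!: AE_I2\<close>)

lemma integrable_imp_locally_integrable:
  assumes "integrable L (u :: 'a \<Rightarrow> 'b::euclidean_space)"
  shows "locally_integrable \<Omega> u"
  unfolding locally_integrable_def
proof (intro allI impI)
  fix K assume K: "compact K \<and> K \<subseteq> \<Omega>"
  then have Ks: "K \<in> sets lebesgue" by (simp add: borel_compact)
  have "integrable lebesgue (\<lambda>x. if x \<in> \<Omega> then u x else 0)"
    by (rule Lebesgue_Measure.integrable_restrict_UNIV[OF \<Omega>_sets, THEN iffD2]) fact
  then have "integrable lebesgue (\<lambda>x. indicator K x *\<^sub>R (if x \<in> \<Omega> then u x else 0))"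
    using Ks by (rule integrable_mult_indicator[rotated])
  also have "(\<lambda>x. indicator K x *\<^sub>R (if x \<in> \<Omega> then u x else 0)) = (\<lambda>x. if x \<in> K then u x else 0)"
    using K by (auto simp: indicator_def fun_eq_iff)
  finally show "integrable (lebesgue_on K) u"
    by (rule Lebesgue_Measure.integrable_restrict_UNIV[OF Ks, THEN iffD1])
qed

subsection \<open>The Sobolev space with zero boundary values\<close>

text \<open>Pairs \<open>(u, v)\<close> with \<open>u \<in> W\<^sub>0\<^sup>1\<^sup>,\<^sup>p\<close> and \<open>v = Du\<close> almost everywhere, without reference to the
  choice operator in \<^const>\<open>weak_grad\<close>.\<close>

definition sob0 :: "('a \<Rightarrow> real) \<Rightarrow> ('a \<Rightarrow> 'a) \<Rightarrow> bool" where
  "sob0 u v \<longleftrightarrow> in_Lp p L u \<and> in_Lp p L v \<and>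
     (\<forall>\<epsilon>>0. \<exists>\<phi>\<in>test_functions \<Omega>.
        (\<integral>x. norm (\<phi> x - u x) powr p \<partial>L) + (\<integral>x. norm (grad \<phi> x - v x) powr p \<partial>L) < \<epsilon>)"

lemma sob0_Lp: "sob0 u v \<Longrightarrow> in_Lp p L u" "sob0 u v \<Longrightarrow> in_Lp p L v"
  by (auto simp: sob0_def)

lemma test_in_Lp:
  assumes "\<phi> \<in> test_functions \<Omega>" shows "in_Lp p L \<phi>" "in_Lp p L (grad \<phi>)"
  using test_functions_continuous[OF assms] test_functions_grad_continuous[OF assms]
  by (auto intro: in_Lp_continuous)

lemma sob0_test: "\<phi> \<in> test_functions \<Omega> \<Longrightarrow> sob0 \<phi> (grad \<phi>)"
  unfolding sob0_def by (auto simp: test_in_Lp intro!: bexI[of _ \<phi>])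

text \<open>Exchanges approximation in norm for almost everywhere convergence with p-integrable
  majorants, both for the functions and for their gradients. Identities and inequalities for test
  functions then extend to \<open>sob0\<close> by dominated convergence. Two successive subsequences
  are extracted, one for the functions and one for the gradients.\<close>

lemma sob0_approx:
  assumes s: "sob0 u v"
  obtains \<phi> and U V :: "'a \<Rightarrow> real" where "\<And>n. \<phi> n \<in> test_functions \<Omega>" "in_Lp p L U" "in_Lp p L V"
    "AE x in L. (\<lambda>n. \<phi> n x) \<longlonglongrightarrow> u x" "AE x in L. (\<lambda>n. grad (\<phi> n) x) \<longlonglongrightarrow> v x"
    "\<And>n. AE x in L. norm (\<phi> n x) \<le> norm (U x)" "\<And>n. AE x in L. norm (grad (\<phi> n) x) \<le> norm (V x)"
proof -
  have "\<forall>n. \<exists>\<phi>\<in>test_functions \<Omega>.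
      (\<integral>x. norm (\<phi> x - u x) powr p \<partial>L) + (\<integral>x. norm (grad \<phi> x - v x) powr p \<partial>L) < 1 / real (Suc n)"
    using s unfolding sob0_def by auto
  then have "\<exists>\<phi>. \<forall>n. \<phi> n \<in> test_functions \<Omega> \<and>
      (\<integral>x. norm (\<phi> n x - u x) powr p \<partial>L) + (\<integral>x. norm (grad (\<phi> n) x - v x) powr p \<partial>L) < 1 / real (Suc n)"
    unfolding Bex_def by (rule choice)
  then obtain \<phi> where \<phi>0: "\<forall>n. \<phi> n \<in> test_functions \<Omega> \<and>
      (\<integral>x. norm (\<phi> n x - u x) powr p \<partial>L) + (\<integral>x. norm (grad (\<phi> n) x - v x) powr p \<partial>L) < 1 / real (Suc n)" ..
  have \<phi>: "\<phi> n \<in> test_functions \<Omega>"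
    and lt: "(\<integral>x. norm (\<phi> n x - u x) powr p \<partial>L) + (\<integral>x. norm (grad (\<phi> n) x - v x) powr p \<partial>L) < 1 / real (Suc n)" for n
    using \<phi>0[rule_format, of n] by (rule conjunct1, rule conjunct2)
  have inv: "(\<lambda>n. 1 / real (Suc n)) \<longlonglongrightarrow> 0" by (rule LIMSEQ_Suc[OF lim_1_over_n])
  have l1: "(\<lambda>n. \<integral>x. norm (\<phi> n x - u x) powr p \<partial>L) \<longlonglongrightarrow> 0"
  proof (rule Lim_null_comparison[OF always_eventually inv], intro allI)
    fix n
    have "(\<integral>x. norm (grad (\<phi> n) x - v x) powr p \<partial>L) \<ge> 0" "(\<integral>x. norm (\<phi> n x - u x) powr p \<partial>L) \<ge> 0" by simp_all
    with lt[of n] show "norm (\<integral>x. norm (\<phi> n x - u x) powr p \<partial>L) \<le> 1 / real (Suc n)" unfolding real_norm_def by linarith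
  qed
  have l2: "(\<lambda>n. \<integral>x. norm (grad (\<phi> n) x - v x) powr p \<partial>L) \<longlonglongrightarrow> 0"
  proof (rule Lim_null_comparison[OF always_eventually inv], intro allI)
    fix n
    have "(\<integral>x. norm (grad (\<phi> n) x - v x) powr p \<partial>L) \<ge> 0" "(\<integral>x. norm (\<phi> n x - u x) powr p \<partial>L) \<ge> 0" by simp_all
    with lt[of n] show "norm (\<integral>x. norm (grad (\<phi> n) x - v x) powr p \<partial>L) \<le> 1 / real (Suc n)" unfolding real_norm_def by linarith
  qed
  obtain r and U :: "'a \<Rightarrow> real" where r: "strict_mono r" "in_Lp p L U"
    "AE x in L. (\<lambda>n. \<phi> (r n) x) \<longlonglongrightarrow> u x" "\<And>n. AE x in L. norm (\<phi> (r n) x) \<le> norm (U x)"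
    by (rule Lp_convergent_subsequence[OF p_gt(1) test_in_Lp(1)[OF \<phi>] sob0_Lp(1)[OF s] l1]) (rule that)
  have l2': "(\<lambda>n. \<integral>x. norm (grad (\<phi> (r n)) x - v x) powr p \<partial>L) \<longlonglongrightarrow> 0"
    using LIMSEQ_subseq_LIMSEQ[OF l2 r(1)] by (simp add: o_def)
  obtain q and V :: "'a \<Rightarrow> real" where q: "strict_mono q" "in_Lp p L V"
    "AE x in L. (\<lambda>n. grad (\<phi> (r (q n))) x) \<longlonglongrightarrow> v x" "\<And>n. AE x in L. norm (grad (\<phi> (r (q n))) x) \<le> norm (V x)"
    by (rule Lp_convergent_subsequence[OF p_gt(1) test_in_Lp(2)[OF \<phi>] sob0_Lp(2)[OF s] l2']) (rule that)
  show ?thesis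
  proof (rule that[of "\<lambda>n. \<phi> (r (q n))" U V])
    show "AE x in L. (\<lambda>n. \<phi> (r (q n)) x) \<longlonglongrightarrow> u x"
      using r(3) by eventually_elim (drule LIMSEQ_subseq_LIMSEQ[OF _ q(1)], simp add: o_def)
  qed (fact \<phi> r(2) r(4) q)+
qed

lemma sob0_limit_Lp:
  assumes s: "\<And>n. sob0 (u n) (v n)" and L: "in_Lp p L u0" "in_Lp p L v0"
    and lu: "(\<lambda>n. \<integral>x. norm (u n x - u0 x) powr p \<partial>L) \<longlonglongrightarrow> 0"
    and lv: "(\<lambda>n. \<integral>x. norm (v n x - v0 x) powr p \<partial>L) \<longlonglongrightarrow> 0"
  shows "sob0 u0 v0"
  unfolding sob0_def
proof (intro conjI allI impI)
  fix \<epsilon> :: real assume e: "\<epsilon> > 0"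
  \<comment> \<open>Each use of the triangle inequality costs a factor \<open>2 powr p\<close>; the
    3 counts the errors below e: the joint error of the test function, the one of the function and
    the one of the gradient.\<close>
  define e where "e = \<epsilon> / (3 * 2 powr p)"
  have e0: "e > 0" using e by (simp add: e_def)
  from eventually_conj[OF order_tendstoD(2)[OF lu e0] order_tendstoD(2)[OF lv e0]]
  obtain n where n: "(\<integral>x. norm (u n x - u0 x) powr p \<partial>L) < e" "(\<integral>x. norm (v n x - v0 x) powr p \<partial>L) < e"
    by (auto dest!: eventually_happens)
  from s[of n] e0 obtain \<phi> where \<phi>: "\<phi> \<in> test_functions \<Omega>"
    and l: "(\<integral>x. norm (\<phi> x - u n x) powr p \<partial>L) + (\<integral>x. norm (grad \<phi> x - v n x) powr p \<partial>L) < e"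
    unfolding sob0_def by blast
  have "(\<integral>x. norm (\<phi> x - u0 x) powr p \<partial>L) \<le> 2 powr p * ((\<integral>x. norm (\<phi> x - u n x) powr p \<partial>L) + (\<integral>x. norm (u n x - u0 x) powr p \<partial>L))"
    using integral_norm_powr_add_le[of p L "\<lambda>x. \<phi> x - u n x" "\<lambda>x. u n x - u0 x"] p_gt L sob0_Lp[OF s] test_in_Lp[OF \<phi>]
    by (simp add: in_Lp_diff)
  moreover have "(\<integral>x. norm (grad \<phi> x - v0 x) powr p \<partial>L) \<le> 2 powr p * ((\<integral>x. norm (grad \<phi> x - v n x) powr p \<partial>L) + (\<integral>x. norm (v n x - v0 x) powr p \<partial>L))"
    using integral_norm_powr_add_le[of p L "\<lambda>x. grad \<phi> x - v n x" "\<lambda>x. v n x - v0 x"] p_gt L sob0_Lp[OF s] test_in_Lp[OF \<phi>]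
    by (simp add: in_Lp_diff)
  ultimately have "(\<integral>x. norm (\<phi> x - u0 x) powr p \<partial>L) + (\<integral>x. norm (grad \<phi> x - v0 x) powr p \<partial>L)
    \<le> 2 powr p * (((\<integral>x. norm (\<phi> x - u n x) powr p \<partial>L) + (\<integral>x. norm (grad \<phi> x - v n x) powr p \<partial>L)) +
        ((\<integral>x. norm (u n x - u0 x) powr p \<partial>L) + (\<integral>x. norm (v n x - v0 x) powr p \<partial>L)))"
    by (simp add: distrib_left)
  also have "\<dots> < 2 powr p * (e + (e + e))" using n l by (intro mult_strict_left_mono add_strict_mono) auto
  also have "\<dots> = \<epsilon>" by (simp add: e_def)
  finally show "\<exists>\<phi>\<in>test_functions \<Omega>. (\<integral>x. norm (\<phi> x - u0 x) powr p \<partial>L) + (\<integral>x. norm (grad \<phi> x - v0 x) powr p \<partial>L) < \<epsilon>"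
    using \<phi> by blast
qed (use L in auto)

lemma sob0_limit:
  fixes U V :: "'a \<Rightarrow> real"
  assumes s: "\<And>n. sob0 (u n) (v n)" and UV: "in_Lp p L U" "in_Lp p L V"
    and m: "u0 \<in> borel_measurable L" "v0 \<in> borel_measurable L"
    and lu: "AE x in L. (\<lambda>n. u n x) \<longlonglongrightarrow> u0 x" and lv: "AE x in L. (\<lambda>n. v n x) \<longlonglongrightarrow> v0 x"
    and b: "\<And>n. AE x in L. norm (u n x) \<le> norm (U x)" "\<And>n. AE x in L. norm (v n x) \<le> norm (V x)"
  shows "sob0 u0 v0"
proof -
  have mm: "u n \<in> borel_measurable L" "v n \<in> borel_measurable L" for n
    by (rule in_Lp_measurable[OF sob0_Lp(1)[OF s]], rule in_Lp_measurable[OF sob0_Lp(2)[OF s]])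
  note 1 = Lp_dominated_convergence[OF p_gt(1) UV(1) mm(1) m(1) b(1) lu]
  note 2 = Lp_dominated_convergence[OF p_gt(1) UV(2) mm(2) m(2) b(2) lv]
  show ?thesis by (rule sob0_limit_Lp[OF s 1(1) 2(1) 1(3) 2(3)])
qed

lemma test_functions_add:
  assumes "\<phi> \<in> test_functions \<Omega>" "\<psi> \<in> test_functions \<Omega>"
  shows "(\<lambda>x. a * \<phi> x + b * \<psi> x) \<in> test_functions \<Omega>"
    "grad (\<lambda>x. a * \<phi> x + b * \<psi> x) x = a *\<^sub>R grad \<phi> x + b *\<^sub>R grad \<psi> x"
proof -
  obtain K1 where K1: "compact K1" "K1 \<subseteq> \<Omega>" "\<And>x. x \<notin> K1 \<Longrightarrow> \<phi> x = 0" "\<And>x. x \<notin> K1 \<Longrightarrow> grad \<phi> x = 0"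
    by (rule test_functionsE[OF assms(1)]) (rule that)
  obtain K2 where K2: "compact K2" "K2 \<subseteq> \<Omega>" "\<And>x. x \<notin> K2 \<Longrightarrow> \<psi> x = 0" "\<And>x. x \<notin> K2 \<Longrightarrow> grad \<psi> x = 0"
    by (rule test_functionsE[OF assms(2)]) (rule that)
  show "(\<lambda>x. a * \<phi> x + b * \<psi> x) \<in> test_functions \<Omega>"
    by (rule test_functionsI[of _ "K1 \<union> K2"])
       (use K1 K2 test_functions_Ck[OF assms(1)] test_functions_Ck[OF assms(2)] in \<open>auto intro!: Ck_add Ck_cmult compact_Un\<close>)
  have "GDERIV (\<lambda>x. a * \<phi> x + b * \<psi> x) x :> (a *\<^sub>R grad \<phi> x + \<phi> x *\<^sub>R 0) + (b *\<^sub>R grad \<psi> x + \<psi> x *\<^sub>R 0)"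
    by (intro GDERIV_add GDERIV_mult GDERIV_const test_functions_GDERIV[OF assms(1)] test_functions_GDERIV[OF assms(2)])
  from GDERIV_imp_grad[OF this] show "grad (\<lambda>x. a * \<phi> x + b * \<psi> x) x = a *\<^sub>R grad \<phi> x + b *\<^sub>R grad \<psi> x" by simp
qed

lemma sob0_lincomb:
  assumes "sob0 u v" "sob0 u' v'"
  shows "sob0 (\<lambda>x. a * u x + b * u' x) (\<lambda>x. a *\<^sub>R v x + b *\<^sub>R v' x)"
proof -
  obtain \<phi> and U V :: "'a \<Rightarrow> real" where 1: "\<And>n. \<phi> n \<in> test_functions \<Omega>" "in_Lp p L U" "in_Lp p L V"
    "AE x in L. (\<lambda>n. \<phi> n x) \<longlonglongrightarrow> u x" "AE x in L. (\<lambda>n. grad (\<phi> n) x) \<longlonglongrightarrow> v x"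
    "\<And>n. AE x in L. norm (\<phi> n x) \<le> norm (U x)" "\<And>n. AE x in L. norm (grad (\<phi> n) x) \<le> norm (V x)"
    by (rule sob0_approx[OF assms(1)]) (rule that)
  obtain \<phi>' and U' V' :: "'a \<Rightarrow> real" where 2: "\<And>n. \<phi>' n \<in> test_functions \<Omega>" "in_Lp p L U'" "in_Lp p L V'"
    "AE x in L. (\<lambda>n. \<phi>' n x) \<longlonglongrightarrow> u' x" "AE x in L. (\<lambda>n. grad (\<phi>' n) x) \<longlonglongrightarrow> v' x"
    "\<And>n. AE x in L. norm (\<phi>' n x) \<le> norm (U' x)" "\<And>n. AE x in L. norm (grad (\<phi>' n) x) \<le> norm (V' x)"
    by (rule sob0_approx[OF assms(2)]) (rule that)
  note m = sob0_Lp[OF assms(1), THEN in_Lp_measurable] sob0_Lp[OF assms(2), THEN in_Lp_measurable]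
  have [measurable]: "u \<in> borel_measurable L" "v \<in> borel_measurable L" "u' \<in> borel_measurable L" "v' \<in> borel_measurable L"
    using m by auto
  have lin: "in_Lp p L (\<lambda>x. \<bar>a\<bar> *\<^sub>R norm (A x) + \<bar>b\<bar> *\<^sub>R norm (B x))" if "in_Lp p L A" "in_Lp p L B" for A B :: "'a \<Rightarrow> real"
    using that p_gt by (intro in_Lp_add in_Lp_scaleR in_Lp_norm) auto
  show ?thesis
  proof (rule sob0_limit[OF sob0_test[OF test_functions_add(1)[OF 1(1) 2(1)]] lin[OF 1(2) 2(2)] lin[OF 1(3) 2(3)]], unfold test_functions_add(2)[OF 1(1) 2(1)])
    show "AE x in L. (\<lambda>n. a * \<phi> n x + b * \<phi>' n x) \<longlonglongrightarrow> a * u x + b * u' x"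
      using 1(4) 2(4) by eventually_elim (intro tendsto_intros)
    show "AE x in L. (\<lambda>n. a *\<^sub>R grad (\<phi> n) x + b *\<^sub>R grad (\<phi>' n) x) \<longlonglongrightarrow> a *\<^sub>R v x + b *\<^sub>R v' x"
      using 1(5) 2(5) by eventually_elim (intro tendsto_intros)
    show "AE x in L. norm (a * \<phi> n x + b * \<phi>' n x) \<le> norm (\<bar>a\<bar> *\<^sub>R norm (U x) + \<bar>b\<bar> *\<^sub>R norm (U' x))" for n
      using 1(6)[of n] 2(6)[of n]
    proof eventually_elim
      case (elim x)
      have "norm (a * \<phi> n x + b * \<phi>' n x) \<le> norm (a * \<phi> n x) + norm (b * \<phi>' n x)" by (rule norm_triangle_ineq)
      also have "\<dots> \<le> \<bar>a\<bar> * norm (U x) + \<bar>b\<bar> * norm (U' x)" unfolding norm_mult real_norm_def[of a] real_norm_def[of b]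
        using elim by (intro add_mono mult_left_mono) auto
      finally show ?case by simp
    qed
    show "AE x in L. norm (a *\<^sub>R grad (\<phi> n) x + b *\<^sub>R grad (\<phi>' n) x) \<le> norm (\<bar>a\<bar> *\<^sub>R norm (V x) + \<bar>b\<bar> *\<^sub>R norm (V' x))" for n
      using 1(7)[of n] 2(7)[of n]
    proof eventually_elim
      case (elim x)
      have "norm (a *\<^sub>R grad (\<phi> n) x + b *\<^sub>R grad (\<phi>' n) x) \<le> norm (a *\<^sub>R grad (\<phi> n) x) + norm (b *\<^sub>R grad (\<phi>' n) x)" by (rule norm_triangle_ineq)
      also have "\<dots> \<le> \<bar>a\<bar> * norm (V x) + \<bar>b\<bar> * norm (V' x)" unfolding norm_scaleR
        using elim by (intro add_mono mult_left_mono) auto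
      finally show ?case by simp
    qed
  qed measurable
qed

lemma sob0_diff: "sob0 u v \<Longrightarrow> sob0 u' v' \<Longrightarrow> sob0 (\<lambda>x. u x - u' x) (\<lambda>x. v x - v' x)"
  using sob0_lincomb[of u v u' v' 1 "-1"] by simp

end

context bounded_open
begin

section \<open>Agreement of \<open>sob0\<close> with the Sobolev space built on
  \<open>weak_grad\<close>\<close>

lemma borel_measurable_L_AE:
  fixes f g :: "'a \<Rightarrow> 'b::euclidean_space"
  assumes "f \<in> borel_measurable L" "AE x in L. f x = g x"
  shows "g \<in> borel_measurable L"
proof -
  have "(\<lambda>x. if x \<in> \<Omega> then f x else 0) \<in> borel_measurable lebesgue"
    by (rule borel_measurable_if_I[OF assms(1) \<Omega>_sets])
  moreover have "AE x in lebesgue. x \<in> \<Omega> \<longrightarrow> f x = g x"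
    using assms(2) \<Omega>_sets by (simp add: AE_restrict_space_iff)
  then have "AE x in lebesgue. (if x \<in> \<Omega> then f x else 0) = (if x \<in> \<Omega> then g x else 0)"
    by eventually_elim simp
  \<comment> \<open>Completeness of Lebesgue measure enters here. Without it, a weak gradient picked
    by the choice operator, known only up to a null set, could not be shown to be measurable this
    way.\<close>
  ultimately have "(\<lambda>x. if x \<in> \<Omega> then g x else 0) \<in> borel_measurable lebesgue"
    by (rule borel_measurable_AE)
  then show ?thesis by (rule borel_measurable_if_D)
qed

text \<open>Integration by parts holds for the approximating test functions, and both sides pass to
  the limit because the second test function and its gradient are bounded.\<close>

lemma sob0_has_weak_gradient:
  assumes s: "sob0 u v"
  shows "has_weak_gradient \<Omega> u v"
proof -
  note mv = sob0_Lp[OF s, THEN in_Lp_measurable]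
  have [measurable]: "u \<in> borel_measurable L" "v \<in> borel_measurable L" using mv by auto
  obtain \<phi> and U V :: "'a \<Rightarrow> real" where a: "\<And>n. \<phi> n \<in> test_functions \<Omega>" "in_Lp p L U" "in_Lp p L V"
    "AE x in L. (\<lambda>n. \<phi> n x) \<longlonglongrightarrow> u x" "AE x in L. (\<lambda>n. grad (\<phi> n) x) \<longlonglongrightarrow> v x"
    "\<And>n. AE x in L. norm (\<phi> n x) \<le> norm (U x)" "\<And>n. AE x in L. norm (grad (\<phi> n) x) \<le> norm (V x)"
    by (rule sob0_approx[OF s]) (rule that)
  have "(\<integral>x. u x * partial_deriv i \<psi> x \<partial>L) = - (\<integral>x. (v x \<bullet> i) * \<psi> x \<partial>L)"
    if \<psi>: "\<psi> \<in> test_functions \<Omega>" and i: "i \<in> Basis" for \<psi> i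
  proof -
    obtain B where B: "\<And>x. \<bar>\<psi> x\<bar> \<le> B" "\<And>x. norm (grad \<psi> x) \<le> B" "B > 0"
      by (rule test_functions_bounded[OF \<psi>]) (rule that)
    have [measurable]: "\<psi> \<in> borel_measurable L" "grad \<psi> \<in> borel_measurable L" "\<phi> n \<in> borel_measurable L" "grad (\<phi> n) \<in> borel_measurable L" for n
      using test_in_Lp[OF \<psi>, THEN in_Lp_measurable] test_in_Lp[OF a(1), THEN in_Lp_measurable] by auto
    have pd: "partial_deriv i \<psi> x = grad \<psi> x \<bullet> i" for x by (simp add: grad_inner_Basis i)
    have pB: "\<bar>grad \<psi> x \<bullet> i\<bar> \<le> B" for x using Basis_le_norm[OF i, of "grad \<psi> x"] B(2)[of x] by linarith
    have l1: "(\<lambda>n. \<integral>x. \<phi> n x * (grad \<psi> x \<bullet> i) \<partial>L) \<longlonglongrightarrow> (\<integral>x. u x * (grad \<psi> x \<bullet> i) \<partial>L)"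
    proof (rule integral_dominated_convergence)
      show "integrable L (\<lambda>x. norm (U x) * B)" using in_Lp_imp_integrable[OF a(2)] by simp
      show "AE x in L. (\<lambda>n. \<phi> n x * (grad \<psi> x \<bullet> i)) \<longlonglongrightarrow> u x * (grad \<psi> x \<bullet> i)"
        using a(4) by eventually_elim (intro tendsto_intros)
      show "AE x in L. norm (\<phi> n x * (grad \<psi> x \<bullet> i)) \<le> norm (U x) * B" for n
        using a(6)[of n] by eventually_elim (unfold norm_mult, intro mult_mono, use pB in auto)
    qed measurable
    have l2: "(\<lambda>n. \<integral>x. (grad (\<phi> n) x \<bullet> i) * \<psi> x \<partial>L) \<longlonglongrightarrow> (\<integral>x. (v x \<bullet> i) * \<psi> x \<partial>L)"
    proof (rule integral_dominated_convergence)
      show "integrable L (\<lambda>x. norm (V x) * B)" using in_Lp_imp_integrable[OF a(3)] by simp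
      show "AE x in L. (\<lambda>n. (grad (\<phi> n) x \<bullet> i) * \<psi> x) \<longlonglongrightarrow> (v x \<bullet> i) * \<psi> x"
        using a(5) by eventually_elim (intro tendsto_intros)
      show "AE x in L. norm ((grad (\<phi> n) x \<bullet> i) * \<psi> x) \<le> norm (V x) * B" for n
        using a(7)[of n]
      proof eventually_elim
        case (elim x)
        have "\<bar>grad (\<phi> n) x \<bullet> i\<bar> \<le> norm (V x)" using Basis_le_norm[OF i, of "grad (\<phi> n) x"] elim by linarith
        then show ?case unfolding norm_mult using B(1)[of x] by (intro mult_mono) auto
      qed
    qed measurable
    have eq: "(\<integral>x. \<phi> n x * (grad \<psi> x \<bullet> i) \<partial>L) = - (\<integral>x. (grad (\<phi> n) x \<bullet> i) * \<psi> x \<partial>L)" for n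
    proof -
      obtain B where "\<And>x. \<bar>\<phi> n x\<bar> \<le> B" and B: "\<And>x. norm (grad (\<phi> n) x) \<le> B" and "B > 0"
        by (rule test_functions_bounded[OF a(1)[of n]]) (rule that)
      have "\<exists>B. \<forall>x\<in>cball 0 R. norm (grad (\<phi> n) x) \<le> B" for R using B by blast
      from test_functions_ibp(3)[OF \<psi> test_functions_GDERIV[OF a(1)] this \<Omega>_sets i] show ?thesis unfolding pd .
    qed
    from LIMSEQ_unique[OF l1, unfolded eq, OF tendsto_minus[OF l2]] show ?thesis unfolding pd .
  qed
  then show ?thesis unfolding has_weak_gradient_def
    using sob0_Lp[OF s] by (blast intro: integrable_imp_locally_integrable in_Lp_imp_integrable)
qed

lemma sob0_weak_grad:
  assumes s: "sob0 u v"
  shows "AE x in L. weak_grad \<Omega> u x = v x" "weak_grad \<Omega> u \<in> borel_measurable L"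
proof -
  have "has_weak_gradient \<Omega> u (weak_grad \<Omega> u)"
    unfolding weak_grad_def by (rule someI[where P="has_weak_gradient \<Omega> u"]) (rule sob0_has_weak_gradient[OF s])
  from has_weak_gradient_unique[OF \<Omega>_open this sob0_has_weak_gradient[OF s]]
  show ae: "AE x in L. weak_grad \<Omega> u x = v x" .
  show "weak_grad \<Omega> u \<in> borel_measurable L"
    by (rule borel_measurable_L_AE[OF in_Lp_measurable[OF sob0_Lp(2)[OF s]]])
       (use ae in eventually_elim, simp)
qed

lemma sob0_imp_W0:
  assumes s: "sob0 u v"
  shows "u \<in> sobolev_W0 p \<Omega>"
  unfolding sobolev_W0_def
proof (intro CollectI conjI allI impI)
  show "u \<in> sobolev_W p \<Omega>"
    unfolding sobolev_W_def Lp_space_iff using s sob0_Lp[OF s] sob0_has_weak_gradient[OF s] by auto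
  fix \<epsilon> :: real assume e: "\<epsilon> > 0"
  then have "\<epsilon> powr p > 0" by simp
  with s obtain \<phi> where \<phi>: "\<phi> \<in> test_functions \<Omega>"
    and lt: "(\<integral>x. norm (\<phi> x - u x) powr p \<partial>L) + (\<integral>x. norm (grad \<phi> x - v x) powr p \<partial>L) < \<epsilon> powr p"
    unfolding sob0_def by blast
  have d: "sob0 (\<lambda>x. u x - \<phi> x) (\<lambda>x. v x - grad \<phi> x)" by (rule sob0_diff[OF s sob0_test[OF \<phi>]])
  have "(\<integral>x. norm (weak_grad \<Omega> (\<lambda>x. u x - \<phi> x) x) powr p \<partial>L) = (\<integral>x. norm (grad \<phi> x - v x) powr p \<partial>L)"
  proof (rule integral_cong_AE)
    show "(\<lambda>x. norm (weak_grad \<Omega> (\<lambda>x. u x - \<phi> x) x) powr p) \<in> borel_measurable L" using sob0_weak_grad(2)[OF d] by measurable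
    have [measurable]: "v \<in> borel_measurable L" "grad \<phi> \<in> borel_measurable L"
      using sob0_Lp(2)[OF s] test_in_Lp(2)[OF \<phi>] by (auto dest: in_Lp_measurable)
    show "(\<lambda>x. norm (grad \<phi> x - v x) powr p) \<in> borel_measurable L" by measurable
    show "AE x in L. norm (weak_grad \<Omega> (\<lambda>x. u x - \<phi> x) x) powr p = norm (grad \<phi> x - v x) powr p"
      using sob0_weak_grad(1)[OF d] by eventually_elim (simp add: norm_minus_commute)
  qed
  then have "sobolev_norm p \<Omega> (\<lambda>x. u x - \<phi> x) = ((\<integral>x. norm (\<phi> x - u x) powr p \<partial>L) + (\<integral>x. norm (grad \<phi> x - v x) powr p \<partial>L)) powr (1 / p)"
    unfolding sobolev_norm_def by (simp add: abs_minus_commute)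
  also have "\<dots> < (\<epsilon> powr p) powr (1 / p)"
    using lt p_gt by (intro powr_less_mono2 add_nonneg_nonneg) auto
  also have "\<dots> = \<epsilon>" using e p_gt by (simp add: powr_powr)
  finally show "\<exists>\<phi>\<in>test_functions \<Omega>. sobolev_norm p \<Omega> (\<lambda>x. u x - \<phi> x) < \<epsilon>" using \<phi> by blast
qed

text \<open>The Sobolev norm contains the chosen gradient of the difference u - \<phi>, not the
  difference of gradients. So the latter is shown to be a weak gradient of u - \<phi>, and
  uniqueness identifies the two almost everywhere.\<close>

lemma W0_imp_sob0:
  assumes u: "u \<in> sobolev_W0 p \<Omega>"
  shows "sob0 u (weak_grad \<Omega> u)"
proof -
  from u obtain v where uL: "in_Lp p L u" and v: "has_weak_gradient \<Omega> u v" "in_Lp p L v"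
    unfolding sobolev_W0_def sobolev_W_def Lp_space_iff by blast
  have wg: "has_weak_gradient \<Omega> u (weak_grad \<Omega> u)"
    unfolding weak_grad_def by (rule someI[where P="has_weak_gradient \<Omega> u"]) (rule v)
  have wv: "AE x in L. v x = weak_grad \<Omega> u x" by (rule has_weak_gradient_unique[OF \<Omega>_open v(1) wg])
  have wm: "weak_grad \<Omega> u \<in> borel_measurable L" by (rule borel_measurable_L_AE[OF in_Lp_measurable[OF v(2)] wv])
  have wL: "in_Lp p L (weak_grad \<Omega> u)"
    by (rule in_Lp_bound[OF p_gt(3) v(2) wm]) (use wv in eventually_elim, simp)
  show ?thesis unfolding sob0_def
  proof (intro conjI uL wL allI impI)
    fix \<epsilon> :: real assume e: "\<epsilon> > 0"
    then have "\<epsilon> powr (1 / p) > 0" by simp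
    with u obtain \<phi> where \<phi>: "\<phi> \<in> test_functions \<Omega>" and lt: "sobolev_norm p \<Omega> (\<lambda>x. u x - \<phi> x) < \<epsilon> powr (1 / p)"
      unfolding sobolev_W0_def by blast
    let ?I = "(\<integral>x. norm (\<phi> x - u x) powr p \<partial>L) + (\<integral>x. norm (grad \<phi> x - weak_grad \<Omega> u x) powr p \<partial>L)"
    have hd: "has_weak_gradient \<Omega> (\<lambda>x. u x - \<phi> x) (\<lambda>x. weak_grad \<Omega> u x - grad \<phi> x)"
      unfolding has_weak_gradient_def
    proof (intro conjI ballI)
      note ht = sob0_has_weak_gradient[OF sob0_test[OF \<phi>]]
      show "locally_integrable \<Omega> (\<lambda>x. u x - \<phi> x)"
        by (intro integrable_imp_locally_integrable in_Lp_imp_integrable in_Lp_diff uL test_in_Lp \<phi> p_gt)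
      show "locally_integrable \<Omega> (\<lambda>x. weak_grad \<Omega> u x - grad \<phi> x)"
        by (intro integrable_imp_locally_integrable in_Lp_imp_integrable in_Lp_diff wL test_in_Lp \<phi> p_gt)
      fix \<psi> and i :: 'a assume \<psi>: "\<psi> \<in> test_functions \<Omega>" and i: "i \<in> Basis"
      obtain K where K: "compact K" "K \<subseteq> \<Omega>" "\<And>x. x \<notin> K \<Longrightarrow> \<psi> x = 0" "\<And>x. x \<notin> K \<Longrightarrow> grad \<psi> x = 0"
        by (rule test_functionsE[OF \<psi>]) (rule that)
      have pd: "partial_deriv i \<psi> = (\<lambda>x. grad \<psi> x \<bullet> i)" by (simp add: fun_eq_iff grad_inner_Basis i)
      have c: "continuous_on UNIV (\<lambda>x. grad \<psi> x \<bullet> i)"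
        by (intro continuous_on_inner test_functions_grad_continuous[OF \<psi>] continuous_on_const)
      have li: "locally_integrable \<Omega> u" "locally_integrable \<Omega> \<phi>" "locally_integrable \<Omega> (\<lambda>x. weak_grad \<Omega> u x \<bullet> i)" "locally_integrable \<Omega> (\<lambda>x. grad \<phi> x \<bullet> i)"
        using in_Lp_imp_integrable[OF uL] in_Lp_imp_integrable[OF wL] test_in_Lp[OF \<phi>, THEN in_Lp_imp_integrable]
        by (auto intro!: integrable_imp_locally_integrable)
      have Z: "\<And>x. x \<notin> K \<Longrightarrow> grad \<psi> x \<bullet> i = 0" using K(4) by simp
      note i1 = locally_integrable_mult_continuous[OF li(1) K(1,2) Z c \<Omega>_sets]
        locally_integrable_mult_continuous[OF li(2) K(1,2) Z c \<Omega>_sets]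
        locally_integrable_mult_continuous[OF li(3) K(1,2) K(3) test_functions_continuous[OF \<psi>] \<Omega>_sets]
        locally_integrable_mult_continuous[OF li(4) K(1,2) K(3) test_functions_continuous[OF \<psi>] \<Omega>_sets]
      have e1: "(\<integral>x. u x * partial_deriv i \<psi> x \<partial>L) = - (\<integral>x. (weak_grad \<Omega> u x \<bullet> i) * \<psi> x \<partial>L)"
        using wg \<psi> i unfolding has_weak_gradient_def by blast
      have e2: "(\<integral>x. \<phi> x * partial_deriv i \<psi> x \<partial>L) = - (\<integral>x. (grad \<phi> x \<bullet> i) * \<psi> x \<partial>L)"
        using ht \<psi> i unfolding has_weak_gradient_def by blast
      show "(\<integral>x. (u x - \<phi> x) * partial_deriv i \<psi> x \<partial>L) = - (\<integral>x. ((weak_grad \<Omega> u x - grad \<phi> x) \<bullet> i) * \<psi> x \<partial>L)"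
        using e1 e2 i1 unfolding pd by (simp add: left_diff_distrib inner_diff_left)
    qed
    have "has_weak_gradient \<Omega> (\<lambda>x. u x - \<phi> x) (weak_grad \<Omega> (\<lambda>x. u x - \<phi> x))"
      unfolding weak_grad_def by (rule someI[where P="has_weak_gradient \<Omega> (\<lambda>x. u x - \<phi> x)"]) (rule hd)
    from has_weak_gradient_unique[OF \<Omega>_open hd this]
    have ae: "AE x in L. weak_grad \<Omega> u x - grad \<phi> x = weak_grad \<Omega> (\<lambda>x. u x - \<phi> x) x" .
    have [measurable]: "grad \<phi> \<in> borel_measurable L" "weak_grad \<Omega> u \<in> borel_measurable L"
      using test_in_Lp(2)[OF \<phi>] wm by (auto dest: in_Lp_measurable)
    have [measurable]: "weak_grad \<Omega> (\<lambda>x. u x - \<phi> x) \<in> borel_measurable L"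
      by (rule borel_measurable_L_AE[OF _ ae]) measurable
    have "(\<integral>x. norm (weak_grad \<Omega> (\<lambda>x. u x - \<phi> x) x) powr p \<partial>L) = (\<integral>x. norm (grad \<phi> x - weak_grad \<Omega> u x) powr p \<partial>L)"
      by (rule integral_cong_AE) (measurable, use ae in eventually_elim, metis norm_minus_commute)
    then have "sobolev_norm p \<Omega> (\<lambda>x. u x - \<phi> x) = ?I powr (1 / p)"
      unfolding sobolev_norm_def by (simp add: abs_minus_commute)
    with lt have lt': "?I powr (1 / p) < \<epsilon> powr (1 / p)" by simp
    have "?I < \<epsilon>"
    proof (rule ccontr)
      assume "\<not> ?I < \<epsilon>"
      then have "\<epsilon> powr (1 / p) \<le> ?I powr (1 / p)" using e p_gt by (intro powr_mono2) auto
      with lt' show False by linarith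
    qed
    then show "\<exists>\<phi>\<in>test_functions \<Omega>. (\<integral>x. norm (\<phi> x - u x) powr p \<partial>L) + (\<integral>x. norm (grad \<phi> x - weak_grad \<Omega> u x) powr p \<partial>L) < \<epsilon>"
      using \<phi> by blast
  qed
qed

subsection \<open>Truncation from below by a smooth barrier\<close>

text \<open>For an approximating test function the composition with
  \<open>smooth_pos \<delta>\<close> after subtracting W is again a test function: W is smooth, and
  where the test function vanishes the argument is -W \<le> 0, at which \<open>smooth_pos\<close> is
  exactly 0. The limit in the test functions is taken for fixed \<delta>, and then \<delta> tends to
  0.\<close>

lemma sob0_pos_part:
  assumes s: "sob0 u v" and W: "\<And>k. Ck k W" "\<And>x. W x \<ge> 0"
  shows "sob0 (\<lambda>x. max 0 (u x - W x)) (\<lambda>x. if u x > W x then v x - grad W x else 0)"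
proof -
  note mv = sob0_Lp[OF s, THEN in_Lp_measurable]
  have Wc: "continuous_on UNIV W" using W(1)[of 0] by simp
  have gWc: "continuous_on UNIV (grad W)" by (rule Ck_grad_continuous) (rule W)
  have [measurable]: "u \<in> borel_measurable L" "v \<in> borel_measurable L" "W \<in> borel_measurable L" "grad W \<in> borel_measurable L"
    using mv Wc gWc by (auto intro: continuous_measurable)
  have gWL: "in_Lp p L (grad W)" by (rule in_Lp_continuous[OF gWc])
  have step: "sob0 (\<lambda>x. smooth_pos \<delta> (u x - W x)) (\<lambda>x. smooth_pos' \<delta> (u x - W x) *\<^sub>R (v x - grad W x))" if \<delta>: "\<delta> > 0" for \<delta>
  proof -
    obtain \<phi> and U V :: "'a \<Rightarrow> real" where a: "\<And>n. \<phi> n \<in> test_functions \<Omega>" "in_Lp p L U" "in_Lp p L V"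
      "AE x in L. (\<lambda>n. \<phi> n x) \<longlonglongrightarrow> u x" "AE x in L. (\<lambda>n. grad (\<phi> n) x) \<longlonglongrightarrow> v x"
      "\<And>n. AE x in L. norm (\<phi> n x) \<le> norm (U x)" "\<And>n. AE x in L. norm (grad (\<phi> n) x) \<le> norm (V x)"
      by (rule sob0_approx[OF s]) (rule that)
    have t: "(\<lambda>x. smooth_pos \<delta> (\<phi> n x - W x)) \<in> test_functions \<Omega>" for n
    proof -
      obtain K where K: "compact K" "K \<subseteq> \<Omega>" "\<And>x. x \<notin> K \<Longrightarrow> \<phi> n x = 0" "\<And>x. x \<notin> K \<Longrightarrow> grad (\<phi> n) x = 0"
        by (rule test_functionsE[OF a(1)]) (rule that)
      show ?thesis
      proof (rule test_functionsI[OF _ K(1,2)])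
        show "Ck k (\<lambda>x. smooth_pos \<delta> (\<phi> n x - W x))" for k
          by (intro Ck_smooth_pos \<delta> Ck_diff W test_functions_Ck[OF a(1)])
        show "smooth_pos \<delta> (\<phi> n x - W x) = 0" if "x \<notin> K" for x
          using K(3)[OF that] W(2)[of x] by (simp add: smooth_pos_def smooth_step_def)
      qed
    qed
    have g: "grad (\<lambda>x. smooth_pos \<delta> (\<phi> n x - W x)) x = smooth_pos' \<delta> (\<phi> n x - W x) *\<^sub>R (grad (\<phi> n) x - grad W x)" for n x
      by (intro GDERIV_imp_grad GDERIV_DERIV_compose[OF GDERIV_diff smooth_pos_has_derivative] test_functions_GDERIV[OF a(1)] Ck_GDERIV[OF W(1)] \<delta>)
    have cs: "isCont (smooth_pos \<delta>) s" for s using DERIV_isCont[OF smooth_pos_has_derivative[OF \<delta>]] .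
    have cs': "isCont (smooth_pos' \<delta>) s" for s using smooth_pos'_isCont[OF \<delta>] .
    have [measurable]: "smooth_pos \<delta> \<in> borel_measurable borel" "smooth_pos' \<delta> \<in> borel_measurable borel"
      using cs cs' by (auto intro!: borel_measurable_continuous_onI continuous_at_imp_continuous_on)
    have VL: "in_Lp p L (\<lambda>x. norm (V x) + norm (grad W x))"
      by (intro in_Lp_add in_Lp_norm a gWL p_gt)
    show ?thesis
    proof (rule sob0_limit[OF sob0_test[OF t] a(2) VL], unfold g)
      show "AE x in L. (\<lambda>n. smooth_pos \<delta> (\<phi> n x - W x)) \<longlonglongrightarrow> smooth_pos \<delta> (u x - W x)"
        using a(4) by eventually_elim (intro isCont_tendsto_compose[OF cs] tendsto_intros)
      show "AE x in L. (\<lambda>n. smooth_pos' \<delta> (\<phi> n x - W x) *\<^sub>R (grad (\<phi> n) x - grad W x)) \<longlonglongrightarrow> smooth_pos' \<delta> (u x - W x) *\<^sub>R (v x - grad W x)"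
        using a(4,5) by eventually_elim (intro tendsto_scaleR isCont_tendsto_compose[OF cs'] tendsto_diff tendsto_const)
      show "AE x in L. norm (smooth_pos \<delta> (\<phi> n x - W x)) \<le> norm (U x)" for n
        using a(6)[of n]
      proof eventually_elim
        case (elim x)
        then show ?case using smooth_pos_bounds[of \<delta> "\<phi> n x - W x"] \<delta> W(2)[of x] by (simp add: max_def split: if_splits)
      qed
      show "AE x in L. norm (smooth_pos' \<delta> (\<phi> n x - W x) *\<^sub>R (grad (\<phi> n) x - grad W x)) \<le> norm (norm (V x) + norm (grad W x))" for n
        using a(7)[of n]
      proof eventually_elim
        case (elim x)
        have "norm (smooth_pos' \<delta> (\<phi> n x - W x) *\<^sub>R (grad (\<phi> n) x - grad W x)) \<le> 1 * (norm (grad (\<phi> n) x) + norm (grad W x))"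
          unfolding norm_scaleR using smooth_pos'_bounds[of \<delta> "\<phi> n x - W x"] \<delta>
          by (intro mult_mono norm_triangle_ineq4) auto
        then show ?case using elim by simp
      qed
    qed measurable
  qed
  have uL: "in_Lp p L u" using s by (rule sob0_Lp)
  have VL: "in_Lp p L (\<lambda>x. norm (v x - grad W x))"
    by (intro in_Lp_norm in_Lp_diff sob0_Lp(2)[OF s] gWL p_gt)
  have d: "1 / real (Suc n) > 0" for n by simp
  show ?thesis
  proof (rule sob0_limit[OF step[OF d] uL VL])
    show "AE x in L. (\<lambda>n. smooth_pos (1 / real (Suc n)) (u x - W x)) \<longlonglongrightarrow> max 0 (u x - W x)"
      by (intro AE_I2 smooth_pos_tendsto)
    show "AE x in L. (\<lambda>n. smooth_pos' (1 / real (Suc n)) (u x - W x) *\<^sub>R (v x - grad W x)) \<longlonglongrightarrow> (if u x > W x then v x - grad W x else 0)"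
    proof (intro AE_I2)
      fix x
      have "(\<lambda>n. smooth_pos' (1 / real (Suc n)) (u x - W x) *\<^sub>R (v x - grad W x)) \<longlonglongrightarrow> (if u x - W x > 0 then 1 else 0) *\<^sub>R (v x - grad W x)"
        by (intro tendsto_scaleR smooth_pos'_tendsto tendsto_const)
      then show "(\<lambda>n. smooth_pos' (1 / real (Suc n)) (u x - W x) *\<^sub>R (v x - grad W x)) \<longlonglongrightarrow> (if u x > W x then v x - grad W x else 0)"
        by (cases "u x > W x") (auto simp del: of_nat_Suc)
    qed
    show "AE x in L. norm (smooth_pos (1 / real (Suc n)) (u x - W x)) \<le> norm (u x)" for n
    proof (intro AE_I2)
      fix x
      show "norm (smooth_pos (1 / real (Suc n)) (u x - W x)) \<le> norm (u x)"
        using smooth_pos_bounds[of "1 / real (Suc n)" "u x - W x"] d[of n] W(2)[of x]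
        by (simp add: max_def split: if_splits del: of_nat_Suc)
    qed
    show "AE x in L. norm (smooth_pos' (1 / real (Suc n)) (u x - W x) *\<^sub>R (v x - grad W x)) \<le> norm (norm (v x - grad W x))" for n
    proof (intro AE_I2)
      fix x
      show "norm (smooth_pos' (1 / real (Suc n)) (u x - W x) *\<^sub>R (v x - grad W x)) \<le> norm (norm (v x - grad W x))"
        using smooth_pos'_bounds[of "1 / real (Suc n)" "u x - W x"] d[of n]
        by (simp add: mult_left_le_one_le del: of_nat_Suc)
    qed
  qed measurable
qed

end

lemma linear_le_powr:
  fixes p \<eta> H :: real
  assumes "p > 1" "\<eta> > 0" "H \<ge> 0"
  obtains C where "C \<ge> 0" "\<And>y. y \<ge> 0 \<Longrightarrow> H * y \<le> \<eta> * y powr p + C"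
proof -
  \<comment> \<open>The threshold where \<eta> T^(p-1) = H: beyond it the power dominates the linear
    term, below it H y is at most H T.\<close>
  define T where "T = (H / \<eta>) powr (1 / (p - 1))"
  have T: "T \<ge> 0" "T powr (p - 1) = H / \<eta>" unfolding T_def using assms by (auto simp: powr_powr)
  show ?thesis
  proof (rule that[of "H * T"])
    show "H * T \<ge> 0" using assms T by simp
    fix y :: real assume y: "y \<ge> 0"
    show "H * y \<le> \<eta> * y powr p + H * T"
    proof (cases "y \<le> T")
      case True
      then have "H * y \<le> H * T" using assms by (intro mult_left_mono) auto
      moreover have "\<eta> * y powr p \<ge> 0" using assms by simp
      ultimately show ?thesis by linarith
    next
      case False
      then have "T powr (p - 1) \<le> y powr (p - 1)" using T assms by (intro powr_mono2) auto
      then have "H \<le> \<eta> * y powr (p - 1)" unfolding T(2) using assms by (simp add: field_simps)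
      then have "H * y \<le> (\<eta> * y powr (p - 1)) * y" using y by (rule mult_right_mono)
      also have "\<dots> = \<eta> * y powr p" using powr_minus_1_times[OF y, of p] by (simp add: mult.assoc)
      moreover have "H * T \<ge> 0" using assms T by simp
      ultimately show ?thesis by linarith
    qed
  qed
qed

context bounded_open
begin

subsection \<open>The Poincare inequality\<close>

text \<open>The function (x . e) |\<phi>|^p has compact support, so its derivative in direction e
  integrates to 0. That derivative is |\<phi>|^p plus a term with one derivative of \<phi>; since |x
  . e| \<le> R, the assumed weighted Young inequality absorbs half of |\<phi>|^p and leaves the
  gradient.\<close>

lemma Poincare_test:
  assumes C: "\<And>x y. x \<ge> 0 \<Longrightarrow> y \<ge> 0 \<Longrightarrow> p * (x powr (p - 1) * y) \<le> 1 / 2 * x powr p + C * y powr p"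
    and R: "\<Omega> \<subseteq> cball 0 R" "R > 0" and \<phi>: "\<phi> \<in> test_functions \<Omega>"
  shows "(\<integral>x. norm (\<phi> x) powr p \<partial>L) \<le> 2 * C * R powr p * (\<integral>x. norm (grad \<phi> x) powr p \<partial>L)"
proof -
  obtain e :: 'a where e: "e \<in> Basis" using nonempty_Basis by blast
  obtain K where K: "compact K" "K \<subseteq> \<Omega>" "\<And>x. x \<notin> K \<Longrightarrow> \<phi> x = 0" "\<And>x. x \<notin> K \<Longrightarrow> grad \<phi> x = 0"
    by (rule test_functionsE[OF \<phi>]) (rule that)
  define G where "G x = (x \<bullet> e) *\<^sub>R ((p * pflux p (\<phi> x)) *\<^sub>R grad \<phi> x) + \<bar>\<phi> x\<bar> powr p *\<^sub>R e" for x
  have gd: "GDERIV (\<lambda>x. (x \<bullet> e) * \<bar>\<phi> x\<bar> powr p) x :> G x" for x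
  proof -
    have "GDERIV (\<lambda>x. x \<bullet> e) x :> e" unfolding gderiv_def by (auto intro!: derivative_eq_intros)
    moreover have "GDERIV (\<lambda>x. \<bar>\<phi> x\<bar> powr p) x :> (p * pflux p (\<phi> x)) *\<^sub>R grad \<phi> x"
      by (rule GDERIV_DERIV_compose[OF test_functions_GDERIV[OF \<phi>] DERIV_abs_powr[OF p_gt(2)]])
    ultimately show ?thesis unfolding G_def by (rule GDERIV_mult)
  qed
  have c\<phi>: "continuous_on UNIV \<phi>" "continuous_on UNIV (grad \<phi>)"
    using test_functions_continuous[OF \<phi>] test_functions_grad_continuous[OF \<phi>] by auto
  have cp: "continuous_on UNIV (\<lambda>x. pflux p (\<phi> x))"
    by (rule continuous_on_compose2[of UNIV "pflux p", OF continuous_at_imp_continuous_on c\<phi>(1)]) (auto intro: isCont_pflux p_gt)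
  have ca: "continuous_on UNIV (\<lambda>x. \<bar>\<phi> x\<bar> powr p)"
    using c\<phi>(1) p_gt by (intro continuous_on_powr' continuous_intros) auto
  have cG: "continuous_on UNIV G" unfolding G_def
    by (intro continuous_on_add continuous_on_scaleR continuous_on_mult continuous_on_inner continuous_on_id continuous_on_const cp ca c\<phi>)
  obtain B where B: "B > 0" "\<And>x. x \<in> K \<Longrightarrow> norm (G x) \<le> B"
    using continuous_on_compact_abs_le[OF K(1) continuous_on_subset[OF cG]] by auto
  have GB: "norm (G x) \<le> B" for x
  proof (cases "x \<in> K")
    case False
    then have "G x = 0" unfolding G_def using K(3,4) by simp
    with B show ?thesis by simp
  qed (use B in auto)
  have z: "integrable lborel (\<lambda>x. G x \<bullet> e)" "(\<integral>x. G x \<bullet> e \<partial>lborel) = 0"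
    using integral_GDERIV_eq_0[OF gd GB K(1) _ e] K(3) by auto
  have G0: "G x \<bullet> e = 0" if "x \<notin> \<Omega>" for x
  proof -
    have "x \<notin> K" using that K(2) by blast
    from K(3,4)[OF this] show ?thesis unfolding G_def by simp
  qed
  have Gm: "(\<lambda>x. G x \<bullet> e) \<in> borel_measurable borel"
    using z(1) by (auto dest: borel_measurable_integrable)
  have zL: "integrable L (\<lambda>x. G x \<bullet> e)" "(\<integral>x. G x \<bullet> e \<partial>L) = 0"
    using lebesgue_on_eq_lborel[OF Gm G0 \<Omega>_sets] z by auto
  note i1 = in_Lp_integrable[OF test_in_Lp(1)[OF \<phi>]]
  note i2 = in_Lp_integrable[OF test_in_Lp(2)[OF \<phi>]]
  have "(\<integral>x. 1/2 * norm (\<phi> x) powr p - C * R powr p * norm (grad \<phi> x) powr p \<partial>L) \<le> (\<integral>x. G x \<bullet> e \<partial>L)"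
  proof (rule integral_mono)
    fix x assume "x \<in> space L"
    then have x: "norm x \<le> R" using R by auto
    have "\<bar>(x \<bullet> e) * (p * pflux p (\<phi> x)) * (grad \<phi> x \<bullet> e)\<bar> = p * (\<bar>\<phi> x\<bar> powr (p - 1) * (\<bar>x \<bullet> e\<bar> * \<bar>grad \<phi> x \<bullet> e\<bar>))"
      using norm_pflux[of p "\<phi> x"] p_gt by (simp add: abs_mult)
    also have "\<dots> \<le> p * (\<bar>\<phi> x\<bar> powr (p - 1) * (R * norm (grad \<phi> x)))"
      using p_gt Basis_le_norm[OF e, of x] Basis_le_norm[OF e, of "grad \<phi> x"] x R
      by (intro mult_left_mono mult_mono) auto
    also have "\<dots> \<le> 1/2 * \<bar>\<phi> x\<bar> powr p + C * (R * norm (grad \<phi> x)) powr p"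
      using R by (intro C) auto
    also have "\<dots> = 1/2 * \<bar>\<phi> x\<bar> powr p + C * R powr p * norm (grad \<phi> x) powr p"
      by (simp add: powr_mult)
    finally have "\<bar>(x \<bullet> e) * (p * pflux p (\<phi> x)) * (grad \<phi> x \<bullet> e)\<bar> \<le> 1/2 * \<bar>\<phi> x\<bar> powr p + C * R powr p * norm (grad \<phi> x) powr p" .
    moreover have "G x \<bullet> e = (x \<bullet> e) * (p * pflux p (\<phi> x)) * (grad \<phi> x \<bullet> e) + \<bar>\<phi> x\<bar> powr p"
      unfolding G_def by (simp add: inner_add_left e)
    ultimately show "1/2 * norm (\<phi> x) powr p - C * R powr p * norm (grad \<phi> x) powr p \<le> G x \<bullet> e"
      unfolding real_norm_def by linarith
  qed (use i1 i2 zL in auto)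
  then show ?thesis using i1 i2 zL by simp
qed

lemma Poincare:
  obtains C where "C > 0" "\<And>u v. sob0 u v \<Longrightarrow> (\<integral>x. norm (u x) powr p \<partial>L) \<le> C * (\<integral>x. norm (v x) powr p \<partial>L)"
proof -
  obtain R where R: "R > 0" "\<Omega> \<subseteq> cball 0 R" by (rule bounded_subset_cball0[OF \<Omega>_bounded]) (rule that)
  obtain C where C: "C > 0" "\<And>x y. x \<ge> 0 \<Longrightarrow> y \<ge> 0 \<Longrightarrow> p * (x powr (p - 1) * y) \<le> 1 / 2 * x powr p + C * y powr p"
    by (rule powr_Young_scaled[of p "1/2"]) (use p_gt that in auto)
  show ?thesis
  proof (rule that[of "2 * C * R powr p"])
    show "2 * C * R powr p > 0" using C R by simp
    fix u v assume s: "sob0 u v"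
    obtain \<phi> and U V :: "'a \<Rightarrow> real" where a: "\<And>n. \<phi> n \<in> test_functions \<Omega>" "in_Lp p L U" "in_Lp p L V"
      "AE x in L. (\<lambda>n. \<phi> n x) \<longlonglongrightarrow> u x" "AE x in L. (\<lambda>n. grad (\<phi> n) x) \<longlonglongrightarrow> v x"
      "\<And>n. AE x in L. norm (\<phi> n x) \<le> norm (U x)" "\<And>n. AE x in L. norm (grad (\<phi> n) x) \<le> norm (V x)"
      by (rule sob0_approx[OF s]) (rule that)
    note m = test_in_Lp[OF a(1), THEN in_Lp_measurable] sob0_Lp[OF s, THEN in_Lp_measurable]
    have l1: "(\<lambda>n. \<integral>x. norm (\<phi> n x) powr p \<partial>L) \<longlonglongrightarrow> (\<integral>x. norm (u x) powr p \<partial>L)"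
    proof (rule integral_dominated_convergence[OF _ _ in_Lp_integrable[OF a(2)]])
      show "AE x in L. (\<lambda>n. norm (\<phi> n x) powr p) \<longlonglongrightarrow> norm (u x) powr p"
        using a(4) by eventually_elim (rule tendsto_norm_powr[OF p_gt(1)])
      show "AE x in L. norm (norm (\<phi> n x) powr p) \<le> norm (U x) powr p" for n
        using a(6)[of n] by eventually_elim (use p_gt in \<open>auto intro!: powr_mono2\<close>)
      show "(\<lambda>x. norm (\<phi> n x) powr p) \<in> borel_measurable L" for n using m(1)[of n] by measurable
      show "(\<lambda>x. norm (u x) powr p) \<in> borel_measurable L" using m(3) by measurable
    qed
    have l2: "(\<lambda>n. \<integral>x. norm (grad (\<phi> n) x) powr p \<partial>L) \<longlonglongrightarrow> (\<integral>x. norm (v x) powr p \<partial>L)"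
    proof (rule integral_dominated_convergence[OF _ _ in_Lp_integrable[OF a(3)]])
      show "AE x in L. (\<lambda>n. norm (grad (\<phi> n) x) powr p) \<longlonglongrightarrow> norm (v x) powr p"
        using a(5) by eventually_elim (rule tendsto_norm_powr[OF p_gt(1)])
      show "AE x in L. norm (norm (grad (\<phi> n) x) powr p) \<le> norm (V x) powr p" for n
        using a(7)[of n] by eventually_elim (use p_gt in \<open>auto intro!: powr_mono2\<close>)
      show "(\<lambda>x. norm (grad (\<phi> n) x) powr p) \<in> borel_measurable L" for n using m(2)[of n] by measurable
      show "(\<lambda>x. norm (v x) powr p) \<in> borel_measurable L" using m(4) by measurable
    qed
    show "(\<integral>x. norm (u x) powr p \<partial>L) \<le> 2 * C * R powr p * (\<integral>x. norm (v x) powr p \<partial>L)"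
      by (rule LIMSEQ_le[OF l1 tendsto_mult[OF tendsto_const l2]])
         (use Poincare_test[OF C(2) R(2,1) a(1)] in blast)
  qed
qed

lemma sob0_eq_0:
  assumes s: "sob0 u v" and v: "AE x in L. v x = 0"
  shows "AE x in L. u x = 0"
proof -
  obtain C where C: "C > 0" "\<And>u v. sob0 u v \<Longrightarrow> (\<integral>x. norm (u x) powr p \<partial>L) \<le> C * (\<integral>x. norm (v x) powr p \<partial>L)"
    by (rule Poincare) (rule that)
  have "(\<integral>x. norm (v x) powr p \<partial>L) = 0"
    by (rule integral_eq_zero_AE) (use v in eventually_elim, simp)
  with C(2)[OF s] have "(\<integral>x. norm (u x) powr p \<partial>L) \<le> 0" by simp
  moreover have "(\<integral>x. norm (u x) powr p \<partial>L) \<ge> 0" by simp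
  ultimately have "(\<integral>x. norm (u x) powr p \<partial>L) = 0" by linarith
  then have "AE x in L. norm (u x) powr p = 0"
    by (subst (asm) integral_nonneg_eq_0_iff_AE[OF in_Lp_integrable[OF sob0_Lp(1)[OF s]]]) auto
  then show ?thesis by eventually_elim simp
qed

end

subsection \<open>The equation with bounded right-hand side\<close>

locale dirichlet = bounded_open \<Omega> p for \<Omega> :: "'a::euclidean_space set" and p +
  fixes f g :: "'a \<Rightarrow> real" and M :: real
  assumes f_int: "integrable (lebesgue_on \<Omega>) f" and g_int: "integrable (lebesgue_on \<Omega>) g"
    and g_nonneg: "AE x in lebesgue_on \<Omega>. 0 \<le> g x" and M_pos: "M > 0"
    and f_le: "AE x in lebesgue_on \<Omega>. \<bar>f x\<bar> \<le> M * g x"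
begin

lemma fg_measurable [measurable]: "f \<in> borel_measurable L" "g \<in> borel_measurable L"
  using f_int g_int by auto

text \<open>The domain where the energy functional is finite. With g only integrable, the weighted
  square condition does not follow from membership in the Sobolev space; the term with f needs no
  condition of its own, since |f| \<le> M g.\<close>

definition energy :: "('a \<Rightarrow> real) \<Rightarrow> ('a \<Rightarrow> 'a) \<Rightarrow> bool" where
  "energy u v \<longleftrightarrow> sob0 u v \<and> integrable L (\<lambda>x. g x * (u x)\<^sup>2)"

text \<open>Gradients are passed as the separate arguments v and w, so the choice operator stays out
  of the analysis until the last step.\<close>

definition eqn :: "('a \<Rightarrow> real) \<Rightarrow> ('a \<Rightarrow> real) \<Rightarrow> ('a \<Rightarrow> 'a) \<Rightarrow> ('a \<Rightarrow> real) \<Rightarrow> ('a \<Rightarrow> 'a) \<Rightarrow> bool" where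
  "eqn h u v \<phi> w \<longleftrightarrow> (\<integral>x. pflux p (v x) \<bullet> w x \<partial>L) + (\<integral>x. g x * u x * \<phi> x \<partial>L) =
     (\<integral>x. h x * \<phi> x \<partial>L) + (\<integral>x. f x * \<phi> x \<partial>L)"

lemma energy_sob0: "energy u v \<Longrightarrow> sob0 u v"
  by (simp add: energy_def)

lemma energy_measurable: "energy u v \<Longrightarrow> u \<in> borel_measurable L" "energy u v \<Longrightarrow> v \<in> borel_measurable L"
  by (auto simp: energy_def intro: in_Lp_measurable sob0_Lp)

lemma energy_square: "energy u v \<Longrightarrow> integrable L (\<lambda>x. g x * (u x)\<^sup>2)"
  by (simp add: energy_def)

lemma energy_mult_integrable:
  assumes "energy u v" "energy \<phi> w"
  shows "integrable L (\<lambda>x. g x * u x * \<phi> x)"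
proof (rule Bochner_Integration.integrable_bound)
  have [measurable]: "u \<in> borel_measurable L" "\<phi> \<in> borel_measurable L" using assms energy_measurable by auto
  show "integrable L (\<lambda>x. g x * (u x)\<^sup>2 + g x * (\<phi> x)\<^sup>2)" using assms by (auto simp: energy_def)
  show "(\<lambda>x. g x * u x * \<phi> x) \<in> borel_measurable L" by measurable
  show "AE x in L. norm (g x * u x * \<phi> x) \<le> norm (g x * (u x)\<^sup>2 + g x * (\<phi> x)\<^sup>2)"
    using g_nonneg
  proof eventually_elim
    case (elim x)
    have "\<bar>u x * \<phi> x\<bar> \<le> (u x)\<^sup>2 + (\<phi> x)\<^sup>2"
      using sum_squares_bound[of "\<bar>u x\<bar>" "\<bar>\<phi> x\<bar>"] zero_le_power2[of "u x"] zero_le_power2[of "\<phi> x"]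
      unfolding abs_mult power2_abs by linarith
    then have "g x * \<bar>u x * \<phi> x\<bar> \<le> g x * ((u x)\<^sup>2 + (\<phi> x)\<^sup>2)" using elim by (rule mult_left_mono)
    then show ?case using elim by (simp add: abs_mult distrib_left)
  qed
qed

text \<open>The hypothesis on f makes the linear term subordinate to the quadratic one, through |t|
  \<le> 1 + t^2.\<close>

lemma f_mult_bound: "AE x in L. \<bar>f x * t x\<bar> \<le> M * (g x + g x * (t x)\<^sup>2)"
  using g_nonneg f_le
proof eventually_elim
  case (elim x)
  have "\<bar>t x\<bar> \<le> 1 + (t x)\<^sup>2"
    using sum_squares_bound[of "\<bar>t x\<bar>" 1] zero_le_power2[of "t x"] unfolding power2_abs one_power2 by linarith
  then have "\<bar>f x\<bar> * \<bar>t x\<bar> \<le> (M * g x) * (1 + (t x)\<^sup>2)" using elim by (intro mult_mono) auto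
  then show ?case by (simp add: abs_mult algebra_simps)
qed

lemma energy_f_integrable:
  assumes "energy \<phi> w"
  shows "integrable L (\<lambda>x. f x * \<phi> x)"
proof (rule Bochner_Integration.integrable_bound)
  have [measurable]: "\<phi> \<in> borel_measurable L" using assms energy_measurable by auto
  show "integrable L (\<lambda>x. M * (g x + g x * (\<phi> x)\<^sup>2))" using assms g_int by (auto simp: energy_def)
  show "(\<lambda>x. f x * \<phi> x) \<in> borel_measurable L" by measurable
  show "AE x in L. norm (f x * \<phi> x) \<le> norm (M * (g x + g x * (\<phi> x)\<^sup>2))"
    using f_mult_bound[of \<phi>] by eventually_elim simp
qed

lemma energy_lincomb:
  assumes "energy u v" "energy \<phi> w"
  shows "energy (\<lambda>x. a * u x + b * \<phi> x) (\<lambda>x. a *\<^sub>R v x + b *\<^sub>R w x)"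
  unfolding energy_def
proof
  show "sob0 (\<lambda>x. a * u x + b * \<phi> x) (\<lambda>x. a *\<^sub>R v x + b *\<^sub>R w x)" using assms energy_sob0 sob0_lincomb by auto
  have "integrable L (\<lambda>x. a\<^sup>2 * (g x * (u x)\<^sup>2) + 2 * a * b * (g x * u x * \<phi> x) + b\<^sup>2 * (g x * (\<phi> x)\<^sup>2))"
    using assms energy_mult_integrable[OF assms] by (auto simp: energy_def)
  also have "(\<lambda>x. a\<^sup>2 * (g x * (u x)\<^sup>2) + 2 * a * b * (g x * u x * \<phi> x) + b\<^sup>2 * (g x * (\<phi> x)\<^sup>2)) = (\<lambda>x. g x * (a * u x + b * \<phi> x)\<^sup>2)"
    by (simp add: fun_eq_iff power2_eq_square algebra_simps)
  finally show "integrable L (\<lambda>x. g x * (a * u x + b * \<phi> x)\<^sup>2)" .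
qed

lemma energy_diff: "energy u v \<Longrightarrow> energy \<phi> w \<Longrightarrow> energy (\<lambda>x. u x - \<phi> x) (\<lambda>x. v x - w x)"
  using energy_lincomb[of u v \<phi> w 1 "-1"] by simp

lemma energy_minus: "energy u v \<Longrightarrow> energy (\<lambda>x. - u x) (\<lambda>x. - v x)"
  using energy_lincomb[of u v u v "-1" 0] by simp

lemma energy_bound:
  assumes "sob0 u v" "energy \<phi> w" "AE x in L. \<bar>u x\<bar> \<le> \<bar>\<phi> x\<bar>"
  shows "energy u v"
  unfolding energy_def
proof
  have [measurable]: "u \<in> borel_measurable L" using sob0_Lp(1)[OF assms(1)] by (rule in_Lp_measurable)
  show "integrable L (\<lambda>x. g x * (u x)\<^sup>2)"
  proof (rule Bochner_Integration.integrable_bound)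
    show "integrable L (\<lambda>x. g x * (\<phi> x)\<^sup>2)" using assms(2) by (rule energy_square)
    show "AE x in L. norm (g x * (u x)\<^sup>2) \<le> norm (g x * (\<phi> x)\<^sup>2)"
      using assms(3) g_nonneg
    proof eventually_elim
      case (elim x)
      have "(u x)\<^sup>2 \<le> (\<phi> x)\<^sup>2" using elim(1) by (simp add: abs_le_square_iff)
      then have "g x * (u x)\<^sup>2 \<le> g x * (\<phi> x)\<^sup>2" using elim(2) by (rule mult_left_mono)
      then show ?case using elim(2) by simp
    qed
  qed measurable
qed fact

text \<open>W \<ge> 0 makes the truncation no larger than |u|, so the weighted square integral stays
  finite.\<close>

lemma energy_pos_part:
  assumes "energy u v" "\<And>k. Ck k W" "\<And>x. W x \<ge> 0"
  shows "energy (\<lambda>x. max 0 (u x - W x)) (\<lambda>x. if u x > W x then v x - grad W x else 0)"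
proof (rule energy_bound[OF sob0_pos_part assms(1)])
  show "AE x in L. \<bar>max 0 (u x - W x)\<bar> \<le> \<bar>u x\<bar>"
  proof (intro AE_I2)
    fix x
    show "\<bar>max 0 (u x - W x)\<bar> \<le> \<bar>u x\<bar>" using assms(3)[of x] by linarith
  qed
qed (use assms energy_sob0 in auto)

lemma energy_pos: "energy u v \<Longrightarrow> energy (\<lambda>x. max 0 (u x)) (\<lambda>x. if u x > 0 then v x else 0)"
proof -
  assume e: "energy u v"
  have "grad (\<lambda>x. 0) x = 0" for x :: 'a by (rule GDERIV_imp_grad[OF GDERIV_const])
  with energy_pos_part[OF e Ck_const[of _ 0]] show ?thesis by (simp cong: if_cong)
qed

end

section \<open>Completeness and the direct method for a given bounded source\<close>

context bounded_open
begin

text \<open>Only the gradients are assumed to be Cauchy; the Poincare inequality transfers this to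
  the functions. That is the information which uniform convexity and monotonicity of the gradient
  term provide.\<close>

lemma sob0_complete:
  fixes u :: "nat \<Rightarrow> 'a \<Rightarrow> real" and v :: "nat \<Rightarrow> 'a \<Rightarrow> 'a"
  assumes s: "\<And>n. sob0 (u n) (v n)"
    and C: "\<And>\<epsilon>. \<epsilon> > 0 \<Longrightarrow> \<exists>N. \<forall>m\<ge>N. \<forall>n\<ge>N. (\<integral>x. norm (v m x - v n x) powr p \<partial>L) \<le> \<epsilon>"
  obtains r u0 v0 and U V :: "'a \<Rightarrow> real" where "strict_mono r" "sob0 u0 v0" "in_Lp p L U" "in_Lp p L V"
    "AE x in L. (\<lambda>n. u (r n) x) \<longlonglongrightarrow> u0 x" "AE x in L. (\<lambda>n. v (r n) x) \<longlonglongrightarrow> v0 x"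
    "\<And>n. AE x in L. norm (u (r n) x) \<le> norm (U x)" "\<And>n. AE x in L. norm (v (r n) x) \<le> norm (V x)"
proof -
  obtain r v0 and V :: "'a \<Rightarrow> real" where r: "strict_mono r" "in_Lp p L V" "v0 \<in> borel_measurable L"
    "AE x in L. (\<lambda>n. v (r n) x) \<longlonglongrightarrow> v0 x" "\<And>n. AE x in L. norm (v (r n) x) \<le> norm (V x)"
    by (rule Riesz_Fischer[where F=v, OF p_gt(1) sob0_Lp(2)[OF s] C], assumption) (rule that)
  obtain K where K: "K > 0" "\<And>u v. sob0 u v \<Longrightarrow> (\<integral>x. norm (u x) powr p \<partial>L) \<le> K * (\<integral>x. norm (v x) powr p \<partial>L)"
    by (rule Poincare) (rule that)
  have "\<exists>N. \<forall>m\<ge>N. \<forall>n\<ge>N. (\<integral>x. norm (u (r m) x - u (r n) x) powr p \<partial>L) \<le> \<epsilon>" if "\<epsilon> > 0" for \<epsilon>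
  proof -
    have "\<epsilon> / K > 0" using that K by simp
    from C[OF this] obtain N where N: "\<forall>m\<ge>N. \<forall>n\<ge>N. (\<integral>x. norm (v m x - v n x) powr p \<partial>L) \<le> \<epsilon> / K" by blast
    show ?thesis
    proof (intro exI allI impI)
      fix m n assume "N \<le> m" "N \<le> n"
      then have "N \<le> r m" "N \<le> r n" using seq_suble[OF r(1)] order_trans by blast+
      with N have "(\<integral>x. norm (v (r m) x - v (r n) x) powr p \<partial>L) \<le> \<epsilon> / K" by blast
      then have "K * (\<integral>x. norm (v (r m) x - v (r n) x) powr p \<partial>L) \<le> \<epsilon>" using K by (simp add: field_simps)
      with K(2)[OF sob0_diff[OF s s], of "r m" "r n"]
      show "(\<integral>x. norm (u (r m) x - u (r n) x) powr p \<partial>L) \<le> \<epsilon>" by linarith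
    qed
  qed
  note C' = this
  obtain q u0 and U :: "'a \<Rightarrow> real" where q: "strict_mono q" "in_Lp p L U" "u0 \<in> borel_measurable L"
    "AE x in L. (\<lambda>n. u (r (q n)) x) \<longlonglongrightarrow> u0 x" "\<And>n. AE x in L. norm (u (r (q n)) x) \<le> norm (U x)"
    by (rule Riesz_Fischer[where F="\<lambda>n. u (r n)", OF p_gt(1) sob0_Lp(1)[OF s] C'], assumption) (rule that)
  have v: "AE x in L. (\<lambda>n. v (r (q n)) x) \<longlonglongrightarrow> v0 x"
    using r(4) by eventually_elim (drule LIMSEQ_subseq_LIMSEQ[OF _ q(1)], simp add: o_def)
  have rq: "strict_mono (\<lambda>n. r (q n))" using r(1) q(1) by (simp add: strict_mono_def)
  have "sob0 u0 v0" by (rule sob0_limit[OF s q(2) r(2) q(3) r(3) q(4) v q(5) r(5)])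
  from rq this q(2) r(2) q(4) v q(5) r(5) show ?thesis by (rule that)
qed

lemma zero_test_function: "(\<lambda>x. 0) \<in> test_functions \<Omega>"
  by (rule test_functionsI[of _ "{}"]) (auto intro: Ck_const)

lemma in_Lp_mult_bounded_integrable:
  fixes u h :: "'a \<Rightarrow> real"
  assumes "in_Lp p L u" and [measurable]: "h \<in> borel_measurable L" and "\<And>x. x \<in> \<Omega> \<Longrightarrow> \<bar>h x\<bar> \<le> H"
  shows "integrable L (\<lambda>x. h x * u x)"
proof (rule Bochner_Integration.integrable_bound)
  have [measurable]: "u \<in> borel_measurable L" using assms(1) by (rule in_Lp_measurable)
  show "integrable L (\<lambda>x. H * u x)" using in_Lp_imp_integrable[OF assms(1)] by simp
  show "(\<lambda>x. h x * u x) \<in> borel_measurable L" by measurable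
  show "AE x in L. norm (h x * u x) \<le> norm (H * u x)"
    by (intro AE_I2) (use assms(3) in \<open>auto simp: abs_mult intro!: mult_right_mono intro: order_trans[OF _ abs_ge_self]\<close>)
qed

end

lemma Cauchy_from_null_bound:
  fixes d :: "nat \<Rightarrow> nat \<Rightarrow> real"
  assumes "\<And>m n. d m n \<le> c * (a m + a n)" "a \<longlonglongrightarrow> 0" "c > 0" "\<epsilon> > 0"
  shows "\<exists>N. \<forall>m\<ge>N. \<forall>n\<ge>N. d m n \<le> \<epsilon>"
proof -
  have "\<epsilon> / (2 * c) > 0" using assms by simp
  then obtain N where N: "\<And>n. n \<ge> N \<Longrightarrow> a n < \<epsilon> / (2 * c)"
    using order_tendstoD(2)[OF assms(2)] by (auto simp: eventually_sequentially)
  show ?thesis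
  proof (intro exI allI impI)
    fix m n assume "N \<le> m" "N \<le> n"
    from N[OF this(1)] N[OF this(2)] have "c * (a m + a n) \<le> c * (\<epsilon> / (2 * c) + \<epsilon> / (2 * c))"
      using assms(3) by (intro mult_left_mono) auto
    also have "\<dots> = \<epsilon>" using assms(3) by (simp add: field_simps)
    finally show "d m n \<le> \<epsilon>" using assms(1)[of m n] by linarith
  qed
qed

text \<open>Both parts expand a square, g (|u| - 2M)^2 for the first and g (|u| - M)^2 for the
  second. Adding M^2 g / 2 makes the zero-order integrand nonnegative, as Fatou's lemma requires,
  and g u^2 can be recovered from it up to an integrable function.\<close>

lemma Young_g_bound:
  fixes g f u M :: real
  assumes "0 \<le> g" "\<bar>f\<bar> \<le> M * g"
  shows "g * u\<^sup>2 \<le> 4 * (g * u\<^sup>2 / 2 - f * u + M\<^sup>2 * g / 2) + 2 * M\<^sup>2 * g"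
    and "0 \<le> g * u\<^sup>2 / 2 - f * u + M\<^sup>2 * g / 2"
proof -
  have "f * u \<le> \<bar>f\<bar> * \<bar>u\<bar>" by (metis abs_ge_self abs_mult)
  also have "\<dots> \<le> M * g * \<bar>u\<bar>" using assms(2) by (rule mult_right_mono) simp
  finally have fu: "f * u \<le> M * g * \<bar>u\<bar>" .
  have "0 \<le> g * (\<bar>u\<bar> - M)\<^sup>2" "0 \<le> g * (\<bar>u\<bar> - 2 * M)\<^sup>2" using assms(1) by simp_all
  then have 1: "0 \<le> g * u\<^sup>2 - 2 * (M * g * \<bar>u\<bar>) + M\<^sup>2 * g" "0 \<le> g * u\<^sup>2 - 4 * (M * g * \<bar>u\<bar>) + 4 * (M\<^sup>2 * g)"
    by (simp_all add: power2_diff algebra_simps power2_eq_square)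
  show "g * u\<^sup>2 \<le> 4 * (g * u\<^sup>2 / 2 - f * u + M\<^sup>2 * g / 2) + 2 * M\<^sup>2 * g" using fu 1(2) by (simp add: algebra_simps)
  show "0 \<le> g * u\<^sup>2 / 2 - f * u + M\<^sup>2 * g / 2" using fu 1(1) by (simp add: algebra_simps)
qed

context dirichlet
begin

text \<open>Gradients of a minimising sequence converge strongly, whereas the g-term is only lower
  semicontinuous, by Fatou; this suffices for the limit to be a minimiser. A bounded h makes its
  term continuous along the sequence.\<close>

lemma bounded_solution:
  assumes hm [measurable]: "h \<in> borel_measurable L" and hb: "\<And>x. x \<in> \<Omega> \<Longrightarrow> \<bar>h x\<bar> \<le> H"
  obtains u v where "energy u v" "\<And>\<phi> w. energy \<phi> w \<Longrightarrow> eqn h u v \<phi> w"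
proof -
  define J where "J u v = (\<integral>x. norm (v x) powr p \<partial>L) / p + (\<integral>x. g x * (u x)\<^sup>2 \<partial>L) / 2
    - (\<integral>x. f x * u x \<partial>L) - (\<integral>x. h x * u x \<partial>L)" for u :: "'a \<Rightarrow> real" and v :: "'a \<Rightarrow> 'a"
  have vi: "integrable L (\<lambda>x. norm (v x) powr p)" if "energy u v" for u v
    using that by (intro in_Lp_integrable sob0_Lp(2)) (rule energy_sob0)
  have hi: "integrable L (\<lambda>x. h x * u x)" if "energy u v" for u v
    using that hb by (intro in_Lp_mult_bounded_integrable sob0_Lp(1)[OF energy_sob0]) auto
  obtain K where K: "K > 0" "\<And>u v. sob0 u v \<Longrightarrow> (\<integral>x. norm (u x) powr p \<partial>L) \<le> K * (\<integral>x. norm (v x) powr p \<partial>L)"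
    by (rule Poincare) (rule that)
  \<comment> \<open>The coefficient 1 / (p K) is chosen so that, after Poincare, the h-term costs
    exactly the gradient term of \<open>J\<close>. Boundedness from below is the whole purpose: the
    bounds on the sequence come from its Cauchy property.\<close>
  obtain C where C: "C \<ge> 0" "\<And>y. y \<ge> 0 \<Longrightarrow> \<bar>H\<bar> * y \<le> 1 / (p * K) * y powr p + C"
    by (rule linear_le_powr[of p "1 / (p * K)" "\<bar>H\<bar>"]) (use K p_gt that in auto)
  have lb: "- (M\<^sup>2 * (\<integral>x. g x \<partial>L) / 2) - C * measure L \<Omega> \<le> J u v" if e: "energy u v" for u v
  proof -
    have "(\<integral>x. h x * u x \<partial>L) \<le> (\<integral>x. 1 / (p * K) * norm (u x) powr p + C \<partial>L)"
    proof (rule integral_mono[OF hi[OF e]])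
      show "integrable L (\<lambda>x. 1 / (p * K) * norm (u x) powr p + C)"
        using in_Lp_integrable[OF sob0_Lp(1)[OF energy_sob0[OF e]]] by simp
      fix x assume "x \<in> space L"
      then have "\<bar>h x * u x\<bar> \<le> \<bar>H\<bar> * \<bar>u x\<bar>" using hb[of x] unfolding abs_mult by (intro mult_right_mono) auto
      also have "\<dots> \<le> 1 / (p * K) * \<bar>u x\<bar> powr p + C" by (rule C) simp
      finally show "h x * u x \<le> 1 / (p * K) * norm (u x) powr p + C" by simp
    qed
    also have "\<dots> = 1 / (p * K) * (\<integral>x. norm (u x) powr p \<partial>L) + C * measure L \<Omega>"
      using in_Lp_integrable[OF sob0_Lp(1)[OF energy_sob0[OF e]]] by simp
    also have "1 / (p * K) * (\<integral>x. norm (u x) powr p \<partial>L) \<le> 1 / (p * K) * (K * (\<integral>x. norm (v x) powr p \<partial>L))"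
      using K(1) p_gt by (intro mult_left_mono K(2) energy_sob0[OF e]) auto
    also have "\<dots> = (\<integral>x. norm (v x) powr p \<partial>L) / p" using K(1) by simp
    finally have h: "(\<integral>x. h x * u x \<partial>L) \<le> (\<integral>x. norm (v x) powr p \<partial>L) / p + C * measure L \<Omega>" by simp
    have "AE x in L. 0 \<le> g x * (u x)\<^sup>2 / 2 - f x * u x + M\<^sup>2 * g x / 2"
      using g_nonneg f_le by eventually_elim (rule Young_g_bound(2))
    then have "0 \<le> (\<integral>x. g x * (u x)\<^sup>2 / 2 - f x * u x + M\<^sup>2 * g x / 2 \<partial>L)"
      by (rule integral_nonneg_AE)
    also have "\<dots> = (\<integral>x. g x * (u x)\<^sup>2 \<partial>L) / 2 - (\<integral>x. f x * u x \<partial>L) + M\<^sup>2 * (\<integral>x. g x \<partial>L) / 2"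
      using energy_square[OF e] energy_f_integrable[OF e] g_int by simp
    finally show ?thesis using h unfolding J_def by linarith
  qed
  define S where "S = {J u v | u v. energy u v}"
  have bdd: "bdd_below S" unfolding S_def by (rule bdd_belowI) (use lb in blast)
  have "energy (\<lambda>x. 0) (grad (\<lambda>x. 0))" unfolding energy_def using sob0_test[OF zero_test_function] by simp
  then have ne: "S \<noteq> {}" unfolding S_def by blast
  define m where "m = Inf S"
  have mle: "m \<le> J u v" if "energy u v" for u v
    unfolding m_def by (rule cInf_lower[OF _ bdd]) (use that in \<open>auto simp: S_def\<close>)
  have "\<exists>uv. energy (fst uv) (snd uv) \<and> J (fst uv) (snd uv) < m + 1 / real (Suc n)" for n
  proof -
    have "Inf S < m + 1 / real (Suc n)" unfolding m_def by simp
    from cInf_lessD[OF ne this] obtain u v where "energy u v" "J u v < m + 1 / real (Suc n)" unfolding S_def by blast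
    then show ?thesis by (intro exI[of _ "(u, v)"]) simp
  qed
  then have "\<forall>n. \<exists>uv. energy (fst uv) (snd uv) \<and> J (fst uv) (snd uv) < m + 1 / real (Suc n)" by blast
  then have "\<exists>UV. \<forall>n. energy (fst (UV n)) (snd (UV n)) \<and> J (fst (UV n)) (snd (UV n)) < m + 1 / real (Suc n)"
    by (rule choice)
  then obtain UV where UV: "\<forall>n. energy (fst (UV n)) (snd (UV n)) \<and> J (fst (UV n)) (snd (UV n)) < m + 1 / real (Suc n)" ..
  define u where "u n = fst (UV n)" for n
  define v where "v n = snd (UV n)" for n
  have e: "energy (u n) (v n)" and Jn: "J (u n) (v n) < m + 1 / real (Suc n)" for n
    using UV unfolding u_def v_def by blast+
  have inv: "(\<lambda>n. 1 / real (Suc n)) \<longlonglongrightarrow> 0" by (rule LIMSEQ_Suc[OF lim_1_over_n])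
  \<comment> \<open>The midpoint has energy at least m while the two members exceed m by less than
    1/(i+1) and 1/(j+1). Clarkson's gain at the midpoint is therefore at most half the sum of these
    excesses, and solving for the integral gives the constant.\<close>
  have d: "(\<integral>x. norm (v i x - v j x) powr p \<partial>L) \<le> (2 powr p * p / 2) * (1 / real (Suc i) + 1 / real (Suc j))" for i j
  proof -
    let ?u = "\<lambda>x. 1/2 * u i x + 1/2 * u j x" and ?v = "\<lambda>x. (1/2) *\<^sub>R v i x + (1/2) *\<^sub>R v j x"
    have em: "energy ?u ?v" by (rule energy_lincomb[OF e e])
    have "(\<integral>x. norm (?v x) powr p + (1/2) powr p * norm (v i x - v j x) powr p \<partial>L) \<le> (\<integral>x. (norm (v i x) powr p + norm (v j x) powr p) / 2 \<partial>L)"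
    proof (rule integral_mono)
      show "integrable L (\<lambda>x. norm (?v x) powr p + (1/2) powr p * norm (v i x - v j x) powr p)"
        using vi[OF em] vi[OF energy_diff[OF e e]] by simp
      show "integrable L (\<lambda>x. (norm (v i x) powr p + norm (v j x) powr p) / 2)" using vi[OF e] by simp
      show "norm (?v x) powr p + (1/2) powr p * norm (v i x - v j x) powr p \<le> (norm (v i x) powr p + norm (v j x) powr p) / 2" for x
      proof -
        have "norm ((1/2) *\<^sub>R (v i x - v j x)) powr p = (1/2) powr p * norm (v i x - v j x) powr p"
          unfolding norm_scaleR powr_mult by simp
        then show ?thesis using Clarkson[OF p2, of "v i x" "v j x"] by (simp only: scaleR_right_distrib)
      qed
    qed
    also have "\<dots> = ((\<integral>x. norm (v i x) powr p \<partial>L) + (\<integral>x. norm (v j x) powr p \<partial>L)) / 2" using vi[OF e] by simp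
    also have "(\<integral>x. norm (?v x) powr p + (1/2) powr p * norm (v i x - v j x) powr p \<partial>L) = (\<integral>x. norm (?v x) powr p \<partial>L) + (1/2) powr p * (\<integral>x. norm (v i x - v j x) powr p \<partial>L)"
      using vi[OF em] vi[OF energy_diff[OF e e]] by simp
    finally have a: "(\<integral>x. norm (?v x) powr p \<partial>L) + (1/2) powr p * (\<integral>x. norm (v i x - v j x) powr p \<partial>L) \<le> ((\<integral>x. norm (v i x) powr p \<partial>L) + (\<integral>x. norm (v j x) powr p \<partial>L)) / 2" .
    have "(\<integral>x. g x * (?u x)\<^sup>2 \<partial>L) \<le> (\<integral>x. (g x * (u i x)\<^sup>2 + g x * (u j x)\<^sup>2) / 2 \<partial>L)"
    proof (rule integral_mono_AE)
      show "integrable L (\<lambda>x. g x * (?u x)\<^sup>2)" by (rule energy_square[OF em])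
      show "integrable L (\<lambda>x. (g x * (u i x)\<^sup>2 + g x * (u j x)\<^sup>2) / 2)" using energy_square[OF e] by simp
      show "AE x in L. g x * (?u x)\<^sup>2 \<le> (g x * (u i x)\<^sup>2 + g x * (u j x)\<^sup>2) / 2"
        using g_nonneg
      proof eventually_elim
        case (elim x)
        have "(?u x)\<^sup>2 \<le> ((u i x)\<^sup>2 + (u j x)\<^sup>2) / 2"
          using zero_le_power2[of "u i x - u j x"] by (simp add: power2_eq_square field_simps)
        then have "g x * (?u x)\<^sup>2 \<le> g x * (((u i x)\<^sup>2 + (u j x)\<^sup>2) / 2)" using elim by (rule mult_left_mono)
        then show ?case by (simp add: distrib_left)
      qed
    qed
    also have "\<dots> = ((\<integral>x. g x * (u i x)\<^sup>2 \<partial>L) + (\<integral>x. g x * (u j x)\<^sup>2 \<partial>L)) / 2" using energy_square[OF e] by simp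
    finally have b: "(\<integral>x. g x * (?u x)\<^sup>2 \<partial>L) \<le> ((\<integral>x. g x * (u i x)\<^sup>2 \<partial>L) + (\<integral>x. g x * (u j x)\<^sup>2 \<partial>L)) / 2" .
    have "(\<integral>x. f x * ?u x \<partial>L) = (\<integral>x. 1/2 * (f x * u i x) + 1/2 * (f x * u j x) \<partial>L)" by (simp add: algebra_simps)
    also have "\<dots> = ((\<integral>x. f x * u i x \<partial>L) + (\<integral>x. f x * u j x \<partial>L)) / 2" using energy_f_integrable[OF e] by simp
    finally have c: "(\<integral>x. f x * ?u x \<partial>L) = ((\<integral>x. f x * u i x \<partial>L) + (\<integral>x. f x * u j x \<partial>L)) / 2" .
    have "(\<integral>x. h x * ?u x \<partial>L) = (\<integral>x. 1/2 * (h x * u i x) + 1/2 * (h x * u j x) \<partial>L)" by (simp add: algebra_simps)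
    also have "\<dots> = ((\<integral>x. h x * u i x \<partial>L) + (\<integral>x. h x * u j x \<partial>L)) / 2" using hi[OF e] by simp
    finally have c': "(\<integral>x. h x * ?u x \<partial>L) = ((\<integral>x. h x * u i x \<partial>L) + (\<integral>x. h x * u j x \<partial>L)) / 2" .
    define D where "D = (\<integral>x. norm (v i x - v j x) powr p \<partial>L)"
    have a': "(\<integral>x. norm (?v x) powr p \<partial>L) / p + (1/2) powr p * D / p \<le> (\<integral>x. norm (v i x) powr p \<partial>L) / p / 2 + (\<integral>x. norm (v j x) powr p \<partial>L) / p / 2"
      using divide_right_mono[OF a, of p] p_gt unfolding D_def by (simp add: add_divide_distrib)
    have "J ?u ?v + (1/2) powr p * D / p \<le> J (u i) (v i) / 2 + J (u j) (v j) / 2"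
      using a' b c c' unfolding J_def by argo
    with mle[OF em] Jn[of i] Jn[of j] have "(1/2) powr p * D / p \<le> (1 / real (Suc i) + 1 / real (Suc j)) / 2"
      by argo
    then have "(1/2) powr p * D \<le> p * ((1 / real (Suc i) + 1 / real (Suc j)) / 2)"
      using p_gt by (simp add: pos_divide_le_eq mult.commute del: of_nat_Suc)
    then have "2 powr p * ((1/2) powr p * D) \<le> 2 powr p * (p * ((1 / real (Suc i) + 1 / real (Suc j)) / 2))"
      by (rule mult_left_mono) simp
    moreover have "2 powr p * ((1/2) powr p * D) = D" by (simp add: powr_divide)
    ultimately show ?thesis unfolding D_def by (simp add: mult.assoc)
  qed
  have cau: "\<exists>N. \<forall>i\<ge>N. \<forall>j\<ge>N. (\<integral>x. norm (v i x - v j x) powr p \<partial>L) \<le> \<epsilon>" if "\<epsilon> > 0" for \<epsilon>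
    by (rule Cauchy_from_null_bound[OF d inv _ that]) (use p_gt in simp)
  obtain r u0 v0 and U V :: "'a \<Rightarrow> real" where r: "strict_mono r" "sob0 u0 v0" "in_Lp p L U" "in_Lp p L V"
    "AE x in L. (\<lambda>n. u (r n) x) \<longlonglongrightarrow> u0 x" "AE x in L. (\<lambda>n. v (r n) x) \<longlonglongrightarrow> v0 x"
    "\<And>n. AE x in L. norm (u (r n) x) \<le> norm (U x)" "\<And>n. AE x in L. norm (v (r n) x) \<le> norm (V x)"
    by (rule sob0_complete[where u=u and v=v, OF energy_sob0[OF e] cau], assumption) (rule that)
  have [measurable]: "u0 \<in> borel_measurable L" "v0 \<in> borel_measurable L" "U \<in> borel_measurable L"
    using sob0_Lp[OF r(2)] r(3) by (auto intro: in_Lp_measurable)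
  have [measurable]: "u n \<in> borel_measurable L" for n using energy_measurable[OF e] by auto
  \<comment> \<open>The integrand of \<open>J\<close> without the h-term, which changes sign but
    converges by domination, and with M^2 g / 2 added to make it nonnegative.\<close>
  define Q where "Q u v x = norm (v x) powr p / p + (g x * (u x)\<^sup>2 / 2 - f x * u x + M\<^sup>2 * g x / 2)"
    for u :: "'a \<Rightarrow> real" and v :: "'a \<Rightarrow> 'a" and x
  have Qi: "integrable L (Q u v)" "(\<integral>x. Q u v x \<partial>L) = J u v + (\<integral>x. h x * u x \<partial>L) + M\<^sup>2 * (\<integral>x. g x \<partial>L) / 2" if "energy u v" for u v
    unfolding Q_def J_def using vi[OF that] energy_square[OF that] energy_f_integrable[OF that] g_int by simp_all
  have hl: "(\<lambda>n. \<integral>x. h x * u (r n) x \<partial>L) \<longlonglongrightarrow> (\<integral>x. h x * u0 x \<partial>L)"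
  proof (rule integral_dominated_convergence)
    show "integrable L (\<lambda>x. \<bar>H\<bar> * norm (U x))" using in_Lp_imp_integrable[OF r(3)] by simp
    show "AE x in L. (\<lambda>n. h x * u (r n) x) \<longlonglongrightarrow> h x * u0 x" using r(5) by eventually_elim (intro tendsto_intros)
    show "AE x in L. norm (h x * u (r n) x) \<le> \<bar>H\<bar> * norm (U x)" for n
    proof -
      have "AE x in L. \<bar>h x\<bar> \<le> \<bar>H\<bar>" using hb by (intro AE_I2) (auto intro: order_trans[OF _ abs_ge_self])
      with r(7)[of n] show ?thesis by eventually_elim (unfold norm_mult, intro mult_mono, auto)
    qed
  qed measurable
  have Cl: "(\<lambda>n. (m + 1 / real (Suc (r n))) + (\<integral>x. h x * u (r n) x \<partial>L) + M\<^sup>2 * (\<integral>x. g x \<partial>L) / 2) \<longlonglongrightarrow> (m + 0) + (\<integral>x. h x * u0 x \<partial>L) + M\<^sup>2 * (\<integral>x. g x \<partial>L) / 2"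
    using LIMSEQ_subseq_LIMSEQ[OF inv r(1)] by (intro tendsto_intros hl) (simp add: o_def)
  have Qpos: "AE x in L. 0 \<le> Q (u (r n)) (v (r n)) x" for n
    using g_nonneg f_le
  proof eventually_elim
    case (elim x)
    have "0 \<le> norm (v (r n) x) powr p / p" using p_gt by simp
    with Young_g_bound(2)[OF elim, of "u (r n) x"] show ?case unfolding Q_def by linarith
  qed
  have Ql: "AE x in L. (\<lambda>n. Q (u (r n)) (v (r n)) x) \<longlonglongrightarrow> Q u0 v0 x"
    using r(5,6)
  proof eventually_elim
    case (elim x)
    then show ?case unfolding Q_def using p_gt
      by (intro tendsto_add tendsto_diff tendsto_divide tendsto_mult tendsto_power tendsto_const tendsto_norm_powr) auto
  qed
  have Qm: "Q u0 v0 \<in> borel_measurable L" unfolding Q_def by measurable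
  have Qle: "(\<integral>x. Q (u (r n)) (v (r n)) x \<partial>L) \<le> (m + 1 / real (Suc (r n))) + (\<integral>x. h x * u (r n) x \<partial>L) + M\<^sup>2 * (\<integral>x. g x \<partial>L) / 2" for n
    unfolding Qi(2)[OF e] using Jn[of "r n"] by simp
  note Q0 = Fatou_integral[where q="\<lambda>n. Q (u (r n)) (v (r n))", OF Qi(1)[OF e] Qpos Ql Qm Cl Qle]
  have e0: "energy u0 v0"
    unfolding energy_def
  proof
    show "integrable L (\<lambda>x. g x * (u0 x)\<^sup>2)"
    proof (rule Bochner_Integration.integrable_bound)
      show "integrable L (\<lambda>x. 4 * Q u0 v0 x + 2 * M\<^sup>2 * g x)" using Q0(1) g_int by simp
      show "AE x in L. norm (g x * (u0 x)\<^sup>2) \<le> norm (4 * Q u0 v0 x + 2 * M\<^sup>2 * g x)"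
        using g_nonneg f_le
      proof eventually_elim
        case (elim x)
        have "norm (v0 x) powr p / p \<ge> 0" using p_gt by simp
        then have "g x * (u0 x)\<^sup>2 \<le> 4 * Q u0 v0 x + 2 * M\<^sup>2 * g x"
          using Young_g_bound(1)[OF elim, of "u0 x"] unfolding Q_def by argo
        moreover have "0 \<le> g x * (u0 x)\<^sup>2" using elim by simp
        ultimately show ?case by simp
      qed
    qed measurable
  qed (rule r(2))
  have J0: "J u0 v0 \<le> m" using Q0(2) Qi(2)[OF e0] by linarith
  have EL: "0 \<le> (\<integral>x. pflux p (v0 x) \<bullet> w x \<partial>L) + (\<integral>x. g x * u0 x * \<phi> x \<partial>L) - (\<integral>x. f x * \<phi> x \<partial>L) - (\<integral>x. h x * \<phi> x \<partial>L)"
    if ew: "energy \<phi> w" for \<phi> w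
  proof -
    note wL = sob0_Lp(2)[OF energy_sob0[OF ew]] and vL = sob0_Lp(2)[OF r(2)]
    have [measurable]: "w \<in> borel_measurable L" using energy_measurable[OF ew] by auto
    \<comment> \<open>An upper bound for the difference quotient of \<open>J\<close> at u0 in
      direction \<phi>. The subgradient inequality is used at the perturbed point, so the flux
      appears there, and continuity of the flux replaces differentiation under the integral as t
      tends to 0. Equality will follow by using -\<phi> as well.\<close>
    define E where "E t = (\<integral>x. pflux p (v0 x + t *\<^sub>R w x) \<bullet> w x \<partial>L) + (\<integral>x. g x * u0 x * \<phi> x \<partial>L)
        + t / 2 * (\<integral>x. g x * (\<phi> x)\<^sup>2 \<partial>L) - (\<integral>x. f x * \<phi> x \<partial>L) - (\<integral>x. h x * \<phi> x \<partial>L)" for t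
    have E0: "0 \<le> E t" if t: "t > 0" for t
    proof -
      let ?u = "\<lambda>x. 1 * u0 x + t * \<phi> x" and ?v = "\<lambda>x. 1 *\<^sub>R v0 x + t *\<^sub>R w x"
      have et: "energy ?u ?v" by (rule energy_lincomb[OF e0 ew])
      note vtL = sob0_Lp(2)[OF energy_sob0[OF et]]
      have pi: "integrable L (\<lambda>x. pflux p (?v x) \<bullet> w x)" by (rule in_Lp_pflux_inner[OF p_gt(2) vtL wL])
      have "(\<integral>x. norm (?v x) powr p + p * (- t * (pflux p (?v x) \<bullet> w x)) \<partial>L) \<le> (\<integral>x. norm (v0 x) powr p \<partial>L)"
      proof (rule integral_mono)
        show "integrable L (\<lambda>x. norm (?v x) powr p + p * (- t * (pflux p (?v x) \<bullet> w x)))"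
          using vi[OF et] pi by simp
        show "norm (?v x) powr p + p * (- t * (pflux p (?v x) \<bullet> w x)) \<le> norm (v0 x) powr p" for x
          using pflux_subgradient[OF p_gt(2), of "?v x" "v0 x"] by (simp add: inner_minus_right)
      qed (rule vi[OF e0])
      also have "(\<integral>x. norm (?v x) powr p + p * (- t * (pflux p (?v x) \<bullet> w x)) \<partial>L) =
          (\<integral>x. norm (?v x) powr p \<partial>L) + p * (- t * (\<integral>x. pflux p (?v x) \<bullet> w x \<partial>L))"
        using vi[OF et] pi by simp
      finally have a: "(\<integral>x. norm (?v x) powr p \<partial>L) - p * t * (\<integral>x. pflux p (?v x) \<bullet> w x \<partial>L) \<le> (\<integral>x. norm (v0 x) powr p \<partial>L)" by simp
      have a': "(\<integral>x. norm (?v x) powr p \<partial>L) / p - t * (\<integral>x. pflux p (?v x) \<bullet> w x \<partial>L) \<le> (\<integral>x. norm (v0 x) powr p \<partial>L) / p"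
        using divide_right_mono[OF a, of p] p_gt by (simp add: diff_divide_distrib)
      have "(\<integral>x. g x * (?u x)\<^sup>2 \<partial>L) = (\<integral>x. g x * (u0 x)\<^sup>2 + 2 * t * (g x * u0 x * \<phi> x) + t\<^sup>2 * (g x * (\<phi> x)\<^sup>2) \<partial>L)"
        by (simp add: power2_eq_square algebra_simps)
      also have "\<dots> = (\<integral>x. g x * (u0 x)\<^sup>2 \<partial>L) + 2 * t * (\<integral>x. g x * u0 x * \<phi> x \<partial>L) + t\<^sup>2 * (\<integral>x. g x * (\<phi> x)\<^sup>2 \<partial>L)"
        using energy_square[OF e0] energy_square[OF ew] energy_mult_integrable[OF e0 ew] by simp
      finally have b: "(\<integral>x. g x * (?u x)\<^sup>2 \<partial>L) = (\<integral>x. g x * (u0 x)\<^sup>2 \<partial>L) + 2 * t * (\<integral>x. g x * u0 x * \<phi> x \<partial>L) + t\<^sup>2 * (\<integral>x. g x * (\<phi> x)\<^sup>2 \<partial>L)" .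
      have c: "(\<integral>x. f x * ?u x \<partial>L) = (\<integral>x. f x * u0 x \<partial>L) + t * (\<integral>x. f x * \<phi> x \<partial>L)"
        using energy_f_integrable[OF e0] energy_f_integrable[OF ew] by (simp add: distrib_left mult.left_commute)
      have c': "(\<integral>x. h x * ?u x \<partial>L) = (\<integral>x. h x * u0 x \<partial>L) + t * (\<integral>x. h x * \<phi> x \<partial>L)"
        using hi[OF e0] hi[OF ew] by (simp add: distrib_left mult.left_commute)
      have "J u0 v0 \<le> J ?u ?v" using J0 mle[OF et] by linarith
      then have "0 \<le> t * (\<integral>x. pflux p (?v x) \<bullet> w x \<partial>L) + (2 * t * (\<integral>x. g x * u0 x * \<phi> x \<partial>L) + t\<^sup>2 * (\<integral>x. g x * (\<phi> x)\<^sup>2 \<partial>L)) / 2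
          - t * (\<integral>x. f x * \<phi> x \<partial>L) - t * (\<integral>x. h x * \<phi> x \<partial>L)"
        using a' unfolding J_def b c c' by argo
      also have "\<dots> = t * E t" unfolding E_def by (simp add: algebra_simps power2_eq_square)
      finally show ?thesis using t by (simp add: zero_le_mult_iff)
    qed
    have "(\<lambda>n. \<integral>x. pflux p (v0 x + (1 / real (Suc n)) *\<^sub>R w x) \<bullet> w x \<partial>L) \<longlonglongrightarrow> (\<integral>x. pflux p (v0 x) \<bullet> w x \<partial>L)"
    proof (rule integral_dominated_convergence)
      show "(\<lambda>x. pflux p (v0 x) \<bullet> w x) \<in> borel_measurable L" unfolding pflux_def by measurable
      show "(\<lambda>x. pflux p (v0 x + (1 / real (Suc n)) *\<^sub>R w x) \<bullet> w x) \<in> borel_measurable L" for n unfolding pflux_def by measurable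
      show "integrable L (\<lambda>x. 2 powr p * (norm (v0 x) powr p + norm (w x) powr p) + norm (w x) powr p)"
        using vi[OF e0] vi[OF ew] by simp
      show "AE x in L. (\<lambda>n. pflux p (v0 x + (1 / real (Suc n)) *\<^sub>R w x) \<bullet> w x) \<longlonglongrightarrow> pflux p (v0 x) \<bullet> w x"
      proof (intro AE_I2)
        fix x
        have "(\<lambda>n. v0 x + (1 / real (Suc n)) *\<^sub>R w x) \<longlonglongrightarrow> v0 x + 0 *\<^sub>R w x" by (intro tendsto_intros inv)
        then have "(\<lambda>n. v0 x + (1 / real (Suc n)) *\<^sub>R w x) \<longlonglongrightarrow> v0 x" by simp
        then show "(\<lambda>n. pflux p (v0 x + (1 / real (Suc n)) *\<^sub>R w x) \<bullet> w x) \<longlonglongrightarrow> pflux p (v0 x) \<bullet> w x"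
          by (intro tendsto_inner tendsto_pflux p_gt tendsto_const)
      qed
      show "AE x in L. norm (pflux p (v0 x + (1 / real (Suc n)) *\<^sub>R w x) \<bullet> w x) \<le> 2 powr p * (norm (v0 x) powr p + norm (w x) powr p) + norm (w x) powr p" for n
      proof (intro AE_I2)
        fix x
        have "norm ((1 / real (Suc n)) *\<^sub>R w x) \<le> 1 * norm (w x)" unfolding norm_scaleR by (intro mult_right_mono) auto
        then have "norm ((1 / real (Suc n)) *\<^sub>R w x) powr p \<le> norm (w x) powr p" using p_gt by (intro powr_mono2) auto
        then have "2 powr p * (norm (v0 x) powr p + norm ((1 / real (Suc n)) *\<^sub>R w x) powr p) \<le> 2 powr p * (norm (v0 x) powr p + norm (w x) powr p)"
          by (intro mult_left_mono add_left_mono) auto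
        with norm_add_powr_le[OF p_gt(3), of "v0 x" "(1 / real (Suc n)) *\<^sub>R w x"]
        have "norm (v0 x + (1 / real (Suc n)) *\<^sub>R w x) powr p \<le> 2 powr p * (norm (v0 x) powr p + norm (w x) powr p)" by linarith
        with abs_pflux_inner_le[OF p_gt(2), of "v0 x + (1 / real (Suc n)) *\<^sub>R w x" "w x"]
        show "norm (pflux p (v0 x + (1 / real (Suc n)) *\<^sub>R w x) \<bullet> w x) \<le> 2 powr p * (norm (v0 x) powr p + norm (w x) powr p) + norm (w x) powr p"
          unfolding real_norm_def by linarith
      qed
    qed
    then have "(\<lambda>n. E (1 / real (Suc n))) \<longlonglongrightarrow> (\<integral>x. pflux p (v0 x) \<bullet> w x \<partial>L) + (\<integral>x. g x * u0 x * \<phi> x \<partial>L)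
        + 0 / 2 * (\<integral>x. g x * (\<phi> x)\<^sup>2 \<partial>L) - (\<integral>x. f x * \<phi> x \<partial>L) - (\<integral>x. h x * \<phi> x \<partial>L)"
      unfolding E_def by (intro tendsto_intros inv) auto
    then have "0 \<le> (\<integral>x. pflux p (v0 x) \<bullet> w x \<partial>L) + (\<integral>x. g x * u0 x * \<phi> x \<partial>L)
        + 0 / 2 * (\<integral>x. g x * (\<phi> x)\<^sup>2 \<partial>L) - (\<integral>x. f x * \<phi> x \<partial>L) - (\<integral>x. h x * \<phi> x \<partial>L)"
      by (rule LIMSEQ_le_const) (use E0 in auto)
    then show ?thesis by simp
  qed
  show ?thesis
  proof (rule that[OF e0])
    fix \<phi> w assume ew: "energy \<phi> w"
    from EL[OF ew] EL[OF energy_minus[OF ew]] show "eqn h u0 v0 \<phi> w"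
      unfolding eqn_def by simp
  qed
qed

end

subsection \<open>Comparison with barriers\<close>

context dirichlet
begin

text \<open>w is the difference of the two fields on some set and 0 elsewhere, so monotonicity makes
  the integrand nonnegative. Its integral is at most 0 by assumption, hence it vanishes, and strict
  monotonicity leaves only w = 0. The comparison arguments end this way.\<close>

lemma pflux_inner_AE_eq_0:
  assumes "in_Lp p L v" "in_Lp p L v'" and wm [measurable]: "w \<in> borel_measurable L"
    and w: "AE x in L. w x = v x - v' x \<or> w x = 0"
    and le: "(\<integral>x. pflux p (v x) \<bullet> w x \<partial>L) \<le> (\<integral>x. pflux p (v' x) \<bullet> w x \<partial>L)"
  shows "AE x in L. w x = 0"
proof -
  have "in_Lp p L (\<lambda>x. v x - v' x)" using assms(1,2) p_gt by (intro in_Lp_diff) auto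
  then have wL: "in_Lp p L w"
    by (rule in_Lp_bound[OF p_gt(3) _ wm]) (use w in eventually_elim, auto)
  have i: "integrable L (\<lambda>x. pflux p (v x) \<bullet> w x)" "integrable L (\<lambda>x. pflux p (v' x) \<bullet> w x)"
    using assms(1,2) wL p_gt by (auto intro: in_Lp_pflux_inner)
  let ?q = "\<lambda>x. pflux p (v x) \<bullet> w x - pflux p (v' x) \<bullet> w x"
  have q0: "AE x in L. 0 \<le> ?q x"
    using w
  proof eventually_elim
    case (elim x)
    then show ?case using pflux_monotone_nonneg[OF p2, of "v x" "v' x"] by (auto simp: inner_diff_left)
  qed
  have "(\<integral>x. ?q x \<partial>L) \<le> 0" using i le by simp
  moreover have "(\<integral>x. ?q x \<partial>L) \<ge> 0" by (rule integral_nonneg_AE[OF q0])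
  ultimately have "(\<integral>x. ?q x \<partial>L) = 0" by linarith
  then have "AE x in L. ?q x = 0"
    using integral_nonneg_eq_0_iff_AE[OF Bochner_Integration.integrable_diff[OF i] q0] by blast
  with w show ?thesis
  proof eventually_elim
    case (elim x)
    then show ?case using pflux_monotone_eq_0[OF p2, of "v x" "v' x"] by (auto simp: inner_diff_left)
  qed
qed

lemma comparison_barrier:
  assumes e: "energy u v" and eq: "\<And>\<phi> w. energy \<phi> w \<Longrightarrow> eqn h u v \<phi> w"
    and W: "\<And>k. Ck k W" "\<And>x. W x \<ge> 0" "\<And>x. x \<in> \<Omega> \<Longrightarrow> M \<le> W x"
    and le: "AE x in L. h x \<le> b x"
    and bd: "h \<in> borel_measurable L" "b \<in> borel_measurable L" "\<And>x. x \<in> \<Omega> \<Longrightarrow> \<bar>h x\<bar> \<le> H" "\<And>x. x \<in> \<Omega> \<Longrightarrow> \<bar>b x\<bar> \<le> H"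
    and super: "\<And>\<phi> w. energy \<phi> w \<Longrightarrow> AE x in L. 0 \<le> \<phi> x \<Longrightarrow> (\<integral>x. b x * \<phi> x \<partial>L) \<le> (\<integral>x. pflux p (grad W x) \<bullet> w x \<partial>L)"
  shows "AE x in L. u x \<le> W x"
proof -
  define \<phi> where "\<phi> x = max 0 (u x - W x)" for x
  define w where "w x = (if u x > W x then v x - grad W x else 0)" for x
  have ew: "energy \<phi> w" unfolding \<phi>_def[abs_def] w_def[abs_def] by (rule energy_pos_part[OF e W(1,2)])
  have \<phi>0: "AE x in L. 0 \<le> \<phi> x" unfolding \<phi>_def by simp
  have \<phi>L: "in_Lp p L \<phi>" by (rule sob0_Lp(1)[OF energy_sob0[OF ew]])
  have "(\<integral>x. h x * \<phi> x \<partial>L) \<le> (\<integral>x. b x * \<phi> x \<partial>L)"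
  proof (rule integral_mono_AE)
    show "integrable L (\<lambda>x. h x * \<phi> x)" "integrable L (\<lambda>x. b x * \<phi> x)"
      using bd \<phi>L by (auto intro: in_Lp_mult_bounded_integrable)
    show "AE x in L. h x * \<phi> x \<le> b x * \<phi> x" using le \<phi>0 by eventually_elim (rule mult_right_mono)
  qed
  also have "\<dots> \<le> (\<integral>x. pflux p (grad W x) \<bullet> w x \<partial>L)" by (rule super[OF ew \<phi>0])
  finally have 1: "(\<integral>x. h x * \<phi> x \<partial>L) \<le> (\<integral>x. pflux p (grad W x) \<bullet> w x \<partial>L)" .
  have 2: "(\<integral>x. f x * \<phi> x \<partial>L) \<le> (\<integral>x. g x * u x * \<phi> x \<partial>L)"
  proof (rule integral_mono_AE[OF energy_f_integrable[OF ew] energy_mult_integrable[OF e ew]])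
    have sp: "AE x in L. x \<in> \<Omega>" by (rule AE_I2) simp
    show "AE x in L. f x * \<phi> x \<le> g x * u x * \<phi> x"
      using g_nonneg f_le sp
    proof eventually_elim
      case (elim x)
      show ?case
      proof (cases "u x > W x")
        case True
        then have "M \<le> u x" using W(3)[OF elim(3)] by simp
        then have "M * g x \<le> u x * g x" using elim(1) by (rule mult_right_mono)
        then have "f x \<le> g x * u x" using elim(2) by (simp add: mult.commute)
        then show ?thesis by (rule mult_right_mono) (simp add: \<phi>_def)
      qed (simp add: \<phi>_def)
    qed
  qed
  have gW: "continuous_on UNIV (grad W)" by (rule Ck_grad_continuous) (rule W)
  have "AE x in L. w x = 0"
  proof (rule pflux_inner_AE_eq_0)
    show "in_Lp p L v" by (rule sob0_Lp(2)[OF energy_sob0[OF e]])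
    show "in_Lp p L (grad W)" by (rule in_Lp_continuous[OF gW])
    show "w \<in> borel_measurable L" using energy_measurable[OF ew] by simp
    show "AE x in L. w x = v x - grad W x \<or> w x = 0" unfolding w_def by simp
    show "(\<integral>x. pflux p (v x) \<bullet> w x \<partial>L) \<le> (\<integral>x. pflux p (grad W x) \<bullet> w x \<partial>L)"
      using eq[OF ew] 1 2 unfolding eqn_def by linarith
  qed
  from sob0_eq_0[OF energy_sob0[OF ew] this] show ?thesis
    by eventually_elim (simp add: \<phi>_def max_def split: if_splits)
qed

lemma comparison_barrier_abs:
  assumes e: "energy u v" and eq: "\<And>\<phi> w. energy \<phi> w \<Longrightarrow> eqn h u v \<phi> w"
    and W: "\<And>k. Ck k W" "\<And>x. W x \<ge> 0" "\<And>x. x \<in> \<Omega> \<Longrightarrow> M \<le> W x"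
    and le: "AE x in L. \<bar>h x\<bar> \<le> b x"
    and bd: "h \<in> borel_measurable L" "b \<in> borel_measurable L" "\<And>x. x \<in> \<Omega> \<Longrightarrow> \<bar>h x\<bar> \<le> H" "\<And>x. x \<in> \<Omega> \<Longrightarrow> \<bar>b x\<bar> \<le> H"
    and super: "\<And>\<phi> w. energy \<phi> w \<Longrightarrow> AE x in L. 0 \<le> \<phi> x \<Longrightarrow> (\<integral>x. b x * \<phi> x \<partial>L) \<le> (\<integral>x. pflux p (grad W x) \<bullet> w x \<partial>L)"
  shows "AE x in L. \<bar>u x\<bar> \<le> W x"
proof -
  have up: "AE x in L. u x \<le> W x"
  proof (rule comparison_barrier[OF e eq W _ bd super])
    show "AE x in L. h x \<le> b x" using le by eventually_elim simp
  qed
  \<comment> \<open>The assumptions are symmetric under f \<mapsto> -f, and -u solves the problem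
    with -f and -h. Since \<open>energy\<close> does not involve f, it is the same predicate in both
    instances.\<close>
  interpret neg: dirichlet \<Omega> p "\<lambda>x. - f x" g M
    by unfold_locales (use f_int g_int g_nonneg M_pos f_le in auto)
  have "AE x in L. - u x \<le> W x"
  proof (rule neg.comparison_barrier[where W=W, OF energy_minus[OF e]])
    show "neg.eqn (\<lambda>x. - h x) (\<lambda>x. - u x) (\<lambda>x. - v x) \<phi> w" if "energy \<phi> w" for \<phi> w
      using eq[OF that] unfolding neg.eqn_def eqn_def by (simp add: pflux_minus)
    show "AE x in L. - h x \<le> b x" using le by eventually_elim simp
    show "(\<lambda>x. - h x) \<in> borel_measurable L" using bd(1) by simp
    show "\<bar>- h x\<bar> \<le> H" if "x \<in> \<Omega>" for x using bd(3)[OF that] by simp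
    show "(\<integral>x. b x * \<phi> x \<partial>L) \<le> (\<integral>x. pflux p (grad W x) \<bullet> w x \<partial>L)"
      if "energy \<phi> w" "AE x in L. 0 \<le> \<phi> x" for \<phi> w by (rule super[OF that])
    show "Ck k W" for k by (rule W(1))
    show "0 \<le> W x" for x by (rule W(2))
    show "M \<le> W x" if "x \<in> \<Omega>" for x by (rule W(3)[OF that])
    show "b \<in> borel_measurable L" by (rule bd(2))
    show "\<bar>b x\<bar> \<le> H" if "x \<in> \<Omega>" for x by (rule bd(4)[OF that])
  qed
  with up show ?thesis by eventually_elim simp
qed

end

subsection \<open>Monotone iteration\<close>

text \<open>
  \<open>W\<close> is a possibly unbounded supersolution for the potential \<open>\<kappa>\<close>; it is the limit of the bounded
  smooth supersolutions \<open>Wn n\<close>, whose right-hand sides \<open>bn n\<close> converge to \<open>\<kappa> W\<^sup>p\<^sup>-\<^sup>1\<close>.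
\<close>

locale supersolution = dirichlet \<Omega> p f g M for \<Omega> :: "'a::euclidean_space set" and p f g M +
  fixes \<kappa> W :: "'a \<Rightarrow> real" and Wn bn :: "nat \<Rightarrow> 'a \<Rightarrow> real"
  assumes \<kappa>_measurable [measurable]: "\<kappa> \<in> borel_measurable (lebesgue_on \<Omega>)"
    and W_measurable [measurable]: "W \<in> borel_measurable (lebesgue_on \<Omega>)"
    and \<kappa>_nonneg: "\<And>x. \<kappa> x \<ge> 0"
    and \<kappa>W_integrable: "integrable (lebesgue_on \<Omega>) (\<lambda>x. \<kappa> x * W x powr p)"
    and Wn_Ck: "\<And>n k. Ck k (Wn n)" and Wn_nonneg: "\<And>n x. Wn n x \<ge> 0"
    and M_le_Wn: "\<And>n x. x \<in> \<Omega> \<Longrightarrow> M \<le> Wn n x"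
    and Wn_le_W: "\<And>n. AE x in lebesgue_on \<Omega>. Wn n x \<le> W x"
    and bn_measurable [measurable]: "\<And>n. bn n \<in> borel_measurable (lebesgue_on \<Omega>)"
    and bn_nonneg: "\<And>n x. bn n x \<ge> 0" and bn_bounded: "\<And>n. \<exists>H. \<forall>x\<in>\<Omega>. bn n x \<le> H"
    and bn_tendsto: "AE x in lebesgue_on \<Omega>. (\<lambda>n. bn n x) \<longlonglongrightarrow> \<kappa> x * W x powr (p - 1)"
    and bn_super: "\<And>n \<phi> w. energy \<phi> w \<Longrightarrow> AE x in lebesgue_on \<Omega>. 0 \<le> \<phi> x \<Longrightarrow>
      (\<integral>x. bn n x * \<phi> x \<partial>lebesgue_on \<Omega>) \<le> (\<integral>x. pflux p (grad (Wn n) x) \<bullet> w x \<partial>lebesgue_on \<Omega>)"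
begin

definition b :: "'a \<Rightarrow> real" where "b x = \<kappa> x * W x powr (p - 1)"

text \<open>Test functions are restricted to |\<phi>| \<le> c W because integrability of b W is what
  controls h \<phi> when |h| \<le> b. The class contains differences of two solutions, with c = 2,
  and bounded functions of finite energy, because W \<ge> M.\<close>

definition sol :: "('a \<Rightarrow> real) \<Rightarrow> ('a \<Rightarrow> real) \<Rightarrow> ('a \<Rightarrow> 'a) \<Rightarrow> bool" where
  "sol h u v \<longleftrightarrow> energy u v \<and> (AE x in L. \<bar>u x\<bar> \<le> W x) \<and>
     (\<forall>\<phi> w c. energy \<phi> w \<longrightarrow> (AE x in L. \<bar>\<phi> x\<bar> \<le> c * W x) \<longrightarrow> eqn h u v \<phi> w)"

lemma b_measurable [measurable]: "b \<in> borel_measurable L"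
  unfolding b_def[abs_def] by measurable

lemma b_nonneg: "b x \<ge> 0"
  unfolding b_def using \<kappa>_nonneg by simp

lemma W_ge_M: "AE x in L. M \<le> W x"
proof -
  have "AE x in L. x \<in> \<Omega>" by (rule AE_I2) simp
  with Wn_le_W[of 0] show ?thesis by eventually_elim (use M_le_Wn in \<open>blast intro: order_trans\<close>)
qed

lemma W_nonneg: "AE x in L. 0 \<le> W x"
  using W_ge_M by eventually_elim (use M_pos in linarith)

lemma bW_integrable: "integrable L (\<lambda>x. b x * W x)"
proof -
  have "integrable L (\<lambda>x. b x * W x) \<longleftrightarrow> integrable L (\<lambda>x. \<kappa> x * W x powr p)"
  proof (rule integrable_cong_AE)
    show "AE x in L. b x * W x = \<kappa> x * W x powr p"
      using W_nonneg by eventually_elim (simp add: b_def powr_minus_1_times mult.assoc)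
  qed measurable
  then show ?thesis using \<kappa>W_integrable by simp
qed

lemma h_mult_integrable:
  assumes [measurable]: "h \<in> borel_measurable L" "\<phi> \<in> borel_measurable L"
    and h: "AE x in L. \<bar>h x\<bar> \<le> c' * b x" and \<phi>: "AE x in L. \<bar>\<phi> x\<bar> \<le> c * W x"
  shows "integrable L (\<lambda>x. h x * \<phi> x)" "AE x in L. \<bar>h x * \<phi> x\<bar> \<le> c' * c * (b x * W x)"
proof -
  show bd: "AE x in L. \<bar>h x * \<phi> x\<bar> \<le> c' * c * (b x * W x)"
    using h \<phi>
  proof eventually_elim
    case (elim x)
    have "\<bar>h x\<bar> * \<bar>\<phi> x\<bar> \<le> (c' * b x) * (c * W x)" using elim by (intro mult_mono) (auto intro: order_trans[OF abs_ge_zero])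
    then show ?case by (simp add: abs_mult mult_ac)
  qed
  show "integrable L (\<lambda>x. h x * \<phi> x)"
  proof (rule Bochner_Integration.integrable_bound)
    show "integrable L (\<lambda>x. c' * c * (b x * W x))" using bW_integrable by simp
    show "AE x in L. norm (h x * \<phi> x) \<le> norm (c' * c * (b x * W x))" using bd by eventually_elim simp
  qed measurable
qed

lemma sol_energy: "sol h u v \<Longrightarrow> energy u v"
  and sol_le_W: "sol h u v \<Longrightarrow> AE x in L. \<bar>u x\<bar> \<le> W x"
  and sol_eqn: "sol h u v \<Longrightarrow> energy \<phi> w \<Longrightarrow> AE x in L. \<bar>\<phi> x\<bar> \<le> c * W x \<Longrightarrow> eqn h u v \<phi> w"
  unfolding sol_def by blast+

section \<open>Comparison and stability of solutions with given source\<close>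

lemma sol_diff_eqn:
  assumes s: "sol h u v" "sol h' u' v'" and [measurable]: "h \<in> borel_measurable L" "h' \<in> borel_measurable L"
    and hb: "AE x in L. \<bar>h x\<bar> \<le> b x" "AE x in L. \<bar>h' x\<bar> \<le> b x"
    and e: "energy \<phi> w" and \<phi>: "AE x in L. \<bar>\<phi> x\<bar> \<le> c * W x"
  shows "(\<integral>x. pflux p (v x) \<bullet> w x \<partial>L) - (\<integral>x. pflux p (v' x) \<bullet> w x \<partial>L) + (\<integral>x. g x * (u x - u' x) * \<phi> x \<partial>L)
    = (\<integral>x. (h x - h' x) * \<phi> x \<partial>L)"
proof -
  have [measurable]: "\<phi> \<in> borel_measurable L" using energy_measurable[OF e] by simp
  have hb1: "AE x in L. \<bar>h x\<bar> \<le> 1 * b x" "AE x in L. \<bar>h' x\<bar> \<le> 1 * b x" using hb by simp_all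
  have i: "integrable L (\<lambda>x. h x * \<phi> x)" "integrable L (\<lambda>x. h' x * \<phi> x)"
    by (rule h_mult_integrable(1)[OF _ _ hb1(1) \<phi>] h_mult_integrable(1)[OF _ _ hb1(2) \<phi>], measurable)+
  have "(\<integral>x. (h x - h' x) * \<phi> x \<partial>L) = (\<integral>x. h x * \<phi> x \<partial>L) - (\<integral>x. h' x * \<phi> x \<partial>L)"
    using i by (simp add: left_diff_distrib)
  moreover have "(\<integral>x. g x * (u x - u' x) * \<phi> x \<partial>L) = (\<integral>x. g x * u x * \<phi> x \<partial>L) - (\<integral>x. g x * u' x * \<phi> x \<partial>L)"
    using energy_mult_integrable[OF sol_energy[OF s(1)] e] energy_mult_integrable[OF sol_energy[OF s(2)] e]
    by (simp add: left_diff_distrib right_diff_distrib)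
  ultimately show ?thesis
    using sol_eqn[OF s(1) e \<phi>] sol_eqn[OF s(2) e \<phi>] unfolding eqn_def by linarith
qed

text \<open>The difference of the equations is tested with the positive part of u - u', which is
  bounded by 2 W. There the source contributes at most 0 and the g-term at least 0, so the flux
  difference has nonpositive integral and strict monotonicity applies.\<close>

lemma sol_mono:
  assumes s: "sol h u v" "sol h' u' v'" and m: "h \<in> borel_measurable L" "h' \<in> borel_measurable L"
    and hb: "AE x in L. \<bar>h x\<bar> \<le> b x" "AE x in L. \<bar>h' x\<bar> \<le> b x" and le: "AE x in L. h x \<le> h' x"
  shows "AE x in L. u x \<le> u' x"
proof -
  define \<phi> where "\<phi> x = max 0 (u x - u' x)" for x
  define w where "w x = (if u x - u' x > 0 then v x - v' x else 0)" for x
  have ew: "energy \<phi> w" unfolding \<phi>_def[abs_def] w_def[abs_def]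
    by (rule energy_pos[OF energy_diff[OF sol_energy[OF s(1)] sol_energy[OF s(2)]]])
  have \<phi>W: "AE x in L. \<bar>\<phi> x\<bar> \<le> 2 * W x"
    using sol_le_W[OF s(1)] sol_le_W[OF s(2)]
  proof eventually_elim
    case (elim x)
    then show ?case unfolding \<phi>_def by linarith
  qed
  have "(\<integral>x. (h x - h' x) * \<phi> x \<partial>L) \<le> 0"
  proof -
    have "AE x in L. 0 \<le> - ((h x - h' x) * \<phi> x)" using le
      by eventually_elim (simp add: \<phi>_def mult_nonpos_nonneg)
    then have "0 \<le> (\<integral>x. - ((h x - h' x) * \<phi> x) \<partial>L)" by (rule integral_nonneg_AE)
    then show ?thesis by simp
  qed
  moreover have "0 \<le> (\<integral>x. g x * (u x - u' x) * \<phi> x \<partial>L)"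
    by (rule integral_nonneg_AE) (use g_nonneg in \<open>eventually_elim, simp add: \<phi>_def max_def mult.assoc\<close>)
  ultimately have "(\<integral>x. pflux p (v x) \<bullet> w x \<partial>L) \<le> (\<integral>x. pflux p (v' x) \<bullet> w x \<partial>L)"
    using sol_diff_eqn[OF s m hb ew \<phi>W] by linarith
  then have "AE x in L. w x = 0"
    by (rule pflux_inner_AE_eq_0[OF sob0_Lp(2)[OF energy_sob0[OF sol_energy[OF s(1)]]]
          sob0_Lp(2)[OF energy_sob0[OF sol_energy[OF s(2)]]] energy_measurable(2)[OF ew], rotated])
       (simp add: w_def)
  from sob0_eq_0[OF energy_sob0[OF ew] this] show ?thesis
    by eventually_elim (simp add: \<phi>_def max_def split: if_splits)
qed

text \<open>Testing the difference of two equations with the difference of the solutions bounds the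
  p-th power norm of the gradient difference and the g-weighted square of the difference by the
  sources, whose contribution tends to 0 by domination with b W. So the gradients converge strongly,
  and so do the products of u with the root of g, in the square-integrable sense; both are used to
  pass to the limit in the equation.\<close>

lemma sol_stable:
  assumes s: "\<And>n. sol (h n) (u n) (v n)" and hm [measurable]: "\<And>n. h n \<in> borel_measurable L"
    and hb: "\<And>n. AE x in L. \<bar>h n x\<bar> \<le> b x" and h0m [measurable]: "h0 \<in> borel_measurable L"
    and hl: "AE x in L. (\<lambda>n. h n x) \<longlonglongrightarrow> h0 x"
  obtains r u0 v0 where "strict_mono r" "sol h0 u0 v0" "AE x in L. (\<lambda>n. u (r n) x) \<longlonglongrightarrow> u0 x"
proof -
  have e: "energy (u n) (v n)" for n using s by (rule sol_energy)
  have uW: "AE x in L. \<bar>u n x\<bar> \<le> W x" for n using s by (rule sol_le_W)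
  have [measurable]: "u n \<in> borel_measurable L" "v n \<in> borel_measurable L" for n using energy_measurable[OF e] by auto
  have "AE x in L. \<forall>n. \<bar>h n x\<bar> \<le> b x" using hb by (simp add: AE_all_countable)
  with hl have h0b: "AE x in L. \<bar>h0 x\<bar> \<le> b x"
    by eventually_elim (rule Lim_bounded[OF tendsto_rabs], auto)
  \<comment> \<open>The distance of the i-th and j-th sources is split through \<open>h0\<close>;
    the factor 2 is the bound 2 W for the difference of two solutions.\<close>
  define E where "E n = (\<integral>x. 2 * (\<bar>h n x - h0 x\<bar> * W x) \<partial>L)" for n
  have hdb: "AE x in L. norm (2 * (\<bar>h n x - h0 x\<bar> * W x)) \<le> 4 * (b x * W x)" for n
    using hb[of n] h0b W_nonneg
  proof eventually_elim
    case (elim x)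
    have "\<bar>h n x - h0 x\<bar> * W x \<le> (2 * b x) * W x" using elim by (intro mult_right_mono) auto
    then show ?case using elim(3) by (simp add: mult_ac)
  qed
  have bWi: "integrable L (\<lambda>x. 4 * (b x * W x))" using bW_integrable by simp
  have Ei: "integrable L (\<lambda>x. 2 * (\<bar>h n x - h0 x\<bar> * W x))" for n
    by (rule Bochner_Integration.integrable_bound[OF bWi]) (measurable, use hdb[of n] in eventually_elim, simp)
  have E0: "E \<longlonglongrightarrow> 0"
  proof -
    have "(\<lambda>n. \<integral>x. 2 * (\<bar>h n x - h0 x\<bar> * W x) \<partial>L) \<longlonglongrightarrow> (\<integral>x. 0 \<partial>L)"
    proof (rule integral_dominated_convergence[OF _ _ bWi _ hdb])
      show "AE x in L. (\<lambda>n. 2 * (\<bar>h n x - h0 x\<bar> * W x)) \<longlonglongrightarrow> 0"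
        using hl
      proof eventually_elim
        case (elim x)
        then have "(\<lambda>n. 2 * (\<bar>h n x - h0 x\<bar> * W x)) \<longlonglongrightarrow> 2 * (\<bar>h0 x - h0 x\<bar> * W x)" by (intro tendsto_intros)
        then show ?case by simp
      qed
    qed measurable
    then show ?thesis unfolding E_def[abs_def] by simp
  qed
  have key: "(4 / p) * (1/2) powr p * (\<integral>x. norm (v i x - v j x) powr p \<partial>L) + (\<integral>x. g x * (u i x - u j x)\<^sup>2 \<partial>L) \<le> E i + E j" for i j
  proof -
    have ed: "energy (\<lambda>x. u i x - u j x) (\<lambda>x. v i x - v j x)" by (rule energy_diff[OF e e])
    have dW: "AE x in L. \<bar>u i x - u j x\<bar> \<le> 2 * W x"
      using uW[of i] uW[of j] by eventually_elim linarith
    note vL = sob0_Lp(2)[OF energy_sob0[OF e]] and dL = sob0_Lp(2)[OF energy_sob0[OF ed]]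
    have pi: "integrable L (\<lambda>x. pflux p (v k x) \<bullet> (v i x - v j x))" for k by (rule in_Lp_pflux_inner[OF p_gt(2) vL dL])
    have "(4 / p) * (1/2) powr p * (\<integral>x. norm (v i x - v j x) powr p \<partial>L) = (\<integral>x. (4 / p) * ((1/2) powr p * norm (v i x - v j x) powr p) \<partial>L)"
      by simp
    also have "\<dots> \<le> (\<integral>x. pflux p (v i x) \<bullet> (v i x - v j x) - pflux p (v j x) \<bullet> (v i x - v j x) \<partial>L)"
    proof (rule integral_mono)
      show "integrable L (\<lambda>x. (4 / p) * ((1/2) powr p * norm (v i x - v j x) powr p))" using in_Lp_integrable[OF dL] by simp
      show "integrable L (\<lambda>x. pflux p (v i x) \<bullet> (v i x - v j x) - pflux p (v j x) \<bullet> (v i x - v j x))" using pi by simp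
      show "(4 / p) * ((1/2) powr p * norm (v i x - v j x) powr p) \<le> pflux p (v i x) \<bullet> (v i x - v j x) - pflux p (v j x) \<bullet> (v i x - v j x)" for x
      proof -
        have "norm ((1/2) *\<^sub>R (v i x - v j x)) powr p = (1/2) powr p * norm (v i x - v j x) powr p"
          unfolding norm_scaleR powr_mult by simp
        with pflux_monotone[OF p2, of "v i x" "v j x"] show ?thesis by (simp only: inner_diff_left)
      qed
    qed
    also have "\<dots> = (\<integral>x. pflux p (v i x) \<bullet> (v i x - v j x) \<partial>L) - (\<integral>x. pflux p (v j x) \<bullet> (v i x - v j x) \<partial>L)"
      using pi by simp
    finally have 1: "(4 / p) * (1/2) powr p * (\<integral>x. norm (v i x - v j x) powr p \<partial>L) \<le> (\<integral>x. pflux p (v i x) \<bullet> (v i x - v j x) \<partial>L) - (\<integral>x. pflux p (v j x) \<bullet> (v i x - v j x) \<partial>L)" .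
    have 2: "(\<integral>x. g x * (u i x - u j x) * (u i x - u j x) \<partial>L) = (\<integral>x. g x * (u i x - u j x)\<^sup>2 \<partial>L)"
      by (simp add: power2_eq_square mult.assoc)
    have hbij: "AE x in L. \<bar>h i x - h j x\<bar> \<le> 2 * b x"
      using hb[of i] hb[of j] by eventually_elim linarith
    have "(\<integral>x. (h i x - h j x) * (u i x - u j x) \<partial>L) \<le> (\<integral>x. 2 * (\<bar>h i x - h0 x\<bar> * W x) + 2 * (\<bar>h j x - h0 x\<bar> * W x) \<partial>L)"
    proof (rule integral_mono_AE)
      show "integrable L (\<lambda>x. (h i x - h j x) * (u i x - u j x))"
        by (rule h_mult_integrable(1)[OF _ _ hbij dW]) measurable
      show "integrable L (\<lambda>x. 2 * (\<bar>h i x - h0 x\<bar> * W x) + 2 * (\<bar>h j x - h0 x\<bar> * W x))" using Ei by simp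
      show "AE x in L. (h i x - h j x) * (u i x - u j x) \<le> 2 * (\<bar>h i x - h0 x\<bar> * W x) + 2 * (\<bar>h j x - h0 x\<bar> * W x)"
        using dW W_nonneg
      proof eventually_elim
        case (elim x)
        have "(h i x - h j x) * (u i x - u j x) \<le> \<bar>h i x - h j x\<bar> * \<bar>u i x - u j x\<bar>" by (metis abs_ge_self abs_mult)
        also have "\<dots> \<le> (\<bar>h i x - h0 x\<bar> + \<bar>h j x - h0 x\<bar>) * (2 * W x)" using elim by (intro mult_mono) auto
        finally show ?case by (simp add: algebra_simps)
      qed
    qed
    also have "\<dots> = E i + E j" unfolding E_def using Ei by (simp only: Bochner_Integration.integral_add)
    finally show ?thesis using 1 2 sol_diff_eqn[OF s[of i] s[of j] hm hm hb hb ed dW] by linarith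
  qed
  define c where "c = (4 / p) * (1/2) powr p"
  have c: "c > 0" unfolding c_def using p_gt by simp
  have gsq0: "0 \<le> (\<integral>x. g x * (u i x - u j x)\<^sup>2 \<partial>L)" for i j
    by (rule integral_nonneg_AE) (use g_nonneg in \<open>eventually_elim, simp\<close>)
  have d: "(\<integral>x. norm (v i x - v j x) powr p \<partial>L) \<le> 1 / c * (E i + E j)" for i j
    using key[of i j] gsq0[of i j] c unfolding c_def[symmetric] by (simp add: field_simps)
  have cau: "\<exists>N. \<forall>i\<ge>N. \<forall>j\<ge>N. (\<integral>x. norm (v i x - v j x) powr p \<partial>L) \<le> \<epsilon>" if "\<epsilon> > 0" for \<epsilon>
    by (rule Cauchy_from_null_bound[OF d E0 _ that]) (use c in simp)
  obtain r u0 v0 and U V :: "'a \<Rightarrow> real" where r: "strict_mono r" "sob0 u0 v0" "in_Lp p L U" "in_Lp p L V"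
    "AE x in L. (\<lambda>n. u (r n) x) \<longlonglongrightarrow> u0 x" "AE x in L. (\<lambda>n. v (r n) x) \<longlonglongrightarrow> v0 x"
    "\<And>n. AE x in L. norm (u (r n) x) \<le> norm (U x)" "\<And>n. AE x in L. norm (v (r n) x) \<le> norm (V x)"
    by (rule sob0_complete[where u=u and v=v, OF energy_sob0[OF e] cau], assumption) (rule that)
  \<comment> \<open>Rewrites the g-weighted square norm as an unweighted one, so that Riesz-Fischer
    with exponent 2 supplies a majorant. The absolute value is there because g is nonnegative only
    almost everywhere.\<close>
  define F where "F n x = sqrt \<bar>g x\<bar> * u n x" for n x
  have Fsq: "norm (sqrt \<bar>g x\<bar> * y) powr 2 = \<bar>g x\<bar> * y\<^sup>2" for x y
    by (simp add: abs_mult power_mult_distrib)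
  have gabs: "AE x in L. \<bar>g x\<bar> = g x" using g_nonneg by eventually_elim simp
  have Fm [measurable]: "F n \<in> borel_measurable L" for n unfolding F_def[abs_def] by measurable
  have FL: "in_Lp 2 L (F (r n))" for n
    unfolding in_Lp_def
  proof
    have "integrable L (\<lambda>x. norm (F (r n) x) powr 2) \<longleftrightarrow> integrable L (\<lambda>x. g x * (u (r n) x)\<^sup>2)"
    proof (rule integrable_cong_AE)
      show "AE x in L. norm (F (r n) x) powr 2 = g x * (u (r n) x)\<^sup>2"
        using gabs
      proof eventually_elim
        case (elim x)
        have "norm (F (r n) x) powr 2 = \<bar>g x\<bar> * (u (r n) x)\<^sup>2" unfolding F_def by (rule Fsq)
        then show ?case by (simp only: elim)
      qed
    qed measurable
    then show "integrable L (\<lambda>x. norm (F (r n) x) powr 2)" using energy_square[OF e] by blast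
  qed (rule Fm)
  have E0': "(\<lambda>n. E (r n)) \<longlonglongrightarrow> 0" using LIMSEQ_subseq_LIMSEQ[OF E0 r(1)] by (simp add: o_def)
  have Fd: "(\<integral>x. norm (F (r i) x - F (r j) x) powr 2 \<partial>L) \<le> 1 * (E (r i) + E (r j))" for i j
  proof -
    have eq: "(\<integral>x. norm (F (r i) x - F (r j) x) powr 2 \<partial>L) = (\<integral>x. g x * (u (r i) x - u (r j) x)\<^sup>2 \<partial>L)"
    proof (rule integral_cong_AE)
      show "AE x in L. norm (F (r i) x - F (r j) x) powr 2 = g x * (u (r i) x - u (r j) x)\<^sup>2"
        using gabs
      proof eventually_elim
        case (elim x)
        have "F (r i) x - F (r j) x = sqrt \<bar>g x\<bar> * (u (r i) x - u (r j) x)" by (simp add: F_def right_diff_distrib)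
        then have "norm (F (r i) x - F (r j) x) powr 2 = \<bar>g x\<bar> * (u (r i) x - u (r j) x)\<^sup>2" by (simp only: Fsq)
        then show ?case by (simp only: elim)
      qed
    qed measurable
    have "0 \<le> (4 / p) * (1/2) powr p * (\<integral>x. norm (v (r i) x - v (r j) x) powr p \<partial>L)" using p_gt by simp
    then have "(\<integral>x. g x * (u (r i) x - u (r j) x)\<^sup>2 \<partial>L) \<le> E (r i) + E (r j)"
      by (rule order_trans[OF add_increasing[OF _ order_refl] key])
    then show ?thesis unfolding eq by simp
  qed
  have Fcau: "\<exists>N. \<forall>i\<ge>N. \<forall>j\<ge>N. (\<integral>x. norm (F (r i) x - F (r j) x) powr 2 \<partial>L) \<le> \<epsilon>" if "\<epsilon> > 0" for \<epsilon>
    by (rule Cauchy_from_null_bound[OF Fd E0' _ that]) simp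
  obtain q G and Z :: "'a \<Rightarrow> real" where q: "strict_mono q" "in_Lp 2 L Z" "G \<in> borel_measurable L"
    "AE x in L. (\<lambda>n. F (r (q n)) x) \<longlonglongrightarrow> G x" "\<And>n. AE x in L. norm (F (r (q n)) x) \<le> norm (Z x)"
    by (rule Riesz_Fischer[where F="\<lambda>n. F (r n)", OF _ FL Fcau], simp, assumption) (rule that)
  have ul: "AE x in L. (\<lambda>n. u (r (q n)) x) \<longlonglongrightarrow> u0 x"
    using r(5) by eventually_elim (drule LIMSEQ_subseq_LIMSEQ[OF _ q(1)], simp add: o_def)
  have vl: "AE x in L. (\<lambda>n. v (r (q n)) x) \<longlonglongrightarrow> v0 x"
    using r(6) by eventually_elim (drule LIMSEQ_subseq_LIMSEQ[OF _ q(1)], simp add: o_def)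
  have hl': "AE x in L. (\<lambda>n. h (r (q n)) x) \<longlonglongrightarrow> h0 x"
    using hl
  proof eventually_elim
    case (elim x)
    have "strict_mono (\<lambda>n. r (q n))" using r(1) q(1) by (simp add: strict_mono_def)
    from LIMSEQ_subseq_LIMSEQ[OF elim this] show ?case by (simp add: o_def)
  qed
  have [measurable]: "u0 \<in> borel_measurable L" "v0 \<in> borel_measurable L" "Z \<in> borel_measurable L" "V \<in> borel_measurable L"
    using sob0_Lp[OF r(2)] q(2) r(4) by (auto intro: in_Lp_measurable)
  have Zi: "integrable L (\<lambda>x. (Z x)\<^sup>2)" using in_Lp_integrable[OF q(2)] by simp
  have "AE x in L. \<forall>n. norm (F (r (q n)) x) \<le> norm (Z x)" using q(5) by (simp add: AE_all_countable)
  with ul have u0Z: "AE x in L. norm (sqrt \<bar>g x\<bar> * u0 x) \<le> norm (Z x)"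
  proof eventually_elim
    case (elim x)
    have "(\<lambda>n. norm (F (r (q n)) x)) \<longlonglongrightarrow> norm (sqrt \<bar>g x\<bar> * u0 x)"
      unfolding F_def using elim(1) by (intro tendsto_intros)
    then show ?case by (rule Lim_bounded) (use elim(2) in blast)
  qed
  have e0: "energy u0 v0"
    unfolding energy_def
  proof
    show "integrable L (\<lambda>x. g x * (u0 x)\<^sup>2)"
    proof (rule Bochner_Integration.integrable_bound[OF Zi])
      show "AE x in L. norm (g x * (u0 x)\<^sup>2) \<le> norm ((Z x)\<^sup>2)"
        using u0Z
      proof eventually_elim
        case (elim x)
        then have "(norm (sqrt \<bar>g x\<bar> * u0 x))\<^sup>2 \<le> (norm (Z x))\<^sup>2" by (rule power_mono) simp
        then show ?case by (simp add: abs_mult power_mult_distrib)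
      qed
    qed measurable
  qed (rule r(2))
  have "AE x in L. \<forall>n. \<bar>u (r (q n)) x\<bar> \<le> W x" using uW by (simp add: AE_all_countable)
  with ul have u0W: "AE x in L. \<bar>u0 x\<bar> \<le> W x"
    by eventually_elim (rule Lim_bounded[OF tendsto_rabs], auto)
  have "eqn h0 u0 v0 \<phi> w" if ew: "energy \<phi> w" and \<phi>W: "AE x in L. \<bar>\<phi> x\<bar> \<le> c * W x" for \<phi> w c
  proof -
    note wL = sob0_Lp(2)[OF energy_sob0[OF ew]]
    have [measurable]: "\<phi> \<in> borel_measurable L" "w \<in> borel_measurable L" using energy_measurable[OF ew] by auto
    have l1: "(\<lambda>n. \<integral>x. pflux p (v (r (q n)) x) \<bullet> w x \<partial>L) \<longlonglongrightarrow> (\<integral>x. pflux p (v0 x) \<bullet> w x \<partial>L)"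
    proof (rule integral_dominated_convergence)
      show "integrable L (\<lambda>x. norm (V x) powr p + norm (w x) powr p)"
        using in_Lp_integrable[OF r(4)] in_Lp_integrable[OF wL] by simp
      show "(\<lambda>x. pflux p (v0 x) \<bullet> w x) \<in> borel_measurable L" "(\<lambda>x. pflux p (v (r (q n)) x) \<bullet> w x) \<in> borel_measurable L" for n
        unfolding pflux_def by measurable
      show "AE x in L. (\<lambda>n. pflux p (v (r (q n)) x) \<bullet> w x) \<longlonglongrightarrow> pflux p (v0 x) \<bullet> w x"
        using vl by eventually_elim (intro tendsto_inner tendsto_pflux p_gt tendsto_const)
      show "AE x in L. norm (pflux p (v (r (q n)) x) \<bullet> w x) \<le> norm (V x) powr p + norm (w x) powr p" for n
        using r(8)[of "q n"]
      proof eventually_elim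
        case (elim x)
        then have "norm (v (r (q n)) x) powr p \<le> norm (V x) powr p" using p_gt by (intro powr_mono2) auto
        with abs_pflux_inner_le[OF p_gt(2), of "v (r (q n)) x" "w x"] show ?case unfolding real_norm_def by linarith
      qed
    qed
    have l2: "(\<lambda>n. \<integral>x. g x * u (r (q n)) x * \<phi> x \<partial>L) \<longlonglongrightarrow> (\<integral>x. g x * u0 x * \<phi> x \<partial>L)"
    proof (rule integral_dominated_convergence)
      show "integrable L (\<lambda>x. (Z x)\<^sup>2 + g x * (\<phi> x)\<^sup>2)" using Zi energy_square[OF ew] by simp
      show "AE x in L. (\<lambda>n. g x * u (r (q n)) x * \<phi> x) \<longlonglongrightarrow> g x * u0 x * \<phi> x"
        using ul by eventually_elim (intro tendsto_intros)
      show "AE x in L. norm (g x * u (r (q n)) x * \<phi> x) \<le> (Z x)\<^sup>2 + g x * (\<phi> x)\<^sup>2" for n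
        using q(5)[of n] g_nonneg
      proof eventually_elim
        case (elim x)
        let ?a = "\<bar>sqrt \<bar>g x\<bar> * u (r (q n)) x\<bar>" and ?b = "\<bar>sqrt \<bar>g x\<bar> * \<phi> x\<bar>"
        have ab: "norm (g x * u (r (q n)) x * \<phi> x) = ?a * ?b"
        proof -
          have "?a * ?b = (sqrt \<bar>g x\<bar> * sqrt \<bar>g x\<bar>) * (\<bar>u (r (q n)) x\<bar> * \<bar>\<phi> x\<bar>)"
            by (simp only: abs_mult abs_of_nonneg[OF real_sqrt_ge_zero[OF abs_ge_zero]] mult_ac)
          also have "\<dots> = \<bar>g x\<bar> * (\<bar>u (r (q n)) x\<bar> * \<bar>\<phi> x\<bar>)" by (simp only: real_sqrt_mult_self abs_idempotent)
          finally show ?thesis by (simp add: abs_mult)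
        qed
        have "2 * (?a * ?b) \<le> ?a\<^sup>2 + ?b\<^sup>2" using sum_squares_bound[of ?a ?b] by (simp only: mult.assoc)
        moreover have "?a\<^sup>2 \<le> (Z x)\<^sup>2" using power_mono[OF elim(1)[unfolded F_def real_norm_def], of 2] by simp
        moreover have "?b\<^sup>2 = g x * (\<phi> x)\<^sup>2" using elim(2) by (simp add: abs_mult power_mult_distrib)
        moreover have "?a * ?b \<ge> 0" by simp
        ultimately show ?case unfolding ab by linarith
      qed
    qed measurable
    have hb1: "AE x in L. \<bar>h n x\<bar> \<le> 1 * b x" for n using hb by simp
    have l3: "(\<lambda>n. \<integral>x. h (r (q n)) x * \<phi> x \<partial>L) \<longlonglongrightarrow> (\<integral>x. h0 x * \<phi> x \<partial>L)"
    proof (rule integral_dominated_convergence)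
      show "integrable L (\<lambda>x. 1 * c * (b x * W x))" using bW_integrable by simp
      show "AE x in L. (\<lambda>n. h (r (q n)) x * \<phi> x) \<longlonglongrightarrow> h0 x * \<phi> x"
        using hl' by eventually_elim (intro tendsto_intros)
      show "AE x in L. norm (h (r (q n)) x * \<phi> x) \<le> 1 * c * (b x * W x)" for n
        unfolding real_norm_def by (rule h_mult_integrable(2)[OF _ _ hb1 \<phi>W]) measurable
    qed measurable
    have "(\<integral>x. pflux p (v (r (q n)) x) \<bullet> w x \<partial>L) + (\<integral>x. g x * u (r (q n)) x * \<phi> x \<partial>L) = (\<integral>x. h (r (q n)) x * \<phi> x \<partial>L) + (\<integral>x. f x * \<phi> x \<partial>L)" for n
      using sol_eqn[OF s ew \<phi>W] unfolding eqn_def .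
    from LIMSEQ_unique[OF tendsto_add[OF l1 l2], unfolded this, OF tendsto_add[OF l3 tendsto_const]]
    show ?thesis unfolding eqn_def .
  qed
  with e0 u0W have "sol h0 u0 v0" unfolding sol_def by blast
  with r(1,5) show ?thesis by (intro that)
qed

text \<open>A source below b may be unbounded, so it is cut off at the bounded barriers' right-hand
  sides. Each cut-off problem is solved by minimisation and confined by the smooth barrier, and
  stability removes the cut-off.\<close>

lemma sol_exists:
  assumes [measurable]: "h \<in> borel_measurable L" and hb: "AE x in L. \<bar>h x\<bar> \<le> b x"
  obtains u v where "sol h u v"
proof -
  \<comment> \<open>Truncation of h at the level min (bn, b). The bound by \<open>bn n\<close> gives
    boundedness and comparison with \<open>Wn n\<close>; the bound by \<open>b\<close> is what
    stability asks for; and since |h| \<le> b, the limit is h.\<close>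
  define hn where "hn n x = max (- min (bn n x) (b x)) (min (min (bn n x) (b x)) (h x))" for n x
  have hnm [measurable]: "hn n \<in> borel_measurable L" for n unfolding hn_def[abs_def] by measurable
  have hn_bn: "\<bar>hn n x\<bar> \<le> bn n x" and hn_b: "\<bar>hn n x\<bar> \<le> b x" for n x
    using bn_nonneg[of n x] b_nonneg[of x] unfolding hn_def by linarith+
  have "\<exists>u v. sol (hn n) u v" for n
  proof -
    from bn_bounded[of n] obtain H where H: "\<And>x. x \<in> \<Omega> \<Longrightarrow> bn n x \<le> H" by blast
    have hH: "\<bar>hn n x\<bar> \<le> H" if "x \<in> \<Omega>" for x using hn_bn[of n x] H[OF that] by linarith
    have bH: "\<bar>bn n x\<bar> \<le> H" if "x \<in> \<Omega>" for x using bn_nonneg[of n x] H[OF that] by linarith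
    obtain u v where e: "energy u v" "\<And>\<phi> w. energy \<phi> w \<Longrightarrow> eqn (hn n) u v \<phi> w"
      by (rule bounded_solution[OF hnm hH], assumption) (rule that)
    have "AE x in L. \<bar>u x\<bar> \<le> Wn n x"
      by (rule comparison_barrier_abs[OF e(1) e(2) Wn_Ck Wn_nonneg M_le_Wn AE_I2[OF hn_bn] hnm bn_measurable hH bH bn_super])
    with Wn_le_W[of n] have "AE x in L. \<bar>u x\<bar> \<le> W x" by eventually_elim linarith
    with e have "sol (hn n) u v" unfolding sol_def by blast
    then show ?thesis by blast
  qed
  then have "\<forall>n. \<exists>uv. sol (hn n) (fst uv) (snd uv)" by simp
  then have "\<exists>UV. \<forall>n. sol (hn n) (fst (UV n)) (snd (UV n))" by (rule choice)
  then obtain UV where UV: "\<forall>n. sol (hn n) (fst (UV n)) (snd (UV n))" ..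
  have s: "sol (hn n) (fst (UV n)) (snd (UV n))" for n using UV by (rule spec)
  have l: "AE x in L. (\<lambda>n. hn n x) \<longlonglongrightarrow> h x"
    using bn_tendsto hb
  proof eventually_elim
    case (elim x)
    have "(\<lambda>n. hn n x) \<longlonglongrightarrow> max (- min (b x) (b x)) (min (min (b x) (b x)) (h x))"
      unfolding hn_def using elim(1)[folded b_def] by (intro tendsto_intros)
    then show ?case using elim(2) by (simp add: max_def min_def split: if_splits)
  qed
  obtain r u0 v0 where "strict_mono r" "sol h u0 v0" "AE x in L. (\<lambda>n. fst (UV (r n)) x) \<longlonglongrightarrow> u0 x"
    by (rule sol_stable[where u="\<lambda>n. fst (UV n)" and v="\<lambda>n. snd (UV n)", OF s hnm AE_I2[OF hn_b] assms(1) l]) (rule that)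
  then show ?thesis by (intro that)
qed

lemma pflux_real_mono:
  fixes a a' :: real
  assumes "a \<le> a'" shows "pflux p a \<le> pflux p a'"
proof (cases "a = a'")
  case False
  then show ?thesis using pflux_monotone_nonneg[OF p2, of a' a] assms by (simp add: zero_le_mult_iff)
qed simp

lemma eqn_cong:
  assumes "AE x in L. u x = u' x" "AE x in L. h x = h' x" "eqn h u v \<phi> w"
    and [measurable]: "u \<in> borel_measurable L" "u' \<in> borel_measurable L" "h \<in> borel_measurable L" "h' \<in> borel_measurable L"
      "\<phi> \<in> borel_measurable L"
  shows "eqn h' u' v \<phi> w"
proof -
  have "(\<integral>x. g x * u x * \<phi> x \<partial>L) = (\<integral>x. g x * u' x * \<phi> x \<partial>L)"
    by (rule integral_cong_AE) (measurable, use assms(1) in eventually_elim, simp)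
  moreover have "(\<integral>x. h x * \<phi> x \<partial>L) = (\<integral>x. h' x * \<phi> x \<partial>L)"
    by (rule integral_cong_AE) (measurable, use assms(2) in eventually_elim, simp)
  ultimately show ?thesis using assms(3) unfolding eqn_def by simp
qed

theorem fixed_point_solution:
  obtains u v where "sol (\<lambda>x. \<kappa> x * pflux p (u x)) u v"
proof -
  define H where "H u x = \<kappa> x * pflux p (u x)" for u :: "'a \<Rightarrow> real" and x
  have Hm: "H u \<in> borel_measurable L" if [measurable]: "u \<in> borel_measurable L" for u
    unfolding H_def[abs_def] pflux_def by measurable
  have Hb: "AE x in L. \<bar>H u x\<bar> \<le> b x" if "AE x in L. \<bar>u x\<bar> \<le> W x" for u
    using that
  proof eventually_elim
    case (elim x)
    have "\<bar>u x\<bar> powr (p - 1) \<le> W x powr (p - 1)" using elim p_gt by (intro powr_mono2) auto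
    then show ?case unfolding H_def b_def using norm_pflux[of p "u x"] \<kappa>_nonneg[of x]
      by (simp add: abs_mult mult_left_mono)
  qed
  \<comment> \<open>T u solves the problem with the Hardy term frozen at u. A pair of function and
    gradient is chosen.\<close>
  define T where "T u = (SOME uv. sol (H u) (fst uv) (snd uv))" for u
  have T: "sol (H u) (fst (T u)) (snd (T u))" if um: "u \<in> borel_measurable L" and uW: "AE x in L. \<bar>u x\<bar> \<le> W x" for u
  proof -
    obtain u' v' where "sol (H u) u' v'" by (rule sol_exists[OF Hm[OF um] Hb[OF uW]]) (rule that)
    then have "\<exists>uv. sol (H u) (fst uv) (snd uv)" by (intro exI[of _ "(u', v')"]) simp
    then show ?thesis unfolding T_def by (rule someI_ex)
  qed
  define it where "it n = ((\<lambda>u. fst (T u)) ^^ n) (\<lambda>x. - W x)" for n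
  have it0: "it 0 = (\<lambda>x. - W x)" and itS: "it (Suc n) = fst (T (it n))" for n unfolding it_def by simp_all
  have inv: "it n \<in> borel_measurable L \<and> (AE x in L. \<bar>it n x\<bar> \<le> W x)" for n
  proof (induction n)
    case 0
    have "AE x in L. \<bar>- W x\<bar> \<le> W x" using W_nonneg by eventually_elim simp
    then show ?case unfolding it0 by simp
  next
    case (Suc n)
    then show ?case unfolding itS using T energy_measurable(1)[OF sol_energy] sol_le_W by blast
  qed
  have itm: "it n \<in> borel_measurable L" and itW: "AE x in L. \<bar>it n x\<bar> \<le> W x" for n using inv[of n] by blast+
  have its: "sol (H (it n)) (it (Suc n)) (snd (T (it n)))" for n
    unfolding itS by (rule T[OF itm itW])
  have mono: "AE x in L. it n x \<le> it (Suc n) x" for n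
  proof (induction n)
    case 0
    \<comment> \<open>The base case is free: the iteration starts at the lower barrier -W, and every
      iterate lies above it.\<close>
    show ?case using itW[of "Suc 0"] unfolding it0 by eventually_elim linarith
  next
    case (Suc n)
    have "AE x in L. H (it n) x \<le> H (it (Suc n)) x"
      using Suc by eventually_elim (unfold H_def, intro mult_left_mono pflux_real_mono \<kappa>_nonneg)
    then show ?case by (rule sol_mono[OF its its Hm[OF itm] Hm[OF itm] Hb[OF itW] Hb[OF itW]])
  qed
  define us where "us x = lim (\<lambda>n. it n x)" for x
  have usm: "us \<in> borel_measurable L" unfolding us_def[abs_def] by (rule borel_measurable_lim_metric[OF itm])
  have "AE x in L. \<forall>n. \<bar>it n x\<bar> \<le> W x" "AE x in L. \<forall>n. it n x \<le> it (Suc n) x"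
    using itW mono by (simp_all add: AE_all_countable)
  then have lim: "AE x in L. (\<lambda>n. it n x) \<longlonglongrightarrow> us x"
  proof eventually_elim
    case (elim x)
    have "incseq (\<lambda>n. it n x)" using elim(2) by (intro incseq_SucI) blast
    moreover have "Bseq (\<lambda>n. it n x)" by (rule BseqI'[of _ "W x"]) (use elim(1) in simp)
    ultimately have "convergent (\<lambda>n. it n x)" by (intro Bseq_monoseq_convergent) (auto intro: incseq_imp_monoseq)
    then show ?case unfolding us_def by (simp add: convergent_LIMSEQ_iff)
  qed
  have Hl: "AE x in L. (\<lambda>n. H (it n) x) \<longlonglongrightarrow> H us x"
    using lim by eventually_elim (unfold H_def, intro tendsto_mult tendsto_const tendsto_pflux p_gt)
  \<comment> \<open>Source and solution are one step apart in the iteration. Stability yields only a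
    subsequence of the solutions, but by monotonicity the whole sequence converges to
    \<open>us\<close>, so the limit \<open>u0\<close> of the solutions and the function
    \<open>us\<close> inside the limit source coincide almost everywhere.\<close>
  obtain r u0 v0 where r: "strict_mono r" "sol (H us) u0 v0" "AE x in L. (\<lambda>n. it (Suc (r n)) x) \<longlonglongrightarrow> u0 x"
    by (rule sol_stable[where u="\<lambda>n. it (Suc n)" and v="\<lambda>n. snd (T (it n))", OF its Hm[OF itm] Hb[OF itW] Hm[OF usm] Hl]) (rule that)
  have eq: "AE x in L. us x = u0 x"
    using lim r(3)
  proof eventually_elim
    case (elim x)
    have "strict_mono (\<lambda>n. Suc (r n))" using r(1) by (simp add: strict_mono_def)
    from LIMSEQ_subseq_LIMSEQ[OF elim(1) this] have "(\<lambda>n. it (Suc (r n)) x) \<longlonglongrightarrow> us x" by (simp add: o_def)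
    then show ?case using elim(2) by (rule LIMSEQ_unique)
  qed
  have u0m: "u0 \<in> borel_measurable L" using energy_measurable(1)[OF sol_energy[OF r(2)]] .
  have Heq: "AE x in L. H us x = H u0 x" using eq by eventually_elim (simp add: H_def)
  have "sol (H u0) u0 v0"
    unfolding sol_def
  proof (intro conjI allI impI)
    fix \<phi> w c assume ew: "energy \<phi> w" and \<phi>W: "AE x in L. \<bar>\<phi> x\<bar> \<le> c * W x"
    show "eqn (H u0) u0 v0 \<phi> w"
      by (rule eqn_cong[OF _ Heq sol_eqn[OF r(2) ew \<phi>W] u0m u0m Hm[OF usm] Hm[OF u0m] energy_measurable(1)[OF ew]]) simp
  qed (use sol_energy[OF r(2)] sol_le_W[OF r(2)] in auto)
  then show ?thesis unfolding H_def[abs_def] by (rule that)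
qed

end

subsection \<open>Radial functions\<close>

text \<open>Dyadic decomposition: for R/2^(k+1) < |x| \<le> R/2^k the function is at most a k, and a
  k times the volume of the ball of radius R/2^k is geometric with ratio 2^(\<beta> - N) < 1. Whole
  balls serve in place of shells, as only an upper bound is required.\<close>

lemma integrable_norm_powr_cball:
  assumes "0 \<le> \<beta>" "\<beta> < real DIM('a::euclidean_space)" "R > 0"
  shows "integrable lborel (\<lambda>x::'a. indicator (cball 0 R) x * norm x powr (- \<beta>))"
proof -
  let ?N = "DIM('a)"
  define a where "a k = (R / 2 ^ Suc k) powr (- \<beta>)" for k :: nat
  define F where "F k x = a k * indicator (cball 0 (R / 2 ^ k)) x" for k and x :: 'a
  have a0: "a k \<ge> 0" for k unfolding a_def by simp
  have F0: "F k x \<ge> 0" for k x unfolding F_def using a0 by simp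
  have fin: "emeasure lborel (cball (0::'a) r) < \<infinity>" for r by (rule emeasure_bounded_finite[OF bounded_cball])
  have Fi: "integrable lborel (F k)" for k
    unfolding F_def[abs_def] using fin by (intro integrable_mult_right) (simp add: integrable_indicator_iff)
  have FI: "(\<integral>x. norm (F k x) \<partial>lborel) = (R / 2) powr (- \<beta>) * (unit_ball_vol (real ?N) * R ^ ?N) * (2 powr (\<beta> - real ?N)) ^ k" for k
  proof -
    have "(\<integral>x. norm (F k x) \<partial>lborel) = a k * measure lborel (cball (0::'a) (R / 2 ^ k))"
      unfolding F_def using a0 by (simp add: abs_mult)
    also have "measure lborel (cball (0::'a) (R / 2 ^ k)) = unit_ball_vol (real ?N) * (R / 2 ^ k) ^ ?N"
      using assms(3) by (simp add: content_cball)
    also have "(R / 2 ^ k) ^ ?N = R ^ ?N * 2 powr (- (real ?N * real k))"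
    proof -
      have "2 powr (- real (k * ?N)) = inverse (2 ^ (k * ?N) :: real)"
        unfolding powr_minus by (subst powr_realpow) simp_all
      moreover have "(R / 2 ^ k) ^ ?N = R ^ ?N * inverse (2 ^ (k * ?N))"
        by (simp only: divide_inverse power_mult_distrib power_mult power_inverse)
      ultimately show ?thesis by (simp only: of_nat_mult mult.commute)
    qed
    also have "a k = (R / 2) powr (- \<beta>) * 2 powr (\<beta> * real k)"
    proof -
      have "a k = ((R / 2) * 2 powr (- real k)) powr (- \<beta>)"
        unfolding a_def by (simp add: powr_minus powr_realpow field_simps)
      also have "\<dots> = (R / 2) powr (- \<beta>) * 2 powr (\<beta> * real k)" unfolding powr_mult powr_powr by (simp add: mult.commute)
      finally show ?thesis .
    qed
    finally have "(\<integral>x. norm (F k x) \<partial>lborel) = (R / 2) powr (- \<beta>) * (unit_ball_vol (real ?N) * R ^ ?N) * (2 powr (\<beta> * real k) * 2 powr (- (real ?N * real k)))"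
      by (simp only: mult_ac)
    also have "2 powr (\<beta> * real k) * 2 powr (- (real ?N * real k)) = 2 powr (\<beta> * real k + - (real ?N * real k))" by (rule powr_add[symmetric])
    also have "\<beta> * real k + - (real ?N * real k) = (\<beta> - real ?N) * real k" by (simp add: left_diff_distrib)
    also have "2 powr ((\<beta> - real ?N) * real k) = (2 powr (\<beta> - real ?N)) ^ k" by (simp add: powr_powr flip: powr_realpow)
    finally show ?thesis .
  qed
  have ks: "\<exists>k. R / 2 ^ Suc k < norm x \<and> norm x \<le> R / 2 ^ k" if "x \<noteq> 0" "norm x \<le> R" for x :: 'a
  proof -
    have "norm x / R > 0" using that assms(3) by simp
    from real_arch_pow_inv[OF this, of "1/2"] obtain n where n: "(1/2) ^ n < norm x / R" by auto
    then have n: "R / 2 ^ n < norm x" using assms(3) by (simp add: power_divide field_simps)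
    have "\<not> R / 2 ^ 0 < norm x" using that by simp
    from ex_least_nat_less[of "\<lambda>n. R / 2 ^ n < norm x", OF n this]
    obtain k where "\<forall>i\<le>k. \<not> R / 2 ^ i < norm x" "R / 2 ^ Suc k < norm x" by auto
    then show ?thesis by (intro exI[of _ k]) (auto simp: not_less)
  qed
  \<comment> \<open>A point other than 0 lies in only finitely many of the shrinking balls, so the
    series is a finite sum.\<close>
  have summ: "summable (\<lambda>k. F k x)" if "x \<noteq> 0" for x
  proof -
    have "norm x / R > 0" using that assms(3) by simp
    from real_arch_pow_inv[OF this, of "1/2"] obtain n where n: "(1/2) ^ n < norm x / R" by auto
    then have n: "R / 2 ^ n < norm x" using assms(3) by (simp add: power_divide field_simps)
    show ?thesis
    proof (rule summable_finite)
      show "finite {..n}" by simp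
      show "F k x = 0" if "k \<notin> {..n}" for k
      proof -
        have "(2::real) ^ n \<le> 2 ^ k" using that by (intro power_increasing) auto
        then have "R / 2 ^ k \<le> R / 2 ^ n" using assms(3) by (intro divide_left_mono) auto
        with n show ?thesis unfolding F_def by simp
      qed
    qed
  qed
  have z: "AE x in lborel. x \<noteq> (0::'a)"
    using AE_lborel_singleton[of 0] by simp
  have i: "integrable lborel (\<lambda>x. \<Sum>k. F k x)"
  proof (rule integrable_suminf[OF Fi])
    show "AE x in lborel. summable (\<lambda>k. norm (F k x))"
      using z by eventually_elim (use summ F0 in simp)
    have "2 powr (\<beta> - real ?N) < 2 powr 0" using assms(2) by (intro powr_less_mono) auto
    then show "summable (\<lambda>k. \<integral>x. norm (F k x) \<partial>lborel)"
      unfolding FI by (intro summable_mult summable_geometric) simp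
  qed
  have m: "(\<lambda>x::'a. indicator (cball 0 R) x * norm x powr (- \<beta>)) \<in> borel_measurable borel"
  proof -
    have [measurable]: "cball (0::'a) R \<in> sets borel" by simp
    show ?thesis by measurable
  qed
  show ?thesis
  proof (rule Bochner_Integration.integrable_bound[OF i])
    show "AE x in lborel. norm (indicator (cball 0 R) x * norm x powr (- \<beta>)) \<le> norm (\<Sum>k. F k x)"
      using z
    proof eventually_elim
      case (elim x)
      have s0: "0 \<le> (\<Sum>k. F k x)" by (rule suminf_nonneg[OF summ[OF elim] F0])
      show ?case
      proof (cases "norm x \<le> R")
        case True
        from ks[OF elim True] obtain k where k: "R / 2 ^ Suc k < norm x" "norm x \<le> R / 2 ^ k" by blast
        have "norm x powr (- \<beta>) \<le> a k" unfolding a_def using k(1) assms by (intro powr_mono2') auto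
        also have "\<dots> = F k x" unfolding F_def using k(2) by simp
        also have "\<dots> \<le> (\<Sum>k. F k x)" using sum_le_suminf[OF summ[OF elim], of "{k}"] F0 by simp
        finally show ?thesis using True s0 by simp
      qed (use s0 in simp)
    qed
  qed (use m in simp)
qed

context bounded_open
begin

lemma integrable_norm_powr:
  assumes "0 \<le> \<beta>" "\<beta> < real DIM('a)"
  shows "integrable L (\<lambda>x. norm x powr (- \<beta>))"
proof -
  obtain R where R: "R > 0" "\<Omega> \<subseteq> cball 0 R" by (rule bounded_subset_cball0[OF \<Omega>_bounded]) (rule that)
  have "integrable lborel (\<lambda>x::'a. indicator (cball 0 R) x * norm x powr (- \<beta>))"
    by (rule integrable_norm_powr_cball[OF assms R(1)])
  moreover have "(\<lambda>x::'a. indicator (cball 0 R) x * norm x powr (- \<beta>)) \<in> borel_measurable borel"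
  proof -
    have [measurable]: "cball (0::'a) R \<in> sets borel" by simp
    show ?thesis by measurable
  qed
  ultimately have "integrable lebesgue (\<lambda>x::'a. indicator (cball 0 R) x * norm x powr (- \<beta>))"
    by (simp add: integrable_completion)
  then have "integrable lebesgue (\<lambda>x::'a. indicator \<Omega> x *\<^sub>R (indicator (cball 0 R) x * norm x powr (- \<beta>)))"
    by (rule integrable_mult_indicator[OF \<Omega>_sets])
  also have "(\<lambda>x::'a. indicator \<Omega> x *\<^sub>R (indicator (cball 0 R) x * norm x powr (- \<beta>))) = (\<lambda>x. if x \<in> \<Omega> then norm x powr (- \<beta>) else 0)"
    using R(2) by (auto simp: fun_eq_iff indicator_def)
  finally show ?thesis by (rule Lebesgue_Measure.integrable_restrict_UNIV[OF \<Omega>_sets, THEN iffD1])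
qed

lemma AE_nonzero: "AE x in L. x \<noteq> 0"
proof -
  have "AE x in lebesgue. x \<noteq> (0::'a)" by (rule AE_completion) (use AE_lborel_singleton[of 0] in simp)
  then have "AE x in lebesgue. x \<in> \<Omega> \<longrightarrow> x \<noteq> 0" by eventually_elim simp
  then show ?thesis using \<Omega>_sets by (simp add: AE_restrict_space_iff)
qed

text \<open>An identity -div X = d known against test functions extends to the whole zero-boundary
  space, since bounded X and d make both sides continuous along the approximating sequence.\<close>

lemma integral_inner_sob0:
  fixes X :: "'a \<Rightarrow> 'a" and d :: "'a \<Rightarrow> real"
  assumes [measurable]: "X \<in> borel_measurable L" "d \<in> borel_measurable L"
    and B: "\<And>x. x \<in> \<Omega> \<Longrightarrow> norm (X x) \<le> B" "\<And>x. x \<in> \<Omega> \<Longrightarrow> \<bar>d x\<bar> \<le> B"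
    and t: "\<And>\<psi>. \<psi> \<in> test_functions \<Omega> \<Longrightarrow> (\<integral>x. X x \<bullet> grad \<psi> x \<partial>L) = (\<integral>x. d x * \<psi> x \<partial>L)"
    and s: "sob0 \<phi> w"
  shows "(\<integral>x. X x \<bullet> w x \<partial>L) = (\<integral>x. d x * \<phi> x \<partial>L)"
proof -
  obtain \<psi> and U V :: "'a \<Rightarrow> real" where a: "\<And>n. \<psi> n \<in> test_functions \<Omega>" "in_Lp p L U" "in_Lp p L V"
    "AE x in L. (\<lambda>n. \<psi> n x) \<longlonglongrightarrow> \<phi> x" "AE x in L. (\<lambda>n. grad (\<psi> n) x) \<longlonglongrightarrow> w x"
    "\<And>n. AE x in L. norm (\<psi> n x) \<le> norm (U x)" "\<And>n. AE x in L. norm (grad (\<psi> n) x) \<le> norm (V x)"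
    by (rule sob0_approx[OF s]) (rule that)
  have [measurable]: "\<psi> n \<in> borel_measurable L" "grad (\<psi> n) \<in> borel_measurable L" for n
    using test_in_Lp[OF a(1), THEN in_Lp_measurable] by auto
  have [measurable]: "\<phi> \<in> borel_measurable L" "w \<in> borel_measurable L"
    using sob0_Lp[OF s, THEN in_Lp_measurable] by auto
  have XB: "AE x in L. norm (X x) \<le> B" "AE x in L. \<bar>d x\<bar> \<le> B" using B by (auto intro: AE_I2)
  have "(\<lambda>n. \<integral>x. X x \<bullet> grad (\<psi> n) x \<partial>L) \<longlonglongrightarrow> (\<integral>x. X x \<bullet> w x \<partial>L)"
  proof (rule integral_dominated_convergence)
    show "integrable L (\<lambda>x. B * norm (V x))" using in_Lp_imp_integrable[OF a(3)] by simp
    show "AE x in L. (\<lambda>n. X x \<bullet> grad (\<psi> n) x) \<longlonglongrightarrow> X x \<bullet> w x" using a(5) by eventually_elim (intro tendsto_intros)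
    show "AE x in L. norm (X x \<bullet> grad (\<psi> n) x) \<le> B * norm (V x)" for n
      using a(7)[of n] XB(1)
    proof eventually_elim
      case (elim x)
      have "norm (X x \<bullet> grad (\<psi> n) x) \<le> norm (X x) * norm (grad (\<psi> n) x)" using Cauchy_Schwarz_ineq2 by simp
      also have "\<dots> \<le> B * norm (V x)" using elim by (intro mult_mono) (auto intro: order_trans[OF norm_ge_zero])
      finally show ?case .
    qed
  qed measurable
  moreover have "(\<lambda>n. \<integral>x. d x * \<psi> n x \<partial>L) \<longlonglongrightarrow> (\<integral>x. d x * \<phi> x \<partial>L)"
  proof (rule integral_dominated_convergence)
    show "integrable L (\<lambda>x. B * norm (U x))" using in_Lp_imp_integrable[OF a(2)] by simp
    show "AE x in L. (\<lambda>n. d x * \<psi> n x) \<longlonglongrightarrow> d x * \<phi> x" using a(4) by eventually_elim (intro tendsto_intros)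
    show "AE x in L. norm (d x * \<psi> n x) \<le> B * norm (U x)" for n
      using a(6)[of n] XB(2)
    proof eventually_elim
      case (elim x)
      then show ?case unfolding norm_mult by (intro mult_mono) (auto intro: order_trans[OF abs_ge_zero])
    qed
  qed measurable
  ultimately show ?thesis unfolding t[OF a(1)] by (rule LIMSEQ_unique)
qed

end

section \<open>Divergence of the flux of regularised radial powers\<close>

lemma powr_minus_4_times:
  fixes r p :: real
  assumes "r \<ge> 0" shows "r powr (p - 4) * r * r = r powr (p - 2)"
proof -
  have "r powr (p - 4) * r = r powr (p - 3)" using powr_minus_2_times[OF assms, of "p - 2"] by (simp add: algebra_simps)
  moreover have "r powr (p - 3) * r = r powr (p - 2)" using powr_minus_1_times[OF assms, of "p - 2"] by (simp add: algebra_simps)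
  ultimately show ?thesis by simp
qed

text \<open>The gradient of one component of |x|^(p-2) x. The case p = 2 is separate because
  \<open>0 powr 0 = 0\<close> would make the general formula give 0 rather than i at the
  origin.\<close>

definition grad_pflux_comp :: "real \<Rightarrow> 'a::euclidean_space \<Rightarrow> 'a \<Rightarrow> 'a" where
  "grad_pflux_comp p i x = (if p = 2 then i
     else norm x powr (p - 2) *\<^sub>R i + ((p - 2) * norm x powr (p - 4) * (x \<bullet> i)) *\<^sub>R x)"

lemma GDERIV_pflux_comp:
  fixes i :: "'a::euclidean_space"
  assumes p: "p \<ge> 2"
  shows "GDERIV (\<lambda>x. pflux p x \<bullet> i) x :> grad_pflux_comp p i x"
proof (cases "p = 2")
  case True
  have "pflux 2 x = x" for x :: 'a by (cases "x = 0") (auto simp: pflux_def)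
  then show ?thesis unfolding True grad_pflux_comp_def gderiv_def by (auto intro!: derivative_eq_intros)
next
  case False
  then have p: "p > 2" using assms by simp
  show ?thesis
  proof (cases "x = 0")
    case True
    have "((\<lambda>h. norm (pflux p h \<bullet> i) / norm h) \<longlongrightarrow> 0) (at 0)"
    proof (rule Lim_null_comparison)
      have "p - 2 > 0" using p by simp
      from tendsto_norm_powr[OF this tendsto_ident_at, of "0::'a" UNIV]
      have "((\<lambda>h::'a. norm h powr (p - 2) * norm i) \<longlongrightarrow> norm (0::'a) powr (p - 2) * norm i) (at 0)"
        by (rule tendsto_mult[OF _ tendsto_const])
      then show "((\<lambda>h::'a. norm h powr (p - 2) * norm i) \<longlongrightarrow> 0) (at 0)" by simp
      show "\<forall>\<^sub>F h::'a in at 0. norm (norm (pflux p h \<bullet> i) / norm h) \<le> norm h powr (p - 2) * norm i"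
      proof (rule eventually_at_filter[THEN iffD2, OF always_eventually], intro allI impI)
        fix h :: 'a assume h: "h \<noteq> 0"
        have "norm (pflux p h \<bullet> i) \<le> norm (pflux p h) * norm i" using Cauchy_Schwarz_ineq2 by simp
        also have "norm (pflux p h) = norm h powr (p - 2) * norm h" by (simp add: norm_pflux powr_minus_2_times)
        finally show "norm (norm (pflux p h \<bullet> i) / norm h) \<le> norm h powr (p - 2) * norm i"
          using h by (simp add: divide_le_eq mult_ac)
      qed
    qed
    then have "((\<lambda>x. pflux p x \<bullet> i) has_derivative (\<lambda>h. 0)) (at 0)"
      unfolding has_derivative_at by (simp add: bounded_linear_zero)
    then show ?thesis unfolding True gderiv_def grad_pflux_comp_def using False by simp
  next
    case nz: False
    have d: "DERIV (\<lambda>s. s powr (p - 2)) (norm x) :> (p - 2) * norm x powr (p - 2 - 1)"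
      using nz by (intro has_real_derivative_powr) simp_all
    have "GDERIV (\<lambda>x. x \<bullet> i) x :> i" unfolding gderiv_def by (auto intro!: derivative_eq_intros)
    from GDERIV_mult[OF GDERIV_DERIV_compose[OF GDERIV_norm[OF nz] d] this]
    have "GDERIV (\<lambda>x. norm x powr (p - 2) * (x \<bullet> i)) x :>
      norm x powr (p - 2) *\<^sub>R i + (x \<bullet> i) *\<^sub>R (((p - 2) * norm x powr (p - 2 - 1)) *\<^sub>R sgn x)" .
    moreover have "(x \<bullet> i) *\<^sub>R (((p - 2) * norm x powr (p - 2 - 1)) *\<^sub>R sgn x) = ((p - 2) * norm x powr (p - 4) * (x \<bullet> i)) *\<^sub>R x"
    proof -
      have "norm x powr (p - 2 - 1) = norm x powr (p - 4) * norm x"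
        using powr_minus_2_times[of "norm x" "p - 2"] by (simp add: algebra_simps)
      then show ?thesis using nz by (simp add: sgn_div_norm)
    qed
    ultimately show ?thesis unfolding grad_pflux_comp_def pflux_def using False by simp
  qed
qed

lemma norm_grad_pflux_comp_le:
  assumes "p \<ge> 2" "norm x \<le> R" "i \<in> Basis"
  shows "norm (grad_pflux_comp p i x) \<le> 1 + (p - 1) * R powr (p - 2)"
proof (cases "p = 2")
  case False
  have e: "norm x powr (p - 4) * norm x * norm x = norm x powr (p - 2)" by (rule powr_minus_4_times) simp
  have "norm (grad_pflux_comp p i x) \<le> norm x powr (p - 2) * norm i + (p - 2) * norm x powr (p - 4) * \<bar>x \<bullet> i\<bar> * norm x"
    unfolding grad_pflux_comp_def using False assms(1) by (auto intro!: norm_triangle_le simp: abs_mult)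
  also have "\<dots> \<le> norm x powr (p - 2) * norm i + (p - 2) * norm x powr (p - 4) * norm x * norm x"
    using assms Basis_le_norm[OF assms(3), of x] by (intro add_left_mono mult_right_mono mult_left_mono) auto
  also have "(p - 2) * norm x powr (p - 4) * norm x * norm x = (p - 2) * norm x powr (p - 2)" unfolding e[symmetric] by (simp only: mult.assoc)
  also have "norm x powr (p - 2) * norm i + (p - 2) * norm x powr (p - 2) = (p - 1) * norm x powr (p - 2)"
    using assms(3) by (simp add: algebra_simps)
  also have "\<dots> \<le> (p - 1) * R powr (p - 2)" using assms by (intro mult_left_mono powr_mono2) auto
  finally show ?thesis by simp
qed (use assms in \<open>simp add: grad_pflux_comp_def\<close>)

text \<open>The sum is the divergence of |x|^(p-2) x. The origin is excluded since for p = 2 the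
  convention \<open>0 powr 0 = 0\<close> falsifies the right-hand side there.\<close>

lemma sum_grad_pflux_comp:
  assumes "x \<noteq> (0::'a::euclidean_space)"
  shows "(\<Sum>i\<in>Basis. grad_pflux_comp p i x \<bullet> i) = (real DIM('a) + p - 2) * norm x powr (p - 2)"
proof (cases "p = 2")
  case False
  have e: "norm x powr (p - 4) * (x \<bullet> x) = norm x powr (p - 2)"
    unfolding power2_norm_eq_inner[symmetric] power2_eq_square mult.assoc[symmetric] by (rule powr_minus_4_times) simp
  have "(\<Sum>i\<in>Basis. grad_pflux_comp p i x \<bullet> i) = (\<Sum>i\<in>Basis. norm x powr (p - 2) + (p - 2) * norm x powr (p - 4) * ((x \<bullet> i) * (x \<bullet> i)))"
    unfolding grad_pflux_comp_def using False by (intro sum.cong) (auto simp: inner_add_left)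
  also have "\<dots> = real DIM('a) * norm x powr (p - 2) + (p - 2) * norm x powr (p - 4) * (x \<bullet> x)"
    by (simp add: sum.distrib euclidean_inner[of x x] sum_distrib_left)
  also have "(p - 2) * norm x powr (p - 4) * (x \<bullet> x) = (p - 2) * norm x powr (p - 2)" unfolding e[symmetric] by (simp only: mult.assoc)
  finally show ?thesis by (simp add: algebra_simps)
qed (use assms in \<open>simp add: grad_pflux_comp_def\<close>)

text \<open>A smooth regularisation of |x|^(2q), hence the exponent -\<alpha>/2 in the
  barriers.\<close>

definition rho_powr :: "real \<Rightarrow> real \<Rightarrow> 'a::euclidean_space \<Rightarrow> real" where
  "rho_powr \<epsilon> q x = (x \<bullet> x + \<epsilon>) powr q"

lemma rho_pos: "\<epsilon> > 0 \<Longrightarrow> x \<bullet> x + \<epsilon> > 0" for x :: "'a::euclidean_space"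
  by (simp add: add_nonneg_pos)

lemma GDERIV_rho_powr:
  assumes "\<epsilon> > 0"
  shows "GDERIV (rho_powr \<epsilon> q) x :> (2 * q * rho_powr \<epsilon> (q - 1) x) *\<^sub>R x"
proof -
  have "GDERIV (\<lambda>x. x \<bullet> x + \<epsilon>) x :> 2 *\<^sub>R x"
    unfolding gderiv_def by (auto intro!: derivative_eq_intros simp: inner_commute)
  from GDERIV_DERIV_compose[OF this has_real_derivative_powr[OF rho_pos[OF assms]]]
  have "GDERIV (\<lambda>x. (x \<bullet> x + \<epsilon>) powr q) x :> (q * (x \<bullet> x + \<epsilon>) powr (q - 1)) *\<^sub>R (2 *\<^sub>R x)" .
  then show ?thesis unfolding rho_powr_def[abs_def] by (simp add: mult_ac)
qed

lemma Ck_rho_powr: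
  assumes "\<epsilon> > 0" shows "Ck k (rho_powr \<epsilon> q)"
proof -
  \<comment> \<open>The n-th derivative of s^q: the Pochhammer symbol written from below is the
    falling factorial q (q-1) ... (q-n+1).\<close>
  define D where "D n s = pochhammer (q - real n + 1) n * s powr (q - real n)" for n s
  have D: "(D n has_real_derivative D (Suc n) s) (at s)" if "s \<in> {0<..}" for n s
  proof -
    have "(D n has_real_derivative pochhammer (q - real n + 1) n * ((q - real n) * s powr (q - real n - 1))) (at s)"
      unfolding D_def[abs_def] using that by (intro DERIV_cmult has_real_derivative_powr) auto
    moreover have "D (Suc n) s = pochhammer (q - real n + 1) n * ((q - real n) * s powr (q - real n - 1))"
    proof -
      have eq: "pochhammer (q - real (Suc n) + 1) (Suc n) = (q - real n) * pochhammer (q - real n + 1) n"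
        by (simp add: pochhammer_rec)
      have a: "q - real (Suc n) = q - real n - 1" by simp
      show ?thesis unfolding D_def eq unfolding a by (simp only: mult_ac)
    qed
    ultimately show ?thesis by simp
  qed
  have "Ck k (\<lambda>x::'a. D 0 (x \<bullet> x + \<epsilon>))"
  proof (rule Ck_compose[where S="{0<..}" and d=D])
    show "(D n has_real_derivative D (Suc n) s) (at s)" if "s \<in> {0<..}" for n s by (rule D[OF that])
    show "x \<bullet> x + \<epsilon> \<in> {0<..}" for x :: 'a using rho_pos[OF assms, of x] by simp
    show "Ck k (\<lambda>x::'a. x \<bullet> x + \<epsilon>)" by (intro Ck_add Ck_inner_self Ck_const)
  qed
  then show ?thesis unfolding D_def rho_powr_def[abs_def] by simp
qed

lemma rho_powr_bound:
  assumes "\<epsilon> > 0" shows "q \<le> 0 \<Longrightarrow> rho_powr \<epsilon> q x \<le> \<epsilon> powr q" "rho_powr \<epsilon> q x > 0"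
  unfolding rho_powr_def using rho_pos[OF assms, of x] assms by (auto intro!: powr_mono2')

lemma pflux_scaleR:
  assumes "c \<ge> 0" shows "pflux p (c *\<^sub>R a) = c powr (p - 1) *\<^sub>R pflux p a"
proof -
  have "pflux p (c *\<^sub>R a) = (c powr (p - 2) * c) *\<^sub>R pflux p a"
    unfolding pflux_def using assms by (simp add: powr_mult mult_ac)
  then show ?thesis using powr_minus_2_times[OF assms] by simp
qed

context bounded_open
begin

text \<open>The flux of the gradient of W is -K \<rho>^(-\<gamma>) |x|^(p-2) x with \<rho> = |x|^2 +
  \<epsilon>, and minus its divergence is K \<rho>^(-\<gamma>-1) |x|^(p-2) ((N+p-2) \<rho> - 2
  \<gamma> |x|^2). As 2 \<gamma> = N + p - 2 - c0, the bracket equals c0 \<rho> + 2 \<gamma>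
  \<epsilon>. Dropping the positive last term leaves the claimed right-hand side, which shows that
  regularisation helps.\<close>

lemma radial_supersolution:
  fixes A \<alpha> \<epsilon> lam :: real
  defines "W \<equiv> \<lambda>x. A * rho_powr \<epsilon> (- \<alpha> / 2) x"
    and "\<gamma> \<equiv> (\<alpha> / 2 + 1) * (p - 1)"
  assumes A: "A > 0" and \<alpha>: "\<alpha> > 0" and \<epsilon>: "\<epsilon> > 0"
    and lam: "lam = \<alpha> powr (p - 1) * (real DIM('a) - p - \<alpha> * (p - 1))"
    and s: "sob0 \<phi> w" and \<phi>0: "AE x in L. 0 \<le> \<phi> x"
  shows "(\<integral>x. lam * A powr (p - 1) * norm x powr (p - 2) * rho_powr \<epsilon> (- \<gamma>) x * \<phi> x \<partial>L) \<le> (\<integral>x. pflux p (grad W x) \<bullet> w x \<partial>L)"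
proof -
  obtain R where R: "R > 0" "\<Omega> \<subseteq> cball 0 R" by (rule bounded_subset_cball0[OF \<Omega>_bounded]) (rule that)
  have xR: "norm x \<le> R" if "x \<in> \<Omega>" for x using R that by auto
  have \<gamma>0: "\<gamma> > 0" unfolding \<gamma>_def using \<alpha> p_gt by simp
  define K where "K = (A * \<alpha>) powr (p - 1)"
  have K0: "K > 0" unfolding K_def using A \<alpha> by simp
  have gW: "grad W x = - ((A * \<alpha> * rho_powr \<epsilon> (- \<alpha> / 2 - 1) x) *\<^sub>R x)" for x
  proof (rule GDERIV_imp_grad)
    have "GDERIV W x :> A *\<^sub>R ((2 * (- \<alpha> / 2) * rho_powr \<epsilon> (- \<alpha> / 2 - 1) x) *\<^sub>R x) + rho_powr \<epsilon> (- \<alpha> / 2) x *\<^sub>R 0"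
      unfolding W_def by (rule GDERIV_mult[OF GDERIV_const GDERIV_rho_powr[OF \<epsilon>]])
    then show "GDERIV W x :> - ((A * \<alpha> * rho_powr \<epsilon> (- \<alpha> / 2 - 1) x) *\<^sub>R x)" by (simp add: mult.assoc)
  qed
  define X where "X x = - ((K * rho_powr \<epsilon> (- \<gamma>) x) *\<^sub>R pflux p x)" for x :: 'a
  have pX: "pflux p (grad W x) = X x" for x
  proof -
    have "(- \<alpha> / 2 - 1) * (p - 1) = - \<gamma>" unfolding \<gamma>_def by (simp add: algebra_simps)
    then have "(rho_powr \<epsilon> (- \<alpha> / 2 - 1) x) powr (p - 1) = rho_powr \<epsilon> (- \<gamma>) x"
      unfolding rho_powr_def powr_powr by simp
    then have "(A * \<alpha> * rho_powr \<epsilon> (- \<alpha> / 2 - 1) x) powr (p - 1) = K * rho_powr \<epsilon> (- \<gamma>) x"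
      unfolding K_def by (simp only: powr_mult)
    moreover have "A * \<alpha> * rho_powr \<epsilon> (- \<alpha> / 2 - 1) x \<ge> 0"
      using A \<alpha> rho_powr_bound(2)[OF \<epsilon>, of "- \<alpha> / 2 - 1" x] by simp
    ultimately show ?thesis unfolding gW pflux_minus X_def by (simp only: pflux_scaleR)
  qed
  define D where "D i x = (K * rho_powr \<epsilon> (- \<gamma>) x) *\<^sub>R grad_pflux_comp p i x
    + (pflux p x \<bullet> i) *\<^sub>R ((K * (2 * (- \<gamma>) * rho_powr \<epsilon> (- \<gamma> - 1) x)) *\<^sub>R x)" for i x :: 'a
  have gd: "GDERIV (\<lambda>x. K * rho_powr \<epsilon> (- \<gamma>) x * (pflux p x \<bullet> i)) x :> D i x" for i x
  proof -
    have "GDERIV (\<lambda>x. K * rho_powr \<epsilon> (- \<gamma>) x) x :> K *\<^sub>R ((2 * (- \<gamma>) * rho_powr \<epsilon> (- \<gamma> - 1) x) *\<^sub>R x) + rho_powr \<epsilon> (- \<gamma>) x *\<^sub>R 0"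
      by (rule GDERIV_mult[OF GDERIV_const GDERIV_rho_powr[OF \<epsilon>]])
    then have "GDERIV (\<lambda>x. K * rho_powr \<epsilon> (- \<gamma>) x) x :> (K * (2 * (- \<gamma>) * rho_powr \<epsilon> (- \<gamma> - 1) x)) *\<^sub>R x" by simp
    from GDERIV_mult[OF this GDERIV_pflux_comp[OF p2]] show ?thesis unfolding D_def .
  qed
  \<comment> \<open>A crude bound for the gradients of the flux components on a ball; only its
    finiteness for fixed \<epsilon> matters.\<close>
  define B where "B R = K * \<epsilon> powr (- \<gamma>) * (1 + (p - 1) * R powr (p - 2)) + R powr (p - 1) * (K * (2 * \<gamma> * \<epsilon> powr (- \<gamma> - 1)) * R)" for R
  have rb: "0 \<le> rho_powr \<epsilon> (- \<gamma>) x" "rho_powr \<epsilon> (- \<gamma>) x \<le> \<epsilon> powr (- \<gamma>)"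
    "0 \<le> rho_powr \<epsilon> (- \<gamma> - 1) x" "rho_powr \<epsilon> (- \<gamma> - 1) x \<le> \<epsilon> powr (- \<gamma> - 1)" for x :: 'a
    using rho_powr_bound[OF \<epsilon>, of "- \<gamma>" x] rho_powr_bound[OF \<epsilon>, of "- \<gamma> - 1" x] \<gamma>0 by auto
  have pfR: "norm (pflux p x) \<le> R powr (p - 1)" if "norm x \<le> R" for x :: 'a and R
    unfolding norm_pflux using that p_gt by (intro powr_mono2) auto
  have DB: "norm (D i x) \<le> B R" if x: "norm x \<le> R" and i: "i \<in> Basis" for i x and R
  proof -
    have R0: "R \<ge> 0" using x norm_ge_zero order_trans by blast
    have "norm (D i x) \<le> norm ((K * rho_powr \<epsilon> (- \<gamma>) x) *\<^sub>R grad_pflux_comp p i x)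
       + norm ((pflux p x \<bullet> i) *\<^sub>R ((K * (2 * (- \<gamma>) * rho_powr \<epsilon> (- \<gamma> - 1) x)) *\<^sub>R x))"
      unfolding D_def by (rule norm_triangle_ineq)
    also have "norm ((K * rho_powr \<epsilon> (- \<gamma>) x) *\<^sub>R grad_pflux_comp p i x) = (K * rho_powr \<epsilon> (- \<gamma>) x) * norm (grad_pflux_comp p i x)"
      using K0 rb[of x] by simp
    also have "norm ((pflux p x \<bullet> i) *\<^sub>R ((K * (2 * (- \<gamma>) * rho_powr \<epsilon> (- \<gamma> - 1) x)) *\<^sub>R x)) = \<bar>pflux p x \<bullet> i\<bar> * ((K * (2 * \<gamma> * rho_powr \<epsilon> (- \<gamma> - 1) x)) * norm x)"
      using K0 rb[of x] \<gamma>0 by (simp add: abs_mult)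
    also have "(K * rho_powr \<epsilon> (- \<gamma>) x) * norm (grad_pflux_comp p i x) \<le> (K * \<epsilon> powr (- \<gamma>)) * (1 + (p - 1) * R powr (p - 2))"
      using K0 rb[of x] p_gt by (intro mult_mono mult_left_mono norm_grad_pflux_comp_le[OF p2 x i]) auto
    also have "\<bar>pflux p x \<bullet> i\<bar> * ((K * (2 * \<gamma> * rho_powr \<epsilon> (- \<gamma> - 1) x)) * norm x) \<le> R powr (p - 1) * ((K * (2 * \<gamma> * \<epsilon> powr (- \<gamma> - 1))) * R)"
    proof (intro mult_mono)
      show "\<bar>pflux p x \<bullet> i\<bar> \<le> R powr (p - 1)" using Basis_le_norm[OF i, of "pflux p x"] pfR[OF x] by linarith
    qed (use K0 rb[of x] \<gamma>0 x R0 in auto)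
    finally show ?thesis unfolding B_def by simp
  qed
  define d where "d x = (\<Sum>i\<in>Basis. D i x \<bullet> i)" for x
  have dB: "\<bar>d x\<bar> \<le> real DIM('a) * B R" if "x \<in> \<Omega>" for x
  proof -
    have "\<bar>d x\<bar> \<le> (\<Sum>i\<in>Basis. \<bar>D i x \<bullet> i\<bar>)" unfolding d_def by (rule sum_abs)
    also have "\<dots> \<le> (\<Sum>i\<in>(Basis :: 'a set). B R)"
    proof (rule sum_mono)
      fix i :: 'a assume i: "i \<in> Basis"
      show "\<bar>D i x \<bullet> i\<bar> \<le> B R" using Basis_le_norm[OF i, of "D i x"] DB[OF xR[OF that] i] by linarith
    qed
    finally show ?thesis by simp
  qed
  have XB: "norm (X x) \<le> K * \<epsilon> powr (- \<gamma>) * R powr (p - 1)" if "x \<in> \<Omega>" for x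
  proof -
    have "norm (X x) = (K * rho_powr \<epsilon> (- \<gamma>) x) * norm (pflux p x)" unfolding X_def using K0 rb[of x] by simp
    also have "\<dots> \<le> K * \<epsilon> powr (- \<gamma>) * R powr (p - 1)"
      using K0 rb[of x] pfR[OF xR[OF that]] by (intro mult_mono) auto
    finally show ?thesis .
  qed
  have [measurable]: "rho_powr \<epsilon> q \<in> borel_measurable L" for q
    by (rule continuous_measurable) (use Ck_rho_powr[OF \<epsilon>, of 0 q] in simp)
  have idm [measurable]: "(\<lambda>x. x) \<in> borel_measurable L" by (rule continuous_measurable) (rule continuous_on_id)
  have [measurable]: "(\<lambda>x. pflux p (x::'a)) \<in> borel_measurable L" by (rule pflux_measurable[OF p_gt(2) idm])
  have [measurable]: "grad_pflux_comp p i \<in> borel_measurable L" for i unfolding grad_pflux_comp_def[abs_def] by measurable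
  have Xm: "X \<in> borel_measurable L" unfolding X_def[abs_def] by measurable
  have dm: "d \<in> borel_measurable L" unfolding d_def[abs_def] D_def[abs_def] by measurable
  have test: "(\<integral>x. X x \<bullet> grad \<psi> x \<partial>L) = (\<integral>x. d x * \<psi> x \<partial>L)" if \<psi>: "\<psi> \<in> test_functions \<Omega>" for \<psi>
  proof -
    have bd: "\<exists>B. \<forall>x\<in>cball 0 R. norm (D i x) \<le> B" if "i \<in> Basis" for i R
      by (intro exI[of _ "B R"] ballI DB that) simp
    note ibp = test_functions_ibp[OF \<psi> gd bd \<Omega>_sets]
    have "(\<integral>x. X x \<bullet> grad \<psi> x \<partial>L) = (\<integral>x. (\<Sum>i\<in>Basis. - (K * rho_powr \<epsilon> (- \<gamma>) x * (pflux p x \<bullet> i) * partial_deriv i \<psi> x)) \<partial>L)"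
    proof (rule Bochner_Integration.integral_cong[OF refl])
      fix x
      have "X x \<bullet> grad \<psi> x = (\<Sum>i\<in>Basis. (X x \<bullet> i) * (grad \<psi> x \<bullet> i))" by (rule euclidean_inner)
      then show "X x \<bullet> grad \<psi> x = (\<Sum>i\<in>Basis. - (K * rho_powr \<epsilon> (- \<gamma>) x * (pflux p x \<bullet> i) * partial_deriv i \<psi> x))"
        by (simp add: X_def grad_inner_Basis)
    qed
    also have "\<dots> = (\<Sum>i\<in>Basis. - (\<integral>x. K * rho_powr \<epsilon> (- \<gamma>) x * (pflux p x \<bullet> i) * partial_deriv i \<psi> x \<partial>L))"
      using ibp(1) by (subst Bochner_Integration.integral_sum) auto
    also have "\<dots> = (\<Sum>i\<in>Basis. (\<integral>x. (D i x \<bullet> i) * \<psi> x \<partial>L))"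
      using ibp(3) by (intro sum.cong) auto
    also have "\<dots> = (\<integral>x. d x * \<psi> x \<partial>L)"
      unfolding d_def sum_distrib_right using ibp(2) by (subst Bochner_Integration.integral_sum) auto
    finally show ?thesis .
  qed
  define B0 where "B0 = max (K * \<epsilon> powr (- \<gamma>) * R powr (p - 1)) (real DIM('a) * B R)"
  have eq: "(\<integral>x. X x \<bullet> w x \<partial>L) = (\<integral>x. d x * \<phi> x \<partial>L)"
    by (rule integral_inner_sob0[OF Xm dm _ _ test s, where B=B0])
       (use XB dB in \<open>auto simp: B0_def intro: order_trans[OF _ max.cobounded1] order_trans[OF _ max.cobounded2]\<close>)
  have \<phi>L: "in_Lp p L \<phi>" by (rule sob0_Lp(1)[OF s])
  let ?b = "\<lambda>x. lam * A powr (p - 1) * norm x powr (p - 2) * rho_powr \<epsilon> (- \<gamma>) x"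
  define c0 where "c0 = real DIM('a) - p - \<alpha> * (p - 1)"
  have lamA: "lam * A powr (p - 1) = K * c0" unfolding lam K_def c0_def powr_mult by simp
  have bd: "?b x \<le> d x" if x: "x \<noteq> 0" for x
  proof -
    let ?r = "rho_powr \<epsilon> (- \<gamma> - 1) x" and ?n = "norm x powr (p - 2)" and ?s = "x \<bullet> x"
    have r1: "rho_powr \<epsilon> (- \<gamma>) x = ?r * (?s + \<epsilon>)"
    proof -
      have "rho_powr \<epsilon> (- \<gamma>) x = (?s + \<epsilon>) powr ((- \<gamma> - 1) + 1)" unfolding rho_powr_def by simp
      also have "\<dots> = ?r * (?s + \<epsilon>) powr 1" unfolding rho_powr_def by (rule powr_add)
      also have "(?s + \<epsilon>) powr 1 = ?s + \<epsilon>" using rho_pos[OF \<epsilon>, of x] by simp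
      finally show ?thesis .
    qed
    have pn: "pflux p x \<bullet> x = ?n * ?s" unfolding pflux_def by simp
    have "d x = (K * rho_powr \<epsilon> (- \<gamma>) x) * (\<Sum>i\<in>Basis. grad_pflux_comp p i x \<bullet> i) + K * (2 * (- \<gamma>) * ?r) * (\<Sum>i\<in>Basis. (pflux p x \<bullet> i) * (x \<bullet> i))"
      unfolding d_def D_def by (simp add: inner_add_left inner_diff_left sum.distrib sum_subtractf sum_distrib_left mult_ac)
    also have "(\<Sum>i\<in>Basis. (pflux p x \<bullet> i) * (x \<bullet> i)) = pflux p x \<bullet> x" by (rule euclidean_inner[symmetric])
    finally have dx: "d x = K * ?r * ?n * ((real DIM('a) + p - 2) * (?s + \<epsilon>) - 2 * \<gamma> * ?s)"
      unfolding sum_grad_pflux_comp[OF x] pn r1 by (simp add: algebra_simps)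
    \<comment> \<open>The relation between the exponents that turns the divergence into c0 times
      \<rho> up to a term of order \<epsilon>; the equation for lam is equivalent to
      \<open>lam * A powr (p - 1) = K * c0\<close>.\<close>
    have 2: "2 * \<gamma> = real DIM('a) + p - 2 - c0" unfolding \<gamma>_def c0_def by (simp add: field_simps)
    have "c0 * (?s + \<epsilon>) + 2 * \<gamma> * \<epsilon> = (real DIM('a) + p - 2) * (?s + \<epsilon>) - 2 * \<gamma> * ?s"
      unfolding 2 by (simp add: algebra_simps)
    moreover have "2 * \<gamma> * \<epsilon> \<ge> 0" using \<gamma>0 \<epsilon> by simp
    ultimately have "c0 * (?s + \<epsilon>) \<le> (real DIM('a) + p - 2) * (?s + \<epsilon>) - 2 * \<gamma> * ?s" by linarith
    moreover have "0 \<le> K * ?r * ?n" using K0 rb[of x] by simp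
    ultimately have "K * ?r * ?n * (c0 * (?s + \<epsilon>)) \<le> d x" unfolding dx by (rule mult_left_mono)
    then show ?thesis unfolding lamA r1 by (simp add: mult_ac)
  qed
  have bm: "?b \<in> borel_measurable L" by measurable
  have "(\<integral>x. ?b x * \<phi> x \<partial>L) \<le> (\<integral>x. d x * \<phi> x \<partial>L)"
  proof (rule integral_mono_AE)
    show "integrable L (\<lambda>x. d x * \<phi> x)" by (rule in_Lp_mult_bounded_integrable[OF \<phi>L dm dB])
    show "AE x in L. ?b x * \<phi> x \<le> d x * \<phi> x"
      using \<phi>0 AE_nonzero by eventually_elim (intro mult_right_mono bd)
    show "integrable L (\<lambda>x. ?b x * \<phi> x)"
    proof (rule in_Lp_mult_bounded_integrable[OF \<phi>L bm])
      fix x assume "x \<in> \<Omega>"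
      then have "norm x powr (p - 2) \<le> R powr (p - 2)" using xR p2 by (intro powr_mono2) auto
      then have "norm x powr (p - 2) * rho_powr \<epsilon> (- \<gamma>) x \<le> R powr (p - 2) * \<epsilon> powr (- \<gamma>)"
        using rb[of x] by (intro mult_mono) auto
      then have "\<bar>lam * A powr (p - 1)\<bar> * (norm x powr (p - 2) * rho_powr \<epsilon> (- \<gamma>) x) \<le> \<bar>lam * A powr (p - 1)\<bar> * (R powr (p - 2) * \<epsilon> powr (- \<gamma>))"
        by (rule mult_left_mono) simp
      then show "\<bar>?b x\<bar> \<le> \<bar>lam * A powr (p - 1)\<bar> * (R powr (p - 2) * \<epsilon> powr (- \<gamma>))"
        using rb[of x] by (simp add: abs_mult mult.assoc)
    qed
  qed
  then show ?thesis unfolding pX eq .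
qed

end

subsection \<open>The exponent of summability\<close>

text \<open>The right-hand side of the equation for s, divided by the p-th power of the Hardy
  constant and written in \<beta> = \<open>sobolev_conj N p / s\<close>. The range of s from the
  critical exponent upwards becomes 0 < \<beta> \<le> 1.\<close>

definition hardy_profile :: "real \<Rightarrow> real \<Rightarrow> real" where
  "hardy_profile p \<beta> = p * \<beta> powr (p - 1) - (p - 1) * \<beta> powr p"

lemma hardy_profile_strict_mono:
  assumes "p > 1" "0 \<le> a" "a < b" "b \<le> 1"
  shows "hardy_profile p a < hardy_profile p b"
proof (rule DERIV_pos_imp_increasing_open[OF assms(3)])
  fix x assume x: "a < x" "x < b"
  then have x0: "x > 0" "x < 1" using assms by auto
  have "(hardy_profile p has_real_derivative p * ((p - 1) * x powr (p - 1 - 1)) - (p - 1) * (p * x powr (p - 1))) (at x)"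
    unfolding hardy_profile_def[abs_def] by (intro DERIV_diff DERIV_cmult has_real_derivative_powr x0)
  moreover have "p * ((p - 1) * x powr (p - 1 - 1)) - (p - 1) * (p * x powr (p - 1)) > 0"
  proof -
    have "x powr (p - 1) = x powr (p - 1 - 1) * x" using powr_minus_1_times[of x "p - 1"] x0 by simp
    then have "p * ((p - 1) * x powr (p - 1 - 1)) - (p - 1) * (p * x powr (p - 1)) = p * (p - 1) * x powr (p - 1 - 1) * (1 - x)"
      by (simp add: algebra_simps)
    also have "\<dots> > 0" using assms(1) x0 by simp
    finally show ?thesis .
  qed
  ultimately show "\<exists>y. DERIV (hardy_profile p) x :> y \<and> y > 0" by blast
next
  show "continuous_on {a..b} (hardy_profile p)"
    unfolding hardy_profile_def[abs_def] using assms
    by (intro continuous_on_diff continuous_on_mult continuous_on_powr' continuous_on_const continuous_on_id) auto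
qed

text \<open>On [0, 1] the profile increases strictly from 0 to 1, so lam divided by the p-th power
  of the Hardy constant is attained at exactly one interior \<beta>. Translating back by s =
  \<open>sobolev_conj N p / \<beta>\<close> gives existence and uniqueness of the exponent at
  once.\<close>

lemma s_lambda_characterization:
  fixes N p lam :: real
  assumes p: "2 \<le> p" "p < N" and lam: "0 < lam" "lam < hardy_H N p powr p"
  obtains \<beta> where "0 < \<beta>" "\<beta> < 1" "lam = hardy_H N p powr p * hardy_profile p \<beta>"
    "\<And>s. s \<ge> sobolev_conj N p \<and> s_lambda_eqn N p lam s \<longleftrightarrow> s = sobolev_conj N p / \<beta>"
proof -
  let ?H = "hardy_H N p powr p" and ?P = "sobolev_conj N p"
  have H0: "?H > 0" unfolding hardy_H_def using p by simp
  have P0: "?P > 0" unfolding sobolev_conj_def using p by simp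
  have "\<exists>\<beta>\<ge>0. \<beta> \<le> 1 \<and> hardy_profile p \<beta> = lam / ?H"
  proof (rule IVT')
    show "hardy_profile p 0 \<le> lam / ?H" "lam / ?H \<le> hardy_profile p 1" unfolding hardy_profile_def using lam H0 by simp_all
    show "continuous_on {0..1} (hardy_profile p)"
      unfolding hardy_profile_def[abs_def] using p
      by (intro continuous_on_diff continuous_on_mult continuous_on_powr' continuous_on_const continuous_on_id) auto
  qed simp
  then obtain \<beta> where \<beta>: "0 \<le> \<beta>" "\<beta> \<le> 1" "hardy_profile p \<beta> = lam / ?H" by blast
  have "\<beta> \<noteq> 0" using \<beta>(3) lam H0 by (auto simp: hardy_profile_def)
  moreover have "\<beta> \<noteq> 1" using \<beta>(3) lam H0 by (auto simp: hardy_profile_def)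
  ultimately have \<beta>01: "0 < \<beta>" "\<beta> < 1" using \<beta> by auto
  \<comment> \<open>Here t is s over the critical exponent; dividing by t^p turns the linear
    numerator into powers of 1/t.\<close>
  have prof: "(p * (t - 1) + 1) / t powr p = hardy_profile p (1 / t)" if "t \<ge> 1" for t
  proof -
    have "(1 / t) powr p = 1 / t powr p" by (simp add: powr_divide)
    moreover have "(1 / t) powr (p - 1) = t / t powr p" using that by (simp add: powr_divide powr_diff)
    ultimately show ?thesis unfolding hardy_profile_def by (simp add: diff_divide_distrib add_divide_distrib algebra_simps)
  qed
  have inj: "b = \<beta>" if "0 \<le> b" "b \<le> 1" "hardy_profile p b = hardy_profile p \<beta>" for b
    using that hardy_profile_strict_mono[of p b \<beta>] hardy_profile_strict_mono[of p \<beta> b] \<beta> p by fastforce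
  show ?thesis
  proof (rule that[OF \<beta>01])
    show "lam = ?H * hardy_profile p \<beta>" using \<beta>(3) H0 by simp
    fix s
    have ev: "s_lambda_eqn N p lam s \<longleftrightarrow> hardy_profile p \<beta> = hardy_profile p (?P / s)" if "s \<ge> ?P"
    proof -
      have "s / ?P \<ge> 1" using that P0 by simp
      have "1 / (s / ?P) = ?P / s" by simp
      with prof[OF \<open>s / ?P \<ge> 1\<close>] have "?H * ((p * (s / ?P - 1) + 1) / (s / ?P) powr p) = ?H * hardy_profile p (?P / s)" by simp
      then have e: "?H * (p * (s / ?P - 1) + 1) / (s / ?P) powr p = ?H * hardy_profile p (?P / s)" by (simp only: times_divide_eq_right)
      have "lam = ?H * hardy_profile p (?P / s) \<longleftrightarrow> lam / ?H = hardy_profile p (?P / s)"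
        using H0 by (simp add: divide_eq_eq mult.commute)
      then show ?thesis unfolding s_lambda_eqn_def e \<beta>(3) .
    qed
    show "s \<ge> ?P \<and> s_lambda_eqn N p lam s \<longleftrightarrow> s = ?P / \<beta>"
    proof
      assume s: "s \<ge> ?P \<and> s_lambda_eqn N p lam s"
      then have "?P / s = \<beta>" using ev P0 by (intro inj) auto
      then show "s = ?P / \<beta>" using s P0 by auto
    next
      assume s: "s = ?P / \<beta>"
      have "?P * \<beta> \<le> ?P * 1" using \<beta>01 P0 by (intro mult_left_mono) auto
      then have "s \<ge> ?P" using \<beta>01 unfolding s by (simp add: le_divide_eq)
      moreover have "?P / s = \<beta>" using s P0 \<beta>01 by simp
      ultimately show "s \<ge> ?P \<and> s_lambda_eqn N p lam s" using ev by simp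
    qed
  qed
qed

subsection \<open>Existence and summability\<close>

text \<open>The bound \<alpha> p + p < N selects the smaller root: it is the condition for W^p /
  |x|^p, a multiple of |x|^(-\<alpha> p - p), to be integrable near the origin. The regularised
  barriers with \<epsilon> = 1/(n+1) instantiate the abstract scheme.\<close>

lemma existence_and_summability:
  fixes \<Omega> :: "'a::euclidean_space set" and p lam M \<alpha> :: real and f g :: "'a \<Rightarrow> real"
  assumes D: "dirichlet \<Omega> p f g M" and lam0: "lam > 0"
    and \<alpha>: "\<alpha> > 0" "\<alpha> * p + p < real DIM('a)"
    and lam: "lam = \<alpha> powr (p - 1) * (real DIM('a) - p - \<alpha> * (p - 1))"
  obtains u where "weak_solution p lam \<Omega> g f u"
    "\<And>s. 0 \<le> s \<Longrightarrow> \<alpha> * s < real DIM('a) \<Longrightarrow> u \<in> Lp_space s \<Omega>"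
proof -
  interpret dirichlet \<Omega> p f g M by (rule D)
  obtain R where R: "R > 0" "\<Omega> \<subseteq> cball 0 R" by (rule bounded_subset_cball0[OF \<Omega>_bounded]) (rule that)
  have xR: "norm x \<le> R" if "x \<in> \<Omega>" for x using R that by auto
  \<comment> \<open>Chosen so that A (R^2 + 1)^(-\<alpha>/2) = M. As |x| \<le> R on \<Omega> and
    \<epsilon> \<le> 1, all regularised barriers are then at least M there.\<close>
  define A where "A = M * (R\<^sup>2 + 1) powr (\<alpha> / 2)"
  have R1: "R\<^sup>2 + 1 > 0" by (rule add_nonneg_pos) simp_all
  then have A0: "A > 0" unfolding A_def using M_pos by (intro mult_pos_pos) auto
  define \<gamma> where "\<gamma> = (\<alpha> / 2 + 1) * (p - 1)"
  define \<epsilon> where "\<epsilon> n = 1 / real (Suc n)" for n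
  have \<epsilon>: "\<epsilon> n > 0" "\<epsilon> n \<le> 1" for n unfolding \<epsilon>_def by auto
  have \<epsilon>l: "\<epsilon> \<longlonglongrightarrow> 0" unfolding \<epsilon>_def[abs_def] by (rule LIMSEQ_Suc[OF lim_1_over_n])
  define \<kappa> where "\<kappa> x = lam / norm x powr p" for x :: 'a
  define W where "W x = A * norm x powr (- \<alpha>)" for x :: 'a
  define Wn where "Wn n x = A * rho_powr (\<epsilon> n) (- \<alpha> / 2) x" for n and x :: 'a
  define bn where "bn n x = lam * A powr (p - 1) * norm x powr (p - 2) * rho_powr (\<epsilon> n) (- \<gamma>) x" for n and x :: 'a
  have sq: "(x \<bullet> x) powr q = norm x powr (2 * q)" for x :: 'a and q
  proof -
    have "(x \<bullet> x) powr q = (norm x powr 2) powr q" by (simp add: power2_norm_eq_inner)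
    then show ?thesis by (simp only: powr_powr)
  qed
  have idm [measurable]: "(\<lambda>x. x) \<in> borel_measurable L" by (rule continuous_measurable) (rule continuous_on_id)
  have rm [measurable]: "rho_powr (\<epsilon> n) q \<in> borel_measurable L" for n q
    by (rule continuous_measurable) (use Ck_rho_powr[OF \<epsilon>(1), of 0 n q] in simp)
  interpret supersolution \<Omega> p f g M \<kappa> W Wn bn
  proof unfold_locales
    show "\<kappa> \<in> borel_measurable L" unfolding \<kappa>_def[abs_def] by measurable
    show "W \<in> borel_measurable L" unfolding W_def[abs_def] by measurable
    show "\<kappa> x \<ge> 0" for x unfolding \<kappa>_def using lam0 by simp
    have "integrable L (\<lambda>x. lam * A powr p * norm x powr (- (\<alpha> * p + p)))"
      using \<alpha> p_gt by (intro integrable_mult_right integrable_norm_powr) auto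
    also have "(\<lambda>x. lam * A powr p * norm x powr (- (\<alpha> * p + p))) = (\<lambda>x::'a. \<kappa> x * W x powr p)"
    proof
      fix x :: 'a
      have "norm x powr (- (\<alpha> * p + p)) = norm x powr (- \<alpha> * p) * norm x powr (- p)" by (simp flip: powr_add)
      then show "lam * A powr p * norm x powr (- (\<alpha> * p + p)) = \<kappa> x * W x powr p"
        unfolding \<kappa>_def W_def powr_mult powr_powr by (simp add: powr_minus divide_inverse mult_ac)
    qed
    finally show "integrable L (\<lambda>x. \<kappa> x * W x powr p)" .
    show "Ck k (Wn n)" for k n unfolding Wn_def[abs_def] by (intro Ck_cmult Ck_rho_powr \<epsilon>)
    show "Wn n x \<ge> 0" for n x unfolding Wn_def using A0 rho_powr_bound(2)[OF \<epsilon>(1), of n "- \<alpha> / 2" x] by simp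
    show "M \<le> Wn n x" if "x \<in> \<Omega>" for n x
    proof -
      have "x \<bullet> x \<le> R\<^sup>2" using xR[OF that] by (simp add: power_mono flip: power2_norm_eq_inner)
      then have "x \<bullet> x + \<epsilon> n \<le> R\<^sup>2 + 1" using \<epsilon>(2)[of n] by simp
      then have "(R\<^sup>2 + 1) powr (- \<alpha> / 2) \<le> rho_powr (\<epsilon> n) (- \<alpha> / 2) x"
        unfolding rho_powr_def using rho_pos[OF \<epsilon>(1), of x n] \<alpha> by (intro powr_mono2') auto
      then have "A * (R\<^sup>2 + 1) powr (- \<alpha> / 2) \<le> Wn n x" unfolding Wn_def using A0 by simp
      moreover have "A * (R\<^sup>2 + 1) powr (- \<alpha> / 2) = M"
      proof -
        have "(R\<^sup>2 + 1) powr (\<alpha> / 2) * (R\<^sup>2 + 1) powr (- \<alpha> / 2) = (R\<^sup>2 + 1) powr (\<alpha> / 2 + - \<alpha> / 2)" by (rule powr_add[symmetric])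
        also have "\<dots> = 1" using R1 by simp
        finally show ?thesis unfolding A_def by (simp add: mult.assoc)
      qed
      ultimately show ?thesis by simp
    qed
    show "AE x in L. Wn n x \<le> W x" for n
      using AE_nonzero
    proof eventually_elim
      case (elim x)
      have "(x \<bullet> x + \<epsilon> n) powr (- \<alpha> / 2) \<le> (x \<bullet> x) powr (- \<alpha> / 2)"
        using elim \<epsilon>(1)[of n] \<alpha> by (intro powr_mono2') auto
      then show ?case unfolding Wn_def W_def rho_powr_def sq using A0 by simp
    qed
    show "bn n \<in> borel_measurable L" for n unfolding bn_def[abs_def] by measurable
    show "bn n x \<ge> 0" for n x
      unfolding bn_def using lam0 rho_powr_bound(2)[OF \<epsilon>(1), of n "- \<gamma>" x] by simp
    show "\<exists>H. \<forall>x\<in>\<Omega>. bn n x \<le> H" for n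
    proof (intro exI ballI)
      fix x assume x: "x \<in> \<Omega>"
      have "\<gamma> \<ge> 0" unfolding \<gamma>_def using \<alpha> p_gt by simp
      then have "rho_powr (\<epsilon> n) (- \<gamma>) x \<le> \<epsilon> n powr (- \<gamma>)" "0 \<le> rho_powr (\<epsilon> n) (- \<gamma>) x"
        using rho_powr_bound(1)[OF \<epsilon>(1)[of n], of "- \<gamma>" x] rho_powr_bound(2)[OF \<epsilon>(1)[of n], of "- \<gamma>" x] by simp_all
      moreover have "norm x powr (p - 2) \<le> R powr (p - 2)" using xR[OF x] p2 by (intro powr_mono2) auto
      ultimately show "bn n x \<le> lam * A powr (p - 1) * R powr (p - 2) * \<epsilon> n powr (- \<gamma>)"
        unfolding bn_def using lam0 by (intro mult_mono mult_left_mono) auto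
    qed
    show "AE x in L. (\<lambda>n. bn n x) \<longlonglongrightarrow> \<kappa> x * W x powr (p - 1)"
      using AE_nonzero
    proof eventually_elim
      case (elim x)
      have "(\<lambda>n. bn n x) \<longlonglongrightarrow> lam * A powr (p - 1) * norm x powr (p - 2) * (x \<bullet> x + 0) powr (- \<gamma>)"
        unfolding bn_def rho_powr_def using elim
        by (intro tendsto_mult tendsto_const tendsto_powr tendsto_add \<epsilon>l) auto
      moreover have "lam * A powr (p - 1) * norm x powr (p - 2) * (x \<bullet> x + 0) powr (- \<gamma>) = \<kappa> x * W x powr (p - 1)"
      proof -
        \<comment> \<open>Exponent count: since 2 \<gamma> = (\<alpha> + 2) (p - 1), the power (p -
          2) - 2 \<gamma> is -p - \<alpha> (p - 1), that of W^(p-1) / |x|^p.\<close>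
        have "norm x powr (p - 2) * (x \<bullet> x + 0) powr (- \<gamma>) = norm x powr ((p - 2) + 2 * (- \<gamma>))"
          unfolding add_0_right sq by (rule powr_add[symmetric])
        also have "(p - 2) + 2 * (- \<gamma>) = - p + (- \<alpha>) * (p - 1)" unfolding \<gamma>_def by (simp add: field_simps)
        also have "norm x powr (- p + (- \<alpha>) * (p - 1)) = norm x powr (- p) * norm x powr ((- \<alpha>) * (p - 1))" by (rule powr_add)
        finally show ?thesis unfolding \<kappa>_def W_def powr_mult powr_powr by (simp add: powr_minus divide_inverse mult_ac)
      qed
      ultimately show ?case by simp
    qed
    show "(\<integral>x. bn n x * \<phi> x \<partial>L) \<le> (\<integral>x. pflux p (grad (Wn n) x) \<bullet> w x \<partial>L)"
      if "energy \<phi> w" "AE x in L. 0 \<le> \<phi> x" for n \<phi> w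
      using radial_supersolution[OF A0 \<alpha>(1) \<epsilon>(1) lam energy_sob0[OF that(1)] that(2), of n]
      unfolding bn_def Wn_def[abs_def] \<gamma>_def .
  qed
  obtain u v where sol: "sol (\<lambda>x. \<kappa> x * pflux p (u x)) u v" by (rule fixed_point_solution) (rule that)
  have e: "energy u v" and uW: "AE x in L. \<bar>u x\<bar> \<le> W x" by (rule sol_energy[OF sol], rule sol_le_W[OF sol])
  note s = energy_sob0[OF e]
  have [measurable]: "u \<in> borel_measurable L" "v \<in> borel_measurable L" using energy_measurable[OF e] by auto
  have uW0: "u \<in> sobolev_W0 p \<Omega>" by (rule sob0_imp_W0[OF s])
  show ?thesis
  proof (rule that[of u])
    show "weak_solution p lam \<Omega> g f u"
      unfolding weak_solution_def Let_def
    proof (intro conjI ballI)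
      show "u \<in> sobolev_W0 p \<Omega>" by (rule uW0)
      show "integrable L (\<lambda>x. g x * u x)"
      proof (rule Bochner_Integration.integrable_bound)
        show "integrable L (\<lambda>x. g x + g x * (u x)\<^sup>2)" using g_int energy_square[OF e] by simp
        show "AE x in L. norm (g x * u x) \<le> norm (g x + g x * (u x)\<^sup>2)"
          using g_nonneg
        proof eventually_elim
          case (elim x)
          have "\<bar>u x\<bar> \<le> 1 + (u x)\<^sup>2"
            using sum_squares_bound[of "\<bar>u x\<bar>" 1] zero_le_power2[of "u x"] unfolding power2_abs one_power2 by linarith
          then have "g x * \<bar>u x\<bar> \<le> g x * (1 + (u x)\<^sup>2)" using elim by (rule mult_left_mono)
          then show ?case using elim by (simp add: abs_mult distrib_left)
        qed
      qed measurable
      fix \<phi> assume \<phi>: "\<phi> \<in> sobolev_W0 p \<Omega> \<inter> Linf_space \<Omega>"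
      then obtain C where C: "AE x in L. \<bar>\<phi> x\<bar> \<le> C" unfolding Linf_space_def by blast
      from \<phi> have \<phi>s: "sob0 \<phi> (weak_grad \<Omega> \<phi>)" by (intro W0_imp_sob0) simp
      have [measurable]: "\<phi> \<in> borel_measurable L" by (rule in_Lp_measurable[OF sob0_Lp(1)[OF \<phi>s]])
      \<comment> \<open>For a bounded test function the weighted square is at most C^2 g, so
        integrability of g gives finite energy.\<close>
      have e\<phi>: "energy \<phi> (weak_grad \<Omega> \<phi>)" unfolding energy_def
      proof
        show "integrable L (\<lambda>x. g x * (\<phi> x)\<^sup>2)"
        proof (rule Bochner_Integration.integrable_bound)
          show "integrable L (\<lambda>x. C\<^sup>2 * g x)" using g_int by simp
          show "AE x in L. norm (g x * (\<phi> x)\<^sup>2) \<le> norm (C\<^sup>2 * g x)"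
            using C g_nonneg
          proof eventually_elim
            case (elim x)
            have "(\<phi> x)\<^sup>2 \<le> C\<^sup>2" using power_mono[OF elim(1), of 2] by simp
            then have "g x * (\<phi> x)\<^sup>2 \<le> g x * C\<^sup>2" using elim(2) by (rule mult_left_mono)
            then show ?case using elim(2) by (simp add: mult.commute)
          qed
        qed measurable
      qed (rule \<phi>s)
      \<comment> \<open>The lower bound W \<ge> M > 0 turns boundedness of the test function into
        domination by a multiple of \<open>W\<close>.\<close>
      have \<phi>W: "AE x in L. \<bar>\<phi> x\<bar> \<le> (\<bar>C\<bar> / M) * W x"
        using C W_ge_M
      proof eventually_elim
        case (elim x)
        have "\<bar>C\<bar> = (\<bar>C\<bar> / M) * M" using M_pos by simp
        also have "\<dots> \<le> (\<bar>C\<bar> / M) * W x" using elim(2) M_pos by (intro mult_left_mono) auto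
        finally show ?case using elim(1) by linarith
      qed
      have wL: "in_Lp p L (weak_grad \<Omega> u)" "in_Lp p L (weak_grad \<Omega> \<phi>)"
        using sob0_Lp(2)[OF W0_imp_sob0[OF uW0]] sob0_Lp(2)[OF \<phi>s] by auto
      have A: "norm (weak_grad \<Omega> u x) powr (p - 2) *\<^sub>R weak_grad \<Omega> u x = pflux p (weak_grad \<Omega> u x)" for x by (simp add: pflux_def)
      have Cf: "lam / norm x powr p * (\<bar>u x\<bar> powr (p - 2) * u x) * \<phi> x = (\<kappa> x * pflux p (u x)) * \<phi> x" for x
        by (simp add: pflux_def \<kappa>_def)
      show "integrable L (\<lambda>x. (norm (weak_grad \<Omega> u x) powr (p - 2) *\<^sub>R weak_grad \<Omega> u x) \<bullet> weak_grad \<Omega> \<phi> x)"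
        unfolding A by (rule in_Lp_pflux_inner[OF p_gt(2) wL])
      show "integrable L (\<lambda>x. g x * u x * \<phi> x)" by (rule energy_mult_integrable[OF e e\<phi>])
      show "integrable L (\<lambda>x. f x * \<phi> x)" by (rule energy_f_integrable[OF e\<phi>])
      have [measurable]: "(\<lambda>x. pflux p (u x)) \<in> borel_measurable L" by (rule pflux_measurable[OF p_gt(2)]) measurable
      have hb: "AE x in L. \<bar>\<kappa> x * pflux p (u x)\<bar> \<le> 1 * b x"
        using uW
      proof eventually_elim
        case (elim x)
        have "\<bar>u x\<bar> powr (p - 1) \<le> W x powr (p - 1)" using elim p_gt by (intro powr_mono2) auto
        then show ?case unfolding b_def using norm_pflux[of p "u x"] \<kappa>_nonneg[of x]
          by (simp add: abs_mult mult_left_mono)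
      qed
      show "integrable L (\<lambda>x. lam / norm x powr p * (\<bar>u x\<bar> powr (p - 2) * u x) * \<phi> x)"
        unfolding Cf by (rule h_mult_integrable(1)[OF _ _ hb \<phi>W]) measurable
      have wm [measurable]: "weak_grad \<Omega> u \<in> borel_measurable L" "weak_grad \<Omega> \<phi> \<in> borel_measurable L"
        using wL by (auto intro: in_Lp_measurable)
      have "(\<integral>x. pflux p (weak_grad \<Omega> u x) \<bullet> weak_grad \<Omega> \<phi> x \<partial>L) = (\<integral>x. pflux p (v x) \<bullet> weak_grad \<Omega> \<phi> x \<partial>L)"
      proof (rule integral_cong_AE)
        show "AE x in L. pflux p (weak_grad \<Omega> u x) \<bullet> weak_grad \<Omega> \<phi> x = pflux p (v x) \<bullet> weak_grad \<Omega> \<phi> x"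
          using sob0_weak_grad(1)[OF s] by eventually_elim simp
      qed (unfold pflux_def, measurable)
      then show "(\<integral>x. (norm (weak_grad \<Omega> u x) powr (p - 2) *\<^sub>R weak_grad \<Omega> u x) \<bullet> weak_grad \<Omega> \<phi> x \<partial>L) + (\<integral>x. g x * u x * \<phi> x \<partial>L) =
          (\<integral>x. lam / norm x powr p * (\<bar>u x\<bar> powr (p - 2) * u x) * \<phi> x \<partial>L) + (\<integral>x. f x * \<phi> x \<partial>L)"
        using sol_eqn[OF sol e\<phi> \<phi>W] unfolding A Cf eqn_def by simp
    qed
    fix q :: real assume q: "0 \<le> q" "\<alpha> * q < real DIM('a)"
    show "u \<in> Lp_space q \<Omega>"
      unfolding Lp_space_iff
    proof (rule in_Lp_bound[OF q(1)])
      have "integrable L (\<lambda>x. A powr q * norm x powr (- (\<alpha> * q)))"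
        using \<alpha> q by (intro integrable_mult_right integrable_norm_powr) auto
      then have "integrable L (\<lambda>x. norm (W x) powr q)"
        unfolding W_def using A0 by (simp add: powr_mult powr_powr)
      then show "in_Lp q L W" unfolding in_Lp_def by simp
      show "AE x in L. norm (u x) \<le> norm (W x)" using uW by eventually_elim simp
    qed measurable
  qed
qed

theorem theorem3:
  fixes \<Omega> :: "(real ^ 'n) set" and p lam M :: real and f g :: "real ^ 'n \<Rightarrow> real"
  defines "N \<equiv> real CARD('n)"
  assumes "open \<Omega>" "connected \<Omega>" "\<Omega> \<noteq> {}" "bounded \<Omega>"
    and "2 \<le> p" "p < N"
    and "0 < lam" "lam < hardy_H N p powr p"
    and "integrable (lebesgue_on \<Omega>) f" "integrable (lebesgue_on \<Omega>) g"
    and "AE x in lebesgue_on \<Omega>. 0 \<le> g x"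
    and "M > 0" "AE x in lebesgue_on \<Omega>. \<bar>f x\<bar> \<le> M * g x"
  shows "(\<exists>!s. s \<ge> sobolev_conj N p \<and> s_lambda_eqn N p lam s) \<and>
    (\<exists>u. weak_solution p lam \<Omega> g f u \<and>
         (\<forall>s\<in>{sobolev_conj N p..<s_lambda N p lam}. u \<in> Lp_space s \<Omega>))"
proof -
  obtain \<beta> where \<beta>: "0 < \<beta>" "\<beta> < 1" and lam: "lam = hardy_H N p powr p * hardy_profile p \<beta>"
    and ch: "\<And>s. s \<ge> sobolev_conj N p \<and> s_lambda_eqn N p lam s \<longleftrightarrow> s = sobolev_conj N p / \<beta>"
    by (rule s_lambda_characterization[OF assms(6-9)]) (rule that)
  have sl: "s_lambda N p lam = sobolev_conj N p / \<beta>"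
    unfolding s_lambda_def ch by simp
  define H where "H = hardy_H N p"
  have H0: "H > 0" unfolding H_def hardy_H_def using assms by simp
  have pH: "p * H = N - p" unfolding H_def hardy_H_def using assms by simp
  \<comment> \<open>With H = (N - p)/p and \<alpha> = H \<beta>, the profile equation becomes the
    equation for the radial power, and \<beta> < 1 becomes \<alpha> p + p < N.\<close>
  define \<alpha> where "\<alpha> = H * \<beta>"
  have N: "real DIM(real ^ 'n) = N" unfolding N_def by simp
  have D: "dirichlet \<Omega> p f g M" by unfold_locales (use assms in auto)
  have a0: "\<alpha> > 0" unfolding \<alpha>_def using H0 \<beta> by simp
  have "\<alpha> < H" unfolding \<alpha>_def using H0 \<beta> by simp
  then have "\<alpha> * p < H * p" using assms by simp
  then have a1: "\<alpha> * p + p < real DIM(real ^ 'n)" unfolding N using pH by (simp add: mult.commute)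
  have l: "lam = \<alpha> powr (p - 1) * (real DIM(real ^ 'n) - p - \<alpha> * (p - 1))"
  proof -
    have b: "H powr p = H powr (p - 1) * H" "\<beta> powr p = \<beta> powr (p - 1) * \<beta>"
      using powr_minus_1_times H0 \<beta> by simp_all
    have "lam = (H powr (p - 1) * \<beta> powr (p - 1)) * (p * H - H * \<beta> * (p - 1))"
      unfolding lam H_def[symmetric] hardy_profile_def b by (simp add: algebra_simps)
    also have "H powr (p - 1) * \<beta> powr (p - 1) = \<alpha> powr (p - 1)" unfolding \<alpha>_def powr_mult ..
    finally show ?thesis unfolding pH N \<alpha>_def .
  qed
  obtain u where u: "weak_solution p lam \<Omega> g f u" "\<And>s. 0 \<le> s \<Longrightarrow> \<alpha> * s < real DIM(real ^ 'n) \<Longrightarrow> u \<in> Lp_space s \<Omega>"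
    by (rule existence_and_summability[OF D assms(8) a0 a1 l]) (rule that)
  have "u \<in> Lp_space s \<Omega>" if s: "s \<in> {sobolev_conj N p..<s_lambda N p lam}" for s
  proof (rule u(2))
    have P0: "sobolev_conj N p > 0" unfolding sobolev_conj_def using assms by simp
    then show "0 \<le> s" using s by simp
    have "s < sobolev_conj N p / \<beta>" using s sl by simp
    then have "\<alpha> * s < \<alpha> * (sobolev_conj N p / \<beta>)" using a0 by (rule mult_strict_left_mono)
    \<comment> \<open>H times the critical exponent is N, so the summability condition \<alpha> s <
      N is precisely s < s_lambda.\<close>
    also have "\<dots> = N" unfolding \<alpha>_def H_def hardy_H_def sobolev_conj_def using assms \<beta> by simp
    finally show "\<alpha> * s < real DIM(real ^ 'n)" unfolding N .
  qed
  with u(1) show ?thesis unfolding ch by auto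
qed

end
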